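(* Let $N\ge3$, $0<s_i<2$ and $\lambda_i\in\mathbb{R}$, $\lambda_i\ne0$, for $i=1,2,\dots,l$, and set $s_0=0$, $\lambda_0=1$. Then any nonnegative $u\in D_0^{1,2}(\mathbb{R}^N)$ satisfying $$\int_{\mathbb{R}^N}\nabla u\cdot\nabla\varphi\,dx=\sum_{i=0}^{l}\lambda_i\int_{\mathbb{R}^N}\frac{u^{2^*(s_i)-1}\varphi}{|x|^{s_i}}\,dx\qquad\text{for all }\varphi\in D_0^{1,2}(\mathbb{R}^N)$$ is of class $L^\infty_{loc}(\mathbb{R}^N)$.
   Context: Notation: $2^*(s):=\frac{2(N-s)}{N-2}$ (so $2^*(0)=2^*=\frac{2N}{N-2}$). $D_0^{1,2}(\mathbb{R}^N)$ is the completion of $C_c^\infty(\mathbb{R}^N)$ under $\|u\|:=\left(\int_{\mathbb{R}^N}|\nabla u|^2dx\right)^{1/2}$. *)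

theory Defs
  imports "HOL-Analysis.Analysis"
begin

definition partial_deriv :: "'n::finite \<Rightarrow> (real ^ 'n \<Rightarrow> real) \<Rightarrow> real ^ 'n \<Rightarrow> real" where
  "partial_deriv i f x = frechet_derivative f (at x) (axis i 1)"

definition gradient :: "(real ^ 'n::finite \<Rightarrow> real) \<Rightarrow> real ^ 'n \<Rightarrow> real ^ 'n" where
  "gradient f x = (\<chi> i. partial_deriv i f x)"

primrec Ck :: "nat \<Rightarrow> (real ^ 'n::finite \<Rightarrow> real) \<Rightarrow> bool" where
  "Ck 0 f \<longleftrightarrow> continuous_on UNIV f"
| "Ck (Suc k) f \<longleftrightarrow> (\<forall>x. f differentiable (at x)) \<and> (\<forall>i. Ck k (partial_deriv i f))"

definition test_functions :: "(real ^ 'n::finite \<Rightarrow> real) set" where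
  "test_functions = {f. (\<forall>k. Ck k f) \<and> compact (closure {x. f x \<noteq> 0})}"

definition crit_exp :: "nat \<Rightarrow> real \<Rightarrow> real" where
  "crit_exp N s = 2 * (real N - s) / (real N - 2)"

definition grad_norm :: "(real ^ 'n::finite \<Rightarrow> real) \<Rightarrow> real" where
  "grad_norm f = sqrt (\<integral>x. (norm (gradient f x))\<^sup>2 \<partial>lebesgue)"

(* The completion of the test functions under grad_norm, realised as a space of
   functions: by the Sobolev inequality (dimension at least 3) every sequence of
   test functions that is Cauchy for grad_norm converges in L^p, p = crit_exp N 0,
   and the element of the completion it represents is identified with its L^p
   limit. Elements are functions rather than almost-everywhere classes; D12 is
   closed under changes on null sets. *)
definition D12 :: "(real ^ 'n::finite \<Rightarrow> real) set" where
  "D12 = {u \<in> borel_measurable lebesgue.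
     \<exists>f :: nat \<Rightarrow> real ^ 'n \<Rightarrow> real.
       (\<forall>k. f k \<in> test_functions) \<and>
       (\<forall>e>0. \<exists>M. \<forall>m\<ge>M. \<forall>n\<ge>M. grad_norm (\<lambda>x. f m x - f n x) < e) \<and>
       (\<lambda>k. \<integral>\<^sup>+x. ennreal (\<bar>f k x - u x\<bar> powr crit_exp CARD('n) 0) \<partial>lebesgue)
         \<longlonglongrightarrow> 0}"

definition has_weak_gradient ::
    "(real ^ 'n::finite \<Rightarrow> real) \<Rightarrow> (real ^ 'n \<Rightarrow> real ^ 'n) \<Rightarrow> bool" where
  "has_weak_gradient u G \<longleftrightarrow>
     (\<forall>K. compact K \<longrightarrow> set_integrable lebesgue K u \<and> set_integrable lebesgue K G) \<and>
     (\<forall>\<psi>\<in>test_functions. \<forall>i.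
        (\<integral>x. u x * partial_deriv i \<psi> x \<partial>lebesgue) = - (\<integral>x. G x $ i * \<psi> x \<partial>lebesgue))"

(* A weak gradient is unique up to a null set, so integrals involving weak_grad do
   not depend on the choice. Every element of D12 has one, namely the L^2 limit of
   the gradients of an approximating sequence. *)
definition weak_grad :: "(real ^ 'n::finite \<Rightarrow> real) \<Rightarrow> real ^ 'n \<Rightarrow> real ^ 'n" where
  "weak_grad u = (SOME G. has_weak_gradient u G)"

definition Linf_loc :: "(real ^ 'n::finite \<Rightarrow> real) set" where
  "Linf_loc = {u \<in> borel_measurable lebesgue.
     \<forall>K. compact K \<longrightarrow> (\<exists>C. AE x in lebesgue. x \<in> K \<longrightarrow> \<bar>u x\<bar> \<le> C)}"

end

theory Submission
  imports Defs
begin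

text \<open>
The argument avoids the Sobolev inequality and nonlinear test functions. Testing with a cut-off of
$(|y-x|^2+\varepsilon^2)^{(2-N)/2}$, which is superharmonic up to an error of size $R^{-2}|y-x|^{2-N}$,
and letting $R\to\infty$ bounds the average of $u$ over the ball of radius $\varepsilon$ around $x$ by
a multiple of the Riesz potential $I_2f(x)$ of $f=\sum_i|\lambda_i|u^{2^*(s_i)-1}|x|^{-s_i}$; as
$\varepsilon\to0$ this gives $u\le C\,I_2f$ almost everywhere. By Young's inequality
$f\le(\varepsilon|x|^{-2}+C_\varepsilon u^{4/(N-2)})u$, where both potentials lie in weak $L^{N/2}$ and,
after removing the part where $u$ is bounded, have small weak norm. Multiplication by such a potential
followed by $I_2$ is a contraction of weak $L^p$ for every $p>N/(N-2)$, so iterating $u\le Tu+F$ puts $u$ into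
weak $L^p$ for all finite $p\ge2^*$. As $s_i<2$, the function $f$ is then good enough for $I_2f$ to be bounded.
\<close>

text \<open>The problem is critical: multiplying by a potential in weak \<open>L^(N/2)\<close> costs
  exactly the exponent 2/N that the Riesz potential gains, so iterating the integral inequality does
  not by itself improve the exponent. Only smallness of the potential helps, and then the term T u
  has to be absorbed in a space to which u is not yet known to belong. This is why T must be a
  contraction at two exponents at once: at the known one, where the iterates of u die out, and at
  the wanted one, where the source terms add up like a geometric series. Weak spaces enter because
  \<open>|x|^(-2)\<close> does not lie in \<open>L^(N/2)\<close> itself. Measuring them by integrals
  over sets has the further advantage that Hoelder's inequality and the potential estimate both
  reduce to splitting a one-dimensional integral at a single point. Since only an upper bound for a
  nonnegative u is sought, the coefficients may be replaced by their absolute values. The shift by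
  \<epsilon> and a cut-off that is flat at its edge make the kernel an admissible smooth test
  function.\<close>

section \<open>Weak Lebesgue spaces and the Riesz potential\<close>

text \<open>For $\theta=1-1/r$ with $r>1$ the best constant $C$ is a norm on weak $L^r$; being countably
  subadditive, it is handier here than the quasinorm given by the distribution function.\<close>

definition weak_bound :: "real \<Rightarrow> real \<Rightarrow> ('a::euclidean_space \<Rightarrow> ennreal) \<Rightarrow> bool" where
  "weak_bound \<theta> C h \<longleftrightarrow> h \<in> borel_measurable borel \<and>
     (\<forall>A\<in>sets borel. emeasure lborel A < \<infinity> \<longrightarrow>
        (\<integral>\<^sup>+x\<in>A. h x \<partial>lborel) \<le> ennreal (C * measure lborel A powr \<theta>))"

abbreviation ball_int :: "('a::euclidean_space \<Rightarrow> ennreal) \<Rightarrow> 'a \<Rightarrow> real \<Rightarrow> ennreal" where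
  "ball_int h x t \<equiv> (\<integral>\<^sup>+y. h y * indicator {y. dist x y < t} y \<partial>lborel)"

text \<open>The set S of radii is a parameter so that the truncations to \<open>{0..1}\<close>,
  \<open>{1..}\<close> and \<open>{0..R}\<close> are treated alongside the full potential. Writing
  the kernel as an integral over balls turns every estimate into a bound on \<open>ball_int\<close>
  that is then integrated in t.\<close>

abbreviation riesz_on :: "real set \<Rightarrow> ('a::euclidean_space \<Rightarrow> ennreal) \<Rightarrow> 'a \<Rightarrow> ennreal" where
  "riesz_on S h x \<equiv> (\<integral>\<^sup>+t. indicator S t * ennreal (t powr (1 - real DIM('a))) * ball_int h x t \<partial>lborel)"

text \<open>Integrating $t^{1-N}$ over $t>|x-y|$ shows that this is $(N-2)^{-1}\int h(y)|x-y|^{2-N}\,dy$.\<close>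

definition riesz :: "('a::euclidean_space \<Rightarrow> ennreal) \<Rightarrow> 'a \<Rightarrow> ennreal" where
  "riesz h x = riesz_on {0..} h x"

lemma nn_integral_powr_0:
  assumes "b > -1" "T \<ge> 0"
  shows "(\<integral>\<^sup>+t. indicator {0..T} t * ennreal (t powr b) \<partial>lborel) = ennreal (T powr (b+1) / (b+1))"
  using nn_integral_has_integral_lebesgue[OF _ has_integral_powr_from_0[OF assms]]
  by (simp add: ennreal_mult' ennreal_indicator[symmetric] del: ennreal_indicator)

lemma nn_integral_powr_inf:
  assumes "b < -1" "T > 0"
  shows "(\<integral>\<^sup>+t. indicator {T..} t * ennreal (t powr b) \<partial>lborel) = ennreal (- (T powr (b+1) / (b+1)))"
  using nn_integral_has_integral_lebesgue[OF _ has_integral_powr_to_inf[OF assms]]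
  by (simp add: ennreal_mult' ennreal_indicator[symmetric] del: ennreal_indicator)

section \<open>Calculus of weak bounds\<close>

lemma weak_boundD:
  assumes "weak_bound \<theta> C h" "A \<in> sets borel" "emeasure lborel A < \<infinity>"
  shows "(\<integral>\<^sup>+x\<in>A. h x \<partial>lborel) \<le> ennreal (C * measure lborel A powr \<theta>)"
  using assms unfolding weak_bound_def by auto

text \<open>For \<theta> \<ge> 0 the bound is monotone in the measure, so an upper estimate of the
  measure of A can be inserted.\<close>

lemma weak_boundD':
  assumes "weak_bound \<theta> C h" "A \<in> sets borel" "emeasure lborel A \<le> ennreal m" "0 \<le> \<theta>" "0 \<le> C" "0 \<le> m"
  shows "(\<integral>\<^sup>+x\<in>A. h x \<partial>lborel) \<le> ennreal (C * m powr \<theta>)"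
proof -
  have fin: "emeasure lborel A < \<infinity>" using assms(3) by (simp add: le_less_trans)
  have "measure lborel A \<le> m" using assms(3,6) fin
    by (metis emeasure_eq_ennreal_measure ennreal_le_iff infinity_ennreal_def less_irrefl)
  then have "C * measure lborel A powr \<theta> \<le> C * m powr \<theta>"
    using assms by (intro mult_left_mono powr_mono2) auto
  then show ?thesis using weak_boundD[OF assms(1,2) fin] by (meson ennreal_leI order_trans)
qed

lemma weak_bound_measurable: "weak_bound \<theta> C h \<Longrightarrow> h \<in> borel_measurable borel"
  by (simp add: weak_bound_def)

text \<open>This is the endpoint r = \<infinity>. Inserted for g in \<open>weak_bound_mult\<close>,
  it turns a bound on the distribution function of V into a weak bound on V itself.\<close>

lemma weak_bound_one: "weak_bound 1 1 (\<lambda>_. 1 :: ennreal)"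
  unfolding weak_bound_def
  by (auto simp: emeasure_eq_ennreal_measure)

lemma weak_bound_mono_const: "weak_bound \<theta> C h \<Longrightarrow> C \<le> C' \<Longrightarrow> weak_bound \<theta> C' h"
  unfolding weak_bound_def by (meson ennreal_leI mult_right_mono order_trans powr_ge_zero)

lemma weak_bound_mono:
  assumes "weak_bound \<theta> C h" "g \<in> borel_measurable borel" "AE x in lborel. g x \<le> h x"
  shows "weak_bound \<theta> C g"
  unfolding weak_bound_def
proof (intro conjI ballI impI)
  fix A :: "'a set" assume A: "A \<in> sets borel" "emeasure lborel A < \<infinity>"
  have "(\<integral>\<^sup>+x\<in>A. g x \<partial>lborel) \<le> (\<integral>\<^sup>+x\<in>A. h x \<partial>lborel)"
    using assms(3) by (intro nn_integral_mono_AE) (auto elim!: eventually_mono intro: mult_right_mono)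
  then show "(\<integral>\<^sup>+x\<in>A. g x \<partial>lborel) \<le> ennreal (C * measure lborel A powr \<theta>)"
    using weak_boundD[OF assms(1) A] by order
qed fact

lemma weak_bound_add:
  assumes "weak_bound \<theta> C h" "weak_bound \<theta> D g" "0 \<le> C" "0 \<le> D"
  shows "weak_bound \<theta> (C + D) (\<lambda>x. h x + g x)"
  unfolding weak_bound_def
proof (intro conjI ballI impI)
  have [measurable]: "h \<in> borel_measurable borel" "g \<in> borel_measurable borel"
    using assms by (auto simp: weak_bound_def)
  show "(\<lambda>x. h x + g x) \<in> borel_measurable borel" by simp
  fix A :: "'a set" assume A: "A \<in> sets borel" "emeasure lborel A < \<infinity>"
  have [measurable]: "A \<in> sets borel" by fact
  have "(\<integral>\<^sup>+x\<in>A. (h x + g x) \<partial>lborel)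
      = (\<integral>\<^sup>+x\<in>A. h x \<partial>lborel) + (\<integral>\<^sup>+x\<in>A. g x \<partial>lborel)"
    by (subst nn_integral_add[symmetric]) (auto simp: distrib_right)
  also have "\<dots> \<le> ennreal (C * measure lborel A powr \<theta>) + ennreal (D * measure lborel A powr \<theta>)"
    by (intro add_mono weak_boundD assms A)
  also have "\<dots> = ennreal ((C + D) * measure lborel A powr \<theta>)"
    using assms by (simp add: ennreal_plus[symmetric] distrib_right del: ennreal_plus)
  finally show "(\<integral>\<^sup>+x\<in>A. (h x + g x) \<partial>lborel) \<le> ennreal ((C + D) * measure lborel A powr \<theta>)" .
qed

lemma weak_bound_cmult:
  assumes "weak_bound \<theta> C h" "0 \<le> C" "0 \<le> c"
  shows "weak_bound \<theta> (c * C) (\<lambda>x. ennreal c * h x)"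
  unfolding weak_bound_def
proof (intro conjI ballI impI)
  have [measurable]: "h \<in> borel_measurable borel"
    using assms by (auto simp: weak_bound_def)
  show "(\<lambda>x. ennreal c * h x) \<in> borel_measurable borel" by simp
  fix A :: "'a set" assume A: "A \<in> sets borel" "emeasure lborel A < \<infinity>"
  have [measurable]: "A \<in> sets borel" by fact
  have "(\<integral>\<^sup>+x\<in>A. (ennreal c * h x) \<partial>lborel)
      = ennreal c * (\<integral>\<^sup>+x\<in>A. h x \<partial>lborel)"
    by (subst nn_integral_cmult[symmetric]) (auto simp: mult.assoc)
  also have "\<dots> \<le> ennreal c * ennreal (C * measure lborel A powr \<theta>)"
    by (intro mult_left_mono weak_boundD assms A) auto
  also have "\<dots> = ennreal (c * C * measure lborel A powr \<theta>)"
    using assms by (simp add: ennreal_mult'[symmetric] mult.assoc)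
  finally show "(\<integral>\<^sup>+x\<in>A. (ennreal c * h x) \<partial>lborel) \<le> ennreal (c * C * measure lborel A powr \<theta>)" .
qed

text \<open>Hoelder's inequality between weak spaces: V lies in weak \<open>L^a\<close>, and the
  reciprocal exponents add up because \<theta> = 1 - 1/r. Slicing V into its superlevel sets leaves
  integrals of g over the part of A where V > t, whose measure is at most that of A and at most
  \<kappa> \<open>t^(-a)\<close>. The condition a\<theta> > 1 makes the second bound integrable at
  infinity.\<close>

lemma weak_bound_mult:
  fixes V :: "'a::euclidean_space \<Rightarrow> real" and g :: "'a \<Rightarrow> ennreal"
  assumes [measurable]: "V \<in> borel_measurable borel" and V0: "\<And>x. 0 \<le> V x"
    and dist: "\<And>t. t > 0 \<Longrightarrow> emeasure lborel {x. V x > t} \<le> ennreal (\<kappa> * t powr - a)"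
    and \<kappa>: "\<kappa> > 0" and a: "a > 0" and a\<theta>: "a * \<theta> > 1"
    and g: "weak_bound \<theta> C g" and C: "0 \<le> C"
  shows "weak_bound (\<theta> - 1/a) (C * \<kappa> powr (1/a) * (1 + 1 / (a*\<theta> - 1))) (\<lambda>x. ennreal (V x) * g x)"
  unfolding weak_bound_def
proof (intro conjI ballI impI)
  have [measurable]: "g \<in> borel_measurable borel"
    using g by (auto simp: weak_bound_def)
  show "(\<lambda>x. ennreal (V x) * g x) \<in> borel_measurable borel" by simp
  fix A :: "'a set" assume A: "A \<in> sets borel" "emeasure lborel A < \<infinity>"
  have [measurable]: "A \<in> sets borel" by fact
  define m where "m = measure lborel A"
  have em: "emeasure lborel A = ennreal m" using A by (simp add: m_def emeasure_eq_ennreal_measure)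
  have \<theta>: "\<theta> > 0" using a a\<theta> by (metis mult_pos_neg mult_zero_right not_less_iff_gr_or_eq zero_less_one order_less_trans)
  show "(\<integral>\<^sup>+x\<in>A. (ennreal (V x) * g x) \<partial>lborel)
      \<le> ennreal (C * \<kappa> powr (1/a) * (1 + 1 / (a*\<theta> - 1)) * measure lborel A powr (\<theta> - 1/a))"
  proof (cases "m = 0")
    case True
    then have "emeasure lborel A = 0" using em by simp
    then have "A \<in> null_sets lborel" by (simp add: null_setsI)
    then show ?thesis by (simp add: nn_integral_null_set)
  next
    case False
    then have m: "m > 0" by (simp add: m_def less_le)
    \<comment> \<open>The level at which the two bounds on the measure coincide: \<kappa>
      \<open>T^(-a)\<close> = m.\<close>
    define T where "T = (\<kappa> / m) powr (1/a)"
    have T: "T > 0" using m \<kappa> by (simp add: T_def)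
    define G where "G t = (\<integral>\<^sup>+x. g x * indicator (A \<inter> {x. V x > t}) x \<partial>lborel)" for t
    have "(\<integral>\<^sup>+x\<in>A. (ennreal (V x) * g x) \<partial>lborel)
        = (\<integral>\<^sup>+x. (\<integral>\<^sup>+t. g x * indicator A x * indicator {0..<V x} t \<partial>lborel) \<partial>lborel)"
    proof (intro nn_integral_cong)
      fix x :: 'a
      have "(\<integral>\<^sup>+t. g x * indicator A x * indicator {0..<V x} t \<partial>lborel) = g x * indicator A x * ennreal (V x)"
        using V0[of x] by (subst nn_integral_cmult) auto
      then show "ennreal (V x) * g x * indicator A x = (\<integral>\<^sup>+t. g x * indicator A x * indicator {0..<V x} t \<partial>lborel)"
        by (simp add: mult_ac)
    qed
    also have "\<dots> = (\<integral>\<^sup>+x. (\<integral>\<^sup>+t. g x * indicator A x * indicator {0..} t * indicator {x. V x > t} x \<partial>lborel) \<partial>lborel)"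
      by (intro nn_integral_cong) (auto split: split_indicator)
    also have "\<dots> = (\<integral>\<^sup>+t. (\<integral>\<^sup>+x. g x * indicator A x * indicator {0..} t * indicator {x. V x > t} x \<partial>lborel) \<partial>lborel)"
      by (intro lborel_pair.Fubini') measurable
    also have "\<dots> = (\<integral>\<^sup>+t. indicator {0..} t * G t \<partial>lborel)"
      unfolding G_def
      by (intro nn_integral_cong, subst nn_integral_cmult[symmetric]) (auto split: split_indicator intro!: nn_integral_cong)
    also have "\<dots> \<le> (\<integral>\<^sup>+t. indicator {0..T} t * ennreal (C * m powr \<theta>)
          + ennreal (C * \<kappa> powr \<theta>) * (indicator {T..} t * ennreal (t powr (- a * \<theta>))) \<partial>lborel)"
    proof (intro nn_integral_mono)
      fix t :: real
      have 1: "G t \<le> ennreal (C * m powr \<theta>)" unfolding G_def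
      proof (rule weak_boundD'[OF g])
        show "emeasure lborel (A \<inter> {x. V x > t}) \<le> ennreal m"
          unfolding em[symmetric] by (intro emeasure_mono) auto
      qed (use \<theta> C m in auto)
      have 2: "G t \<le> ennreal (C * \<kappa> powr \<theta>) * ennreal (t powr (- a * \<theta>))" if "t \<ge> T"
      proof -
        have t: "t > 0" using that T by simp
        have "G t \<le> ennreal (C * (\<kappa> * t powr - a) powr \<theta>)" unfolding G_def
        proof (rule weak_boundD'[OF g])
          have "emeasure lborel (A \<inter> {x. V x > t}) \<le> emeasure lborel {x. V x > t}"
            by (intro emeasure_mono) auto
          then show "emeasure lborel (A \<inter> {x. V x > t}) \<le> ennreal (\<kappa> * t powr - a)"
            using dist[OF t] by order
        qed (use \<theta> C \<kappa> in auto)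
        also have "C * (\<kappa> * t powr - a) powr \<theta> = C * \<kappa> powr \<theta> * t powr (- a * \<theta>)"
          using \<kappa> by (simp add: powr_mult powr_powr)
        finally show ?thesis using C by (simp add: ennreal_mult'[symmetric])
      qed
      show "indicator {0..} t * G t \<le> indicator {0..T} t * ennreal (C * m powr \<theta>)
          + ennreal (C * \<kappa> powr \<theta>) * (indicator {T..} t * ennreal (t powr (- a * \<theta>)))"
        using 1 2 T by (cases "t \<le> T"; cases "t = T") (auto split: split_indicator simp: add_increasing2)
    qed
    also have "\<dots> = ennreal (C * m powr \<theta>) * ennreal T
        + ennreal (C * \<kappa> powr \<theta>) * ennreal (- (T powr (- a*\<theta> + 1) / (- a*\<theta> + 1)))"
    proof -
      have "(\<integral>\<^sup>+t. indicator {0..T} t * ennreal (C * m powr \<theta>) \<partial>lborel) = ennreal (C * m powr \<theta>) * ennreal T"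
        using T by (subst nn_integral_multc) (auto simp: mult.commute)
      moreover have "(\<integral>\<^sup>+t. ennreal (C * \<kappa> powr \<theta>) * (indicator {T..} t * ennreal (t powr (- a * \<theta>))) \<partial>lborel)
        = ennreal (C * \<kappa> powr \<theta>) * ennreal (- (T powr (- a*\<theta> + 1) / (- a*\<theta> + 1)))"
        using a\<theta> T by (subst nn_integral_cmult) (auto simp: nn_integral_powr_inf simp del: ennreal_minus_if)
      ultimately show ?thesis by (subst nn_integral_add) auto
    qed
    also have "\<dots> = ennreal (C * m powr \<theta> * T + C * \<kappa> powr \<theta> * (T powr (- a*\<theta> + 1) / (a*\<theta> - 1)))"
    proof -
      have e: "- (T powr (- a*\<theta> + 1) / (- a*\<theta> + 1)) = T powr (- a*\<theta> + 1) / (a*\<theta> - 1)"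
        using a\<theta> by (simp add: field_simps)
      show ?thesis unfolding e using C T a\<theta> 
        by (simp add: ennreal_mult'[symmetric] ennreal_plus[symmetric] del: ennreal_plus)
    qed
    also have "C * m powr \<theta> * T + C * \<kappa> powr \<theta> * (T powr (- a*\<theta> + 1) / (a*\<theta> - 1))
        = C * \<kappa> powr (1/a) * (1 + 1 / (a*\<theta> - 1)) * m powr (\<theta> - 1/a)"
    proof -
      have "T powr (- a*\<theta> + 1) = T * (T powr a) powr - \<theta>"
        using T by (simp add: powr_powr powr_add powr_diff powr_minus divide_simps)
      also have "T powr a = \<kappa> / m" using m \<kappa> a by (simp add: T_def powr_powr)
      also have "(\<kappa>/m) powr - \<theta> = m powr \<theta> / \<kappa> powr \<theta>"
        using m \<kappa> by (simp add: powr_minus powr_divide)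
      finally have 1: "\<kappa> powr \<theta> * T powr (- a*\<theta> + 1) = T * m powr \<theta>"
        using \<kappa> by simp
      have 2: "T * m powr \<theta> = \<kappa> powr (1/a) * m powr (\<theta> - 1/a)"
        using m \<kappa> by (simp add: T_def powr_divide powr_diff)
      have "C * m powr \<theta> * T + C * \<kappa> powr \<theta> * (T powr (- a*\<theta> + 1) / (a*\<theta> - 1))
        = C * (T * m powr \<theta>) + C * (\<kappa> powr \<theta> * T powr (- a*\<theta> + 1)) / (a*\<theta> - 1)" by simp
      also have "\<dots> = C * (T * m powr \<theta>) * (1 + 1 / (a*\<theta> - 1))" unfolding 1 by (simp add: field_simps)
      finally show ?thesis unfolding 2 by (simp add: mult_ac)
    qed
    finally show ?thesis by (simp add: m_def)
  qed
qed

section \<open>The Riesz potential: algebra, ball integrals and mapping properties\<close>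

lemma riesz_measurable [measurable]:
  fixes h :: "'a::euclidean_space \<Rightarrow> ennreal"
  assumes [measurable]: "h \<in> borel_measurable borel"
  shows "riesz h \<in> borel_measurable borel"
proof -
  have "(\<lambda>x. \<integral>\<^sup>+t. indicator {0..} t * ennreal (t powr (1 - real DIM('a))) *
      ball_int h x t \<partial>lborel) \<in> borel_measurable (borel :: 'a measure)"
    by measurable
  then show ?thesis by (simp add: riesz_def[abs_def])
qed

lemma riesz_mono:
  assumes "AE x in lborel. h x \<le> g x"
  shows "riesz h x \<le> riesz g x"
  unfolding riesz_def using assms
  by (intro nn_integral_mono mult_left_mono nn_integral_mono_AE)
     (auto elim!: eventually_mono intro!: mult_right_mono)

lemma riesz_add:
  assumes [measurable]: "h \<in> borel_measurable borel" "g \<in> borel_measurable borel"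
  shows "riesz (\<lambda>y. h y + g y) x = riesz h x + riesz g x"
  unfolding riesz_def
  by (subst nn_integral_add[symmetric]; (simp add: distrib_right distrib_left)?)
     (auto simp: nn_integral_add distrib_left)

lemma riesz_sum:
  assumes "finite I" "\<And>i. i \<in> I \<Longrightarrow> h i \<in> borel_measurable borel"
  shows "riesz (\<lambda>y. \<Sum>i\<in>I. h i y) x = (\<Sum>i\<in>I. riesz (h i) x)"
  using assms
proof (induction I rule: finite_induct)
  case empty
  then show ?case by (simp add: riesz_def)
next
  case (insert a I)
  then show ?case by (simp add: riesz_add)
qed

lemma riesz_cmult:
  assumes [measurable]: "h \<in> borel_measurable borel"
  shows "riesz (\<lambda>y. c * h y) x = c * riesz h x"
  unfolding riesz_def
  by (subst nn_integral_cmult[symmetric]; (simp add: mult_ac)?)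
     (auto simp: nn_integral_cmult mult_ac)

lemma emeasure_dist_ball:
  "t \<ge> 0 \<Longrightarrow> emeasure lborel {y::'a::euclidean_space. dist x y < t}
      = ennreal (unit_ball_vol (real DIM('a)) * t powr real DIM('a))"
  using emeasure_ball[of t x] by (cases "t = 0") (auto simp: ball_def powr_realpow)

lemma ball_integral_le_1:
  fixes h :: "'a::euclidean_space \<Rightarrow> ennreal"
  assumes h: "weak_bound \<theta> C h" and C: "0 \<le> C" and \<theta>: "0 \<le> \<theta>" and t: "0 \<le> t"
  shows "ball_int h x t
    \<le> ennreal (C * (unit_ball_vol (real DIM('a)) * t powr real DIM('a)) powr \<theta>)"
  using t by (intro weak_boundD'[OF h]) (auto simp: emeasure_dist_ball C \<theta>)

text \<open>By Fubini and the substitution y = x + z this is an integral over |z| < t of integrals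
  of h over translates of A, and each translate has the measure of A. This is the better estimate
  for radii that are small compared with A, while \<open>ball_integral_le_1'\<close> is better for
  large radii.\<close>

lemma ball_integral_le_2:
  fixes h :: "'a::euclidean_space \<Rightarrow> ennreal"
  assumes h: "weak_bound \<theta> C h" and C: "0 \<le> C" and t: "0 \<le> t"
    and A: "A \<in> sets borel" "emeasure lborel A < \<infinity>"
  shows "(\<integral>\<^sup>+x\<in>A. ball_int h x t \<partial>lborel)
    \<le> ennreal (C * measure lborel A powr \<theta> * (unit_ball_vol (real DIM('a)) * t powr real DIM('a)))"
proof -
  note [measurable] = weak_bound_measurable[OF h] A(1)
  have "(\<integral>\<^sup>+x\<in>A. ball_int h x t \<partial>lborel)
      = (\<integral>\<^sup>+x. (\<integral>\<^sup>+z. h (x + z) * indicator {z. dist 0 z < t} z * indicator A x \<partial>lborel) \<partial>lborel)"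
  proof (intro nn_integral_cong)
    fix x :: 'a
    have "ball_int h x t
        = (\<integral>\<^sup>+y. h y * indicator {y. dist x y < t} y \<partial>(distr lborel borel ((+) x)))"
      by (simp add: lborel_distr_plus)
    also have "\<dots> = (\<integral>\<^sup>+z. h (x + z) * indicator {z. dist 0 z < t} z \<partial>lborel)"
      by (subst nn_integral_distr) (auto simp: dist_norm indicator_def)
    finally show "ball_int h x t * indicator A x
        = (\<integral>\<^sup>+z. h (x + z) * indicator {z. dist 0 z < t} z * indicator A x \<partial>lborel)"
      by (simp add: nn_integral_multc)
  qed
  also have "\<dots> = (\<integral>\<^sup>+z. (\<integral>\<^sup>+x\<in>A. h (x + z) * indicator {z. dist 0 z < t} z \<partial>lborel) \<partial>lborel)"
    by (intro lborel_pair.Fubini') measurable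
  also have "\<dots> \<le> (\<integral>\<^sup>+z. ennreal (C * measure lborel A powr \<theta>) * indicator {z::'a. dist 0 z < t} z \<partial>lborel)"
  proof (rule nn_integral_mono)
    fix z :: 'a
    have B [measurable]: "(\<lambda>x. x + - z) -` A \<in> sets borel"
      using measurable_sets[of "\<lambda>x. x + - z" borel borel A] A by simp
    have em: "emeasure lborel ((\<lambda>x. x + - z) -` A) = emeasure lborel A"
    proof -
      have "emeasure lborel A = emeasure (distr lborel borel ((+) (-z))) A" by (simp add: lborel_distr_plus)
      also have "\<dots> = emeasure lborel ((+) (-z) -` A)" by (subst emeasure_distr) auto
      also have "(+) (-z) = (\<lambda>x. x + - z)" by (auto simp: add.commute)
      finally show ?thesis by simp
    qed
    have "(\<integral>\<^sup>+x\<in>A. h (x + z) \<partial>lborel) = (\<integral>\<^sup>+x. h (z + x) * indicator ((\<lambda>x. x + - z) -` A) (z + x) \<partial>lborel)"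
      by (auto intro!: nn_integral_cong simp: indicator_def add.commute)
    also have "\<dots> = (\<integral>\<^sup>+x. h x * indicator ((\<lambda>x. x + - z) -` A) x \<partial>(distr lborel borel ((+) z)))"
      by (subst nn_integral_distr) auto
    also have "\<dots> \<le> ennreal (C * measure lborel ((\<lambda>x. x + - z) -` A) powr \<theta>)"
      unfolding lborel_distr_plus using A em B by (intro weak_boundD[OF h]) simp_all
    also have "measure lborel ((\<lambda>x. x + - z) -` A) = measure lborel A" by (simp only: measure_def em)
    finally show "(\<integral>\<^sup>+x\<in>A. h (x + z) * indicator {z. dist 0 z < t} z \<partial>lborel)
      \<le> ennreal (C * measure lborel A powr \<theta>) * indicator {z. dist 0 z < t} z"
      by (auto split: split_indicator)
  qed
  also have "\<dots> = ennreal (C * measure lborel A powr \<theta>) * ennreal (unit_ball_vol (real DIM('a)) * t powr real DIM('a))"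
    using t emeasure_dist_ball[of t "0::'a"] by (simp add: nn_integral_cmult)
  finally show ?thesis using C by (simp add: ennreal_mult'[symmetric])
qed

lemma ball_integral_le_1':
  fixes h :: "'a::euclidean_space \<Rightarrow> ennreal"
  assumes h: "weak_bound \<theta> C h" and C: "0 \<le> C" and \<theta>: "0 \<le> \<theta>" and t: "0 \<le> t"
    and A: "A \<in> sets borel" "emeasure lborel A < \<infinity>"
  shows "(\<integral>\<^sup>+x\<in>A. ball_int h x t \<partial>lborel)
    \<le> ennreal (C * (unit_ball_vol (real DIM('a)) * t powr real DIM('a)) powr \<theta> * measure lborel A)"
proof -
  note [measurable] = A(1)
  have "(\<integral>\<^sup>+x\<in>A. ball_int h x t \<partial>lborel)
     \<le> (\<integral>\<^sup>+x\<in>A. ennreal (C * (unit_ball_vol (real DIM('a)) * t powr real DIM('a)) powr \<theta>) \<partial>lborel)"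
    by (intro nn_integral_mono mult_right_mono ball_integral_le_1[OF h C \<theta> t]) auto
  also have "\<dots> = ennreal (C * (unit_ball_vol (real DIM('a)) * t powr real DIM('a)) powr \<theta>) * ennreal (measure lborel A)"
    using A by (subst nn_integral_cmult_indicator) (auto simp: emeasure_eq_ennreal_measure)
  finally show ?thesis using C by (simp add: ennreal_mult'[symmetric])
qed

lemma riesz_Fubini:
  fixes h :: "'a::euclidean_space \<Rightarrow> ennreal"
  assumes [measurable]: "h \<in> borel_measurable borel" "A \<in> sets borel"
  shows "(\<integral>\<^sup>+x\<in>A. riesz h x \<partial>lborel)
    = (\<integral>\<^sup>+t. indicator {0..} t * ennreal (t powr (1 - real DIM('a))) *
       (\<integral>\<^sup>+x\<in>A. ball_int h x t \<partial>lborel) \<partial>lborel)"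
proof -
  have "(\<integral>\<^sup>+x\<in>A. riesz h x \<partial>lborel)
     = (\<integral>\<^sup>+x. (\<integral>\<^sup>+t. indicator {0..} t * ennreal (t powr (1 - real DIM('a))) *
      ball_int h x t * indicator A x \<partial>lborel) \<partial>lborel)"
    unfolding riesz_def by (intro nn_integral_cong, subst nn_integral_multc) auto
  also have "\<dots> = (\<integral>\<^sup>+t. (\<integral>\<^sup>+x. indicator {0..} t * ennreal (t powr (1 - real DIM('a))) *
      ball_int h x t * indicator A x \<partial>lborel) \<partial>lborel)"
    by (intro lborel_pair.Fubini') measurable
  also have "\<dots> = (\<integral>\<^sup>+t. indicator {0..} t * ennreal (t powr (1 - real DIM('a))) *
       (\<integral>\<^sup>+x\<in>A. ball_int h x t \<partial>lborel) \<partial>lborel)"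
    by (intro nn_integral_cong, subst nn_integral_cmult[symmetric]) (auto simp: mult_ac)
  finally show ?thesis .
qed

text \<open>The weak form of the Hardy-Littlewood-Sobolev inequality. After exchanging the
  integrals, small radii are handled by \<open>ball_integral_le_2\<close>, which leaves the integral
  of t, and large radii by \<open>ball_integral_le_1'\<close>, which leaves that of
  \<open>t powr (1 - N + N * \<theta>)\<close>. The latter converges at infinity exactly when
  \<theta> + 2/N < 1.\<close>

lemma weak_bound_riesz:
  fixes h :: "'a::euclidean_space \<Rightarrow> ennreal"
  assumes h: "weak_bound \<theta> C h" and C: "0 \<le> C" and \<theta>: "0 \<le> \<theta>" and \<theta>2: "\<theta> + 2 / real DIM('a) < 1"
  shows "weak_bound (\<theta> + 2 / real DIM('a))
     (C * (unit_ball_vol (real DIM('a)) / 2 +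
       unit_ball_vol (real DIM('a)) powr \<theta> / (real DIM('a) - 2 - real DIM('a) * \<theta>))) (riesz h)"
  unfolding weak_bound_def
proof (intro conjI ballI impI)
  note [measurable] = weak_bound_measurable[OF h]
  show "riesz h \<in> borel_measurable borel" by simp
  fix A :: "'a set" assume A: "A \<in> sets borel" "emeasure lborel A < \<infinity>"
  note [measurable] = A(1)
  define m where "m = measure lborel A"
  define N where "N = real DIM('a)"
  define \<omega> where "\<omega> = unit_ball_vol N"
  have N: "N > 0" by (simp add: N_def)
  have \<omega>: "\<omega> > 0" by (simp add: \<omega>_def N_def)
  have N\<theta>: "N - 2 - N * \<theta> > 0" using \<theta>2 N by (simp add: N_def[symmetric] field_simps)
  have em: "emeasure lborel A = ennreal m" using A by (simp add: m_def emeasure_eq_ennreal_measure)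
  define Q where "Q t = (\<integral>\<^sup>+x\<in>A. ball_int h x t \<partial>lborel)" for t
  have "(\<integral>\<^sup>+x\<in>A. riesz h x \<partial>lborel) \<le> ennreal (C * (\<omega> / 2 + \<omega> powr \<theta> / (N - 2 - N * \<theta>)) * m powr (\<theta> + 2/N))"
  proof (cases "m = 0")
    case True
    then have "emeasure lborel A = 0" using em by simp
    then have "A \<in> null_sets lborel" by (simp add: null_setsI)
    then show ?thesis by (simp add: nn_integral_null_set)
  next
    case False
    then have m: "m > 0" by (simp add: m_def less_le)
    \<comment> \<open>A ball of radius T has measure comparable to m, so the two estimates of
      \<open>Q\<close> are of the same order there.\<close>
    define T where "T = m powr (1/N)"
    have T: "T > 0" using m by (simp add: T_def)
    have "(\<integral>\<^sup>+x\<in>A. riesz h x \<partial>lborel)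
        = (\<integral>\<^sup>+t. indicator {0..} t * ennreal (t powr (1 - N)) * Q t \<partial>lborel)"
      using A by (simp add: riesz_Fubini Q_def N_def)
    also have "\<dots> \<le> (\<integral>\<^sup>+t. ennreal (C * m powr \<theta> * \<omega>) * (indicator {0..T} t * ennreal (t powr 1))
          + ennreal (C * m * \<omega> powr \<theta>) * (indicator {T..} t * ennreal (t powr (1 - N + N * \<theta>))) \<partial>lborel)"
    proof (intro nn_integral_mono)
      fix t :: real
      have 1: "ennreal (t powr (1 - N)) * Q t \<le> ennreal (C * m powr \<theta> * \<omega>) * ennreal (t powr 1)" if t: "t \<ge> 0"
      proof (cases "t = 0")
        case False
        have "ennreal (t powr (1 - N)) * Q t \<le> ennreal (t powr (1 - N)) * ennreal (C * m powr \<theta> * (\<omega> * t powr N))"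
          using ball_integral_le_2[OF h C t A] by (intro mult_left_mono) (auto simp: Q_def m_def \<omega>_def N_def)
        also have "\<dots> = ennreal (C * m powr \<theta> * \<omega> * (t powr (1 - N) * t powr N))"
          using C by (simp add: ennreal_mult'[symmetric] mult_ac)
        also have "t powr (1 - N) * t powr N = t powr 1" by (simp add: powr_add[symmetric])
        finally show ?thesis using C \<omega> m by (simp add: ennreal_mult'[symmetric])
      qed simp
      have 2: "ennreal (t powr (1 - N)) * Q t \<le> ennreal (C * m * \<omega> powr \<theta>) * ennreal (t powr (1 - N + N * \<theta>))" if t: "t \<ge> T"
      proof -
        have "ennreal (t powr (1 - N)) * Q t \<le> ennreal (t powr (1 - N)) * ennreal (C * (\<omega> * t powr N) powr \<theta> * m)"
          using ball_integral_le_1'[OF h C \<theta> _ A, of t] T t by (intro mult_left_mono) (auto simp: Q_def m_def \<omega>_def N_def)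
        also have "\<dots> = ennreal (C * m * \<omega> powr \<theta> * (t powr (1 - N) * t powr (N * \<theta>)))"
          using C \<omega> m by (simp add: ennreal_mult'[symmetric] mult_ac powr_mult powr_powr)
        also have "t powr (1 - N) * t powr (N * \<theta>) = t powr (1 - N + N * \<theta>)" by (simp add: powr_add[symmetric])
        finally show ?thesis using C \<omega> m by (simp add: ennreal_mult'[symmetric])
      qed
      show "indicator {0..} t * ennreal (t powr (1 - N)) * Q t
        \<le> ennreal (C * m powr \<theta> * \<omega>) * (indicator {0..T} t * ennreal (t powr 1))
          + ennreal (C * m * \<omega> powr \<theta>) * (indicator {T..} t * ennreal (t powr (1 - N + N * \<theta>)))"
        using 1 2 T by (cases "t \<le> T"; cases "t = T"; cases "t \<ge> 0") (auto split: split_indicator simp: add_increasing2 simp del: powr_one)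
    qed
    also have "\<dots> = ennreal (C * m powr \<theta> * \<omega>) * ennreal (T powr 2 / 2)
        + ennreal (C * m * \<omega> powr \<theta>) * ennreal (- (T powr (2 - N + N * \<theta>) / (2 - N + N * \<theta>)))"
    proof -
      have "(\<integral>\<^sup>+t. ennreal (C * m powr \<theta> * \<omega>) * (indicator {0..T} t * ennreal (t powr 1)) \<partial>lborel)
          = ennreal (C * m powr \<theta> * \<omega>) * ennreal (T powr 2 / 2)"
        using nn_integral_powr_0[of 1 T] T by (subst nn_integral_cmult) (auto simp del: powr_one)
      moreover have "(\<integral>\<^sup>+t. ennreal (C * m * \<omega> powr \<theta>) * (indicator {T..} t * ennreal (t powr (1 - N + N * \<theta>))) \<partial>lborel)
          = ennreal (C * m * \<omega> powr \<theta>) * ennreal (- (T powr (2 - N + N * \<theta>) / (2 - N + N * \<theta>)))"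
        using nn_integral_powr_inf[of "1 - N + N * \<theta>" T] N\<theta> T
        by (subst nn_integral_cmult) (auto simp: algebra_simps)
      ultimately show ?thesis by (subst nn_integral_add) (auto simp del: powr_one)
    qed
    also have "\<dots> = ennreal (C * m powr \<theta> * \<omega> * (T powr 2 / 2) + C * m * \<omega> powr \<theta> * (T powr (2 - N + N * \<theta>) / (N - 2 - N * \<theta>)))"
    proof -
      have e: "- (T powr (2 - N + N * \<theta>) / (2 - N + N * \<theta>)) = T powr (2 - N + N * \<theta>) / (N - 2 - N * \<theta>)"
        using N\<theta> by (simp add: field_simps)
      show ?thesis unfolding e using C T N\<theta> \<omega> m
        by (simp add: ennreal_mult'[symmetric] ennreal_plus[symmetric] del: ennreal_plus)
    qed
    also have "C * m powr \<theta> * \<omega> * (T powr 2 / 2) + C * m * \<omega> powr \<theta> * (T powr (2 - N + N * \<theta>) / (N - 2 - N * \<theta>))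
        = C * (\<omega> / 2 + \<omega> powr \<theta> / (N - 2 - N * \<theta>)) * m powr (\<theta> + 2/N)"
    proof -
      have 1: "m powr \<theta> * T powr 2 = m powr (\<theta> + 2/N)"
        by (simp only: T_def powr_powr powr_add[symmetric]) simp
      have "m * T powr (2 - N + N * \<theta>) = m powr 1 * m powr (1 / N * (2 - N + N * \<theta>))"
        using m by (simp add: T_def powr_powr)
      also have "\<dots> = m powr (1 + 1 / N * (2 - N + N * \<theta>))" by (simp only: powr_add)
      also have "1 + 1 / N * (2 - N + N * \<theta>) = \<theta> + 2/N" using N by (simp add: field_simps)
      finally have 2: "m * T powr (2 - N + N * \<theta>) = m powr (\<theta> + 2/N)" .
      have "C * m powr \<theta> * \<omega> * (T powr 2 / 2) + C * m * \<omega> powr \<theta> * (T powr (2 - N + N * \<theta>) / (N - 2 - N * \<theta>))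
        = C * \<omega> * (m powr \<theta> * T powr 2) / 2 + C * \<omega> powr \<theta> * (m * T powr (2 - N + N * \<theta>)) / (N - 2 - N * \<theta>)" by (simp add: mult_ac)
      also have "\<dots> = C * (\<omega> / 2 + \<omega> powr \<theta> / (N - 2 - N * \<theta>)) * m powr (\<theta> + 2/N)"
        unfolding 1 2 by (simp add: distrib_left distrib_right)
      finally show ?thesis .
    qed
    finally show ?thesis .
  qed
  then show "(\<integral>\<^sup>+x\<in>A. riesz h x \<partial>lborel)
    \<le> ennreal (C * (unit_ball_vol (real DIM('a)) / 2 +
       unit_ball_vol (real DIM('a)) powr \<theta> / (real DIM('a) - 2 - real DIM('a) * \<theta>)) *
         measure lborel A powr (\<theta> + 2 / real DIM('a)))"
    by (simp add: m_def N_def \<omega>_def)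
qed

text \<open>As only an inequality is claimed, it suffices to keep the radii between d = |x - y| and
  2d: on this interval of length d the weight \<open>t^(1-N)\<close> is at least
  \<open>(2d)^(1-N)\<close>, whence the factor \<open>2^(N-1)\<close>. Keeping just these radii is
  what allows S to be bounded when P is.\<close>

lemma riesz_kernel_le:
  fixes h :: "'a::euclidean_space \<Rightarrow> ennreal"
  assumes [measurable]: "h \<in> borel_measurable borel" "S \<in> sets borel" "P \<in> sets borel"
    and P: "\<And>y. y \<in> P \<Longrightarrow> {dist x y<..2 * dist x y} \<subseteq> S"
  shows "(\<integral>\<^sup>+y. h y * ennreal (norm (x - y) powr (2 - real DIM('a))) * indicator P y \<partial>lborel)
    \<le> ennreal (2 powr (real DIM('a) - 1)) * riesz_on S h x"
proof -
  define \<beta> where "\<beta> = real DIM('a)"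
  have \<beta>: "\<beta> \<ge> 1" using DIM_positive[where 'a='a] by (simp add: \<beta>_def Suc_le_eq)
  have 1: "ennreal (norm (x - y) powr (2 - \<beta>)) * indicator P y
     \<le> (\<integral>\<^sup>+t. ennreal (2 powr (\<beta> - 1)) * (indicator S t * ennreal (t powr (1 - \<beta>))) * indicator {t. dist x y < t} t \<partial>lborel)" for y
  proof (cases "y \<in> P \<and> y \<noteq> x")
    case True
    define d where "d = dist x y"
    have d: "d > 0" using True by (auto simp: d_def)
    have "ennreal (norm (x - y) powr (2 - \<beta>)) = ennreal (2 powr (\<beta> - 1) * (2 * d) powr (1 - \<beta>) * d)"
    proof -
      have "(2 * d) powr (1 - \<beta>) = 2 powr (1 - \<beta>) * d powr (1 - \<beta>)" using d by (simp add: powr_mult)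
      moreover have "2 powr (\<beta> - 1) * 2 powr (1 - \<beta>) = (1::real)" by (simp add: powr_add[symmetric])
      moreover have "d powr (1 - \<beta>) * d = d powr (2 - \<beta>)" using d powr_add[of d "1 - \<beta>" 1] by simp
      ultimately have "2 powr (\<beta> - 1) * (2 * d) powr (1 - \<beta>) * d = d powr (2 - \<beta>)"
        by (metis mult.assoc mult.left_neutral)
      then show ?thesis by (simp add: d_def dist_norm)
    qed
    also have "\<dots> = (\<integral>\<^sup>+t. ennreal (2 powr (\<beta> - 1) * (2 * d) powr (1 - \<beta>)) * indicator {d<..2 * d} t \<partial>lborel)"
      using d by (subst nn_integral_cmult) (auto simp: ennreal_mult'[symmetric] nn_integral_indicator)
    also have "\<dots> \<le> (\<integral>\<^sup>+t. ennreal (2 powr (\<beta> - 1)) * (indicator S t * ennreal (t powr (1 - \<beta>))) * indicator {t. dist x y < t} t \<partial>lborel)"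
    proof (rule nn_integral_mono)
      fix t
      show "ennreal (2 powr (\<beta> - 1) * (2 * d) powr (1 - \<beta>)) * indicator {d<..2 * d} t
        \<le> ennreal (2 powr (\<beta> - 1)) * (indicator S t * ennreal (t powr (1 - \<beta>))) * indicator {t. dist x y < t} t"
      proof (cases "t \<in> {d<..2 * d}")
        case t: True
        then have "t \<in> S" using P[of y] True by (auto simp: d_def)
        moreover have "(2 * d) powr (1 - \<beta>) \<le> t powr (1 - \<beta>)" using t d \<beta> by (intro powr_mono2') auto
        ultimately show ?thesis using t by (auto simp: d_def ennreal_mult'[symmetric] intro!: ennreal_leI mult_left_mono)
      qed auto
    qed
    finally show ?thesis using True by simp
  qed auto
  have "(\<integral>\<^sup>+y. h y * ennreal (norm (x - y) powr (2 - \<beta>)) * indicator P y \<partial>lborel)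
    \<le> (\<integral>\<^sup>+y. h y * (\<integral>\<^sup>+t. ennreal (2 powr (\<beta> - 1)) * (indicator S t * ennreal (t powr (1 - \<beta>))) * indicator {t. dist x y < t} t \<partial>lborel) \<partial>lborel)"
    using 1 by (intro nn_integral_mono) (auto simp: mult.assoc intro!: mult_left_mono)
  also have "\<dots> = (\<integral>\<^sup>+y. (\<integral>\<^sup>+t. ennreal (2 powr (\<beta> - 1)) * (indicator S t * ennreal (t powr (1 - \<beta>))) * (h y * indicator {y. dist x y < t} y) \<partial>lborel) \<partial>lborel)"
    by (intro nn_integral_cong, subst nn_integral_cmult[symmetric]) (auto simp: mult_ac indicator_def intro!: nn_integral_cong)
  also have "\<dots> = (\<integral>\<^sup>+t. (\<integral>\<^sup>+y. ennreal (2 powr (\<beta> - 1)) * (indicator S t * ennreal (t powr (1 - \<beta>))) * (h y * indicator {y. dist x y < t} y) \<partial>lborel) \<partial>lborel)"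
    by (intro lborel_pair.Fubini') measurable
  also have "\<dots> = (\<integral>\<^sup>+t. ennreal (2 powr (\<beta> - 1)) * (indicator S t * ennreal (t powr (1 - \<beta>)) *
      ball_int h x t) \<partial>lborel)"
    by (intro nn_integral_cong, subst nn_integral_cmult) (auto simp: mult_ac)
  also have "\<dots> = ennreal (2 powr (\<beta> - 1)) * (\<integral>\<^sup>+t. indicator S t * ennreal (t powr (1 - \<beta>)) *
      ball_int h x t \<partial>lborel)"
    by (intro nn_integral_cmult) measurable
  finally show ?thesis by (simp add: \<beta>_def)
qed

text \<open>This serves to remove the cut-off error: there the truncated potential is multiplied by
  \<open>R^(-2)\<close>, so any growth strictly below \<open>R^2\<close> makes it vanish in the
  limit. The gain \<sigma> > 0 comes from \<theta> < 1, that is, from some finite integrability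
  exponent of h.\<close>

lemma truncated_riesz_growth:
  fixes h :: "'a::euclidean_space \<Rightarrow> ennreal"
  assumes h: "weak_bound \<theta> C h" and C: "0 \<le> C" and \<theta>: "0 \<le> \<theta>" "\<theta> < 1"
    and A: "A \<in> sets borel" "emeasure lborel A < \<infinity>"
  shows "\<exists>K \<sigma>. \<sigma> > 0 \<and> (\<forall>R\<ge>0.
    (\<integral>\<^sup>+x. riesz_on {0..R} h x * indicator A x \<partial>lborel)
    \<le> ennreal (K * R powr (2 - \<sigma>)))"
proof -
  note [measurable] = weak_bound_measurable[OF h] A(1)
  define N where "N = real DIM('a)"
  define \<omega> where "\<omega> = unit_ball_vol N"
  define m where "m = measure lborel A"
  have N: "N > 0" by (simp add: N_def)
  have \<omega>: "\<omega> > 0" by (simp add: \<omega>_def N_def)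
  \<comment> \<open>At most N(1 - \<theta>), so that \<open>t powr (N * \<theta>)\<close> is
    dominated for t \<ge> 1, and at most 1, so that 2 - \<sigma> stays positive.\<close>
  define \<sigma> where "\<sigma> = min 1 (N * (1 - \<theta>))"
  define K where "K = C * m powr \<theta> * \<omega> + C * \<omega> powr \<theta> * m"
  have \<sigma>: "\<sigma> > 0" "\<sigma> \<le> 1" "\<sigma> \<le> N * (1 - \<theta>)" using \<theta> N by (auto simp: \<sigma>_def)
  define Q where "Q t = (\<integral>\<^sup>+x\<in>A. ball_int h x t \<partial>lborel)" for t
  have m0: "m \<ge> 0" by (simp add: m_def)
  have Q: "Q t \<le> ennreal (K * t powr (N - \<sigma>))" if t: "t > 0" for t
  proof (cases "t \<le> 1")
    case True
    have "Q t \<le> ennreal (C * m powr \<theta> * (\<omega> * t powr N))"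
      using ball_integral_le_2[OF h C _ A, of t] t by (simp add: Q_def m_def \<omega>_def N_def)
    also have "\<dots> \<le> ennreal (C * m powr \<theta> * (\<omega> * t powr (N - \<sigma>)))"
      using True t \<sigma> C m0 \<omega> by (intro ennreal_leI mult_left_mono powr_mono') auto
    also have "\<dots> \<le> ennreal (K * t powr (N - \<sigma>))"
      using C \<omega> m0 by (intro ennreal_leI) (auto simp: K_def distrib_right)
    finally show ?thesis .
  next
    case False
    have "Q t \<le> ennreal (C * (\<omega> * t powr N) powr \<theta> * m)"
      using ball_integral_le_1'[OF h C \<theta>(1) _ A, of t] t by (simp add: Q_def m_def \<omega>_def N_def)
    also have "C * (\<omega> * t powr N) powr \<theta> * m = C * \<omega> powr \<theta> * m * t powr (N * \<theta>)"
      using \<omega> by (simp add: powr_mult powr_powr)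
    also have "ennreal \<dots> \<le> ennreal (C * \<omega> powr \<theta> * m * t powr (N - \<sigma>))"
      using False \<sigma> C m0 \<omega> by (intro ennreal_leI mult_left_mono powr_mono) (auto simp: algebra_simps)
    also have "\<dots> \<le> ennreal (K * t powr (N - \<sigma>))"
      using C \<omega> m0 by (intro ennreal_leI) (auto simp: K_def distrib_right)
    finally show ?thesis .
  qed
  have K: "K \<ge> 0" using C \<omega> m0 by (auto simp: K_def)
  have "(\<integral>\<^sup>+x. (\<integral>\<^sup>+t. indicator {0..R} t * ennreal (t powr (1 - N)) *
      ball_int h x t \<partial>lborel) * indicator A x \<partial>lborel)
    \<le> ennreal (K / (2 - \<sigma>) * R powr (2 - \<sigma>))" if R: "R \<ge> 0" for R
  proof -
    have "(\<integral>\<^sup>+x. (\<integral>\<^sup>+t. indicator {0..R} t * ennreal (t powr (1 - N)) *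
      ball_int h x t \<partial>lborel) * indicator A x \<partial>lborel)
     = (\<integral>\<^sup>+x. (\<integral>\<^sup>+t. indicator {0..R} t * ennreal (t powr (1 - N)) *
      ball_int h x t * indicator A x \<partial>lborel) \<partial>lborel)"
      by (intro nn_integral_cong, subst nn_integral_multc) auto
    also have "\<dots> = (\<integral>\<^sup>+t. (\<integral>\<^sup>+x. indicator {0..R} t * ennreal (t powr (1 - N)) *
      ball_int h x t * indicator A x \<partial>lborel) \<partial>lborel)"
      by (intro lborel_pair.Fubini') measurable
    also have "\<dots> = (\<integral>\<^sup>+t. indicator {0..R} t * ennreal (t powr (1 - N)) * Q t \<partial>lborel)"
      unfolding Q_def
      by (intro nn_integral_cong, subst nn_integral_cmult[symmetric]) (auto simp: mult_ac)
    also have "\<dots> \<le> (\<integral>\<^sup>+t. ennreal K * (indicator {0..R} t * ennreal (t powr (1 - \<sigma>))) \<partial>lborel)"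
    proof (rule nn_integral_mono)
      fix t :: real
      show "indicator {0..R} t * ennreal (t powr (1 - N)) * Q t \<le> ennreal K * (indicator {0..R} t * ennreal (t powr (1 - \<sigma>)))"
      proof (cases "t > 0")
        case True
        have "ennreal (t powr (1 - N)) * Q t \<le> ennreal (t powr (1 - N)) * ennreal (K * t powr (N - \<sigma>))"
          using Q[OF True] by (intro mult_left_mono) auto
        also have "\<dots> = ennreal (K * (t powr (1 - N) * t powr (N - \<sigma>)))"
          using K by (simp add: ennreal_mult'[symmetric] mult_ac)
        also have "t powr (1 - N) * t powr (N - \<sigma>) = t powr (1 - \<sigma>)" by (simp add: powr_add[symmetric])
        finally show ?thesis using K by (auto split: split_indicator simp: ennreal_mult')
      qed (auto split: split_indicator)
    qed
    also have "\<dots> = ennreal K * ennreal (R powr (2 - \<sigma>) / (2 - \<sigma>))"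
      using nn_integral_powr_0[of "1 - \<sigma>" R] R \<sigma> by (subst nn_integral_cmult) (auto simp: algebra_simps)
    finally show ?thesis using K \<sigma> by (simp add: ennreal_mult'[symmetric] mult_ac)
  qed
  then show ?thesis using \<sigma>(1) unfolding N_def by blast
qed

section \<open>Absorption by a contraction\<close>

text \<open>If u were known to have a finite bound at \<open>\<theta>\<^sub>1\<close>, absorbing T u
  would be immediate. Instead, u is dominated by the n-th iterate of T on u, which tends to 0 at
  \<open>\<theta>\<^sub>0\<close>, plus a partial sum of the Neumann series of F, which stays
  bounded at \<open>\<theta>\<^sub>1\<close>. The two parts live in different spaces but can be
  added on a fixed set A of finite measure.\<close>

lemma weak_bound_neumann:
  fixes u F :: "'a::euclidean_space \<Rightarrow> ennreal"
  assumes T0: "\<And>g C. 0 \<le> C \<Longrightarrow> weak_bound \<theta>\<^sub>0 C g \<Longrightarrow> weak_bound \<theta>\<^sub>0 (C/2) (T g)"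
    and T1: "\<And>g C. 0 \<le> C \<Longrightarrow> weak_bound \<theta>\<^sub>1 C g \<Longrightarrow> weak_bound \<theta>\<^sub>1 (C/2) (T g)"
    and mono: "\<And>g h x. AE x in lborel. g x \<le> h x \<Longrightarrow> T g x \<le> T h x"
    and add: "\<And>g h x. g \<in> borel_measurable borel \<Longrightarrow> h \<in> borel_measurable borel \<Longrightarrow> T (\<lambda>y. g y + h y) x = T g x + T h x"
    and u: "AE x in lborel. u x \<le> T u x + F x"
    and u0: "weak_bound \<theta>\<^sub>0 C\<^sub>0 u" "0 \<le> C\<^sub>0" and F: "weak_bound \<theta>\<^sub>1 C\<^sub>1 F" "0 \<le> C\<^sub>1"
  shows "weak_bound \<theta>\<^sub>1 (2 * C\<^sub>1) u"
  unfolding weak_bound_def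
proof (intro conjI ballI impI)
  show [measurable]: "u \<in> borel_measurable borel" using u0(1) by (rule weak_bound_measurable)
  fix A :: "'a set" assume A: "A \<in> sets borel" "emeasure lborel A < \<infinity>"
  note [measurable] = A(1)
  have *: "\<exists>v S. weak_bound \<theta>\<^sub>0 (C\<^sub>0 / 2^n) v \<and> weak_bound \<theta>\<^sub>1 (2 * C\<^sub>1) S \<and> (AE x in lborel. u x \<le> v x + S x)" for n
  proof (induction n)
    case 0
    have "weak_bound \<theta>\<^sub>1 (2 * C\<^sub>1) (\<lambda>x::'a. 0)" using F by (auto simp: weak_bound_def)
    then show ?case using u0 by (intro exI[of _ u] exI[of _ "\<lambda>_. 0"]) auto
  next
    case (Suc n)
    then obtain v S where vS: "weak_bound \<theta>\<^sub>0 (C\<^sub>0 / 2^n) v" "weak_bound \<theta>\<^sub>1 (2 * C\<^sub>1) S" "AE x in lborel. u x \<le> v x + S x" by blast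
    note [measurable] = vS(1,2)[THEN weak_bound_measurable]
    have Tu: "T u x \<le> T v x + T S x" for x
      using mono[OF vS(3)] add[of v S] by simp
    have "AE x in lborel. u x \<le> T v x + (T S x + F x)"
    proof (rule eventually_mono[OF u])
      fix x assume "u x \<le> T u x + F x"
      moreover have "T u x + F x \<le> (T v x + T S x) + F x" by (intro add_right_mono Tu)
      ultimately show "u x \<le> T v x + (T S x + F x)" by (metis add.assoc order_trans)
    qed
    moreover have "weak_bound \<theta>\<^sub>0 (C\<^sub>0 / 2^Suc n) (T v)"
      using T0[OF _ vS(1)] u0 by (simp add: mult.commute[of 2])
    \<comment> \<open>The constant reproduces itself: T halves 2 \<open>C\<^sub>1\<close>, and F
      contributes the other \<open>C\<^sub>1\<close>.\<close>
    moreover have "weak_bound \<theta>\<^sub>1 (2 * C\<^sub>1) (\<lambda>x. T S x + F x)"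
      using weak_bound_add[OF T1[OF _ vS(2)] F(1)] F(2) by simp
    ultimately show ?case by blast
  qed
  define m where "m = measure lborel A"
  have "(\<integral>\<^sup>+x\<in>A. u x \<partial>lborel) \<le> ennreal (C\<^sub>0 / 2^n * m powr \<theta>\<^sub>0 + 2 * C\<^sub>1 * m powr \<theta>\<^sub>1)" for n
  proof -
    obtain v S where vS: "weak_bound \<theta>\<^sub>0 (C\<^sub>0 / 2^n) v" "weak_bound \<theta>\<^sub>1 (2 * C\<^sub>1) S" "AE x in lborel. u x \<le> v x + S x" using * by blast
    note [measurable] = vS(1,2)[THEN weak_bound_measurable]
    have "(\<integral>\<^sup>+x\<in>A. u x \<partial>lborel) \<le> (\<integral>\<^sup>+x. v x * indicator A x + S x * indicator A x \<partial>lborel)"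
      using vS(3) by (intro nn_integral_mono_AE) (auto elim!: eventually_mono split: split_indicator)
    also have "\<dots> = (\<integral>\<^sup>+x\<in>A. v x \<partial>lborel) + (\<integral>\<^sup>+x\<in>A. S x \<partial>lborel)"
      by (intro nn_integral_add) auto
    also have "\<dots> \<le> ennreal (C\<^sub>0 / 2^n * m powr \<theta>\<^sub>0) + ennreal (2 * C\<^sub>1 * m powr \<theta>\<^sub>1)"
      unfolding m_def by (intro add_mono weak_boundD vS A)
    finally show ?thesis using u0 F by (simp add: ennreal_plus)
  qed
  moreover have "(\<lambda>n. ennreal (C\<^sub>0 / 2^n * m powr \<theta>\<^sub>0 + 2 * C\<^sub>1 * m powr \<theta>\<^sub>1)) \<longlonglongrightarrow> ennreal (0 * m powr \<theta>\<^sub>0 + 2 * C\<^sub>1 * m powr \<theta>\<^sub>1)"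
    by (intro tendsto_intros LIMSEQ_divide_realpow_zero) auto
  ultimately have "(\<integral>\<^sup>+x\<in>A. u x \<partial>lborel) \<le> ennreal (0 * m powr \<theta>\<^sub>0 + 2 * C\<^sub>1 * m powr \<theta>\<^sub>1)"
    by (intro LIMSEQ_le_const) auto
  then show "(\<integral>\<^sup>+x\<in>A. u x \<partial>lborel) \<le> ennreal (2 * C\<^sub>1 * measure lborel A powr \<theta>\<^sub>1)"
    by (simp add: m_def)
qed

text \<open>Multiplication by V lowers \<theta> by 2/N and the potential raises it back, so the
  composition acts within one weak space, with norm proportional to
  \<open>\<kappa> powr (2/N)\<close>. The factor 1/4 leaves room for the sum of two such operators
  to contract by 1/2.\<close>

lemma small_potential:
  assumes \<theta>: "2 / real DIM('a::euclidean_space) < \<theta>" "\<theta> < 1"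
  obtains \<kappa> where "\<kappa> > 0"
    "\<And>(V::'a \<Rightarrow> real) (g::'a \<Rightarrow> ennreal) C. V \<in> borel_measurable borel \<Longrightarrow> (\<And>x. 0 \<le> V x) \<Longrightarrow>
       (\<And>t. t > 0 \<Longrightarrow> emeasure lborel {x. V x > t} \<le> ennreal (\<kappa> * t powr - (real DIM('a) / 2))) \<Longrightarrow>
       0 \<le> C \<Longrightarrow> weak_bound \<theta> C g \<Longrightarrow> weak_bound \<theta> (C / 4) (riesz (\<lambda>x. ennreal (V x) * g x))"
proof -
  define N where "N = real DIM('a)"
  define \<omega> where "\<omega> = unit_ball_vol N"
  have N: "N > 0" by (simp add: N_def)
  have N\<theta>: "N / 2 * \<theta> > 1" using \<theta> N by (simp add: N_def field_simps)
  \<comment> \<open>The product of the constants of \<open>weak_bound_mult\<close> for a = N/2 and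
    of \<open>weak_bound_riesz\<close> at \<theta> - 2/N, stripped of C and \<kappa>.\<close>
  define k where "k = (1 + 1 / (N / 2 * \<theta> - 1)) * (\<omega> / 2 + \<omega> powr (\<theta> - 2/N) / (N - 2 - N * (\<theta> - 2/N)))"
  have Neq: "N - 2 - N * (\<theta> - 2/N) = N - N * \<theta>" using N by (simp add: field_simps)
  have pos: "N - N * \<theta> > 0" using \<theta> N by simp
  have k: "k > 0" unfolding k_def Neq using N\<theta> pos
    by (intro mult_pos_pos add_pos_nonneg) (auto simp: \<omega>_def N_def)
  define \<kappa> where "\<kappa> = (1 / (4 * k)) powr (N/2)"
  have \<kappa>: "\<kappa> > 0" using k by (simp add: \<kappa>_def)
  have \<kappa>2: "\<kappa> powr (2/N) = 1 / (4 * k)" using k N by (simp add: \<kappa>_def powr_powr)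
  show ?thesis
  proof
    show "\<kappa> > 0" by fact
    fix V :: "'a \<Rightarrow> real" and g :: "'a \<Rightarrow> ennreal" and C
    assume V: "V \<in> borel_measurable borel" "\<And>x. 0 \<le> V x"
      "\<And>t. t > 0 \<Longrightarrow> emeasure lborel {x. V x > t} \<le> ennreal (\<kappa> * t powr - (real DIM('a) / 2))"
      and C: "0 \<le> C" and g: "weak_bound \<theta> C g"
    have 1: "weak_bound (\<theta> - 2/N) (C * \<kappa> powr (2/N) * (1 + 1 / (N/2*\<theta> - 1))) (\<lambda>x. ennreal (V x) * g x)"
      using weak_bound_mult[OF V(1,2,3) \<kappa> _ _ g C] N N\<theta> by (simp add: N_def)
    have "weak_bound (\<theta> - 2/N + 2/N) ((C * \<kappa> powr (2/N) * (1 + 1 / (N/2*\<theta> - 1))) *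
       (\<omega> / 2 + \<omega> powr (\<theta> - 2/N) / (N - 2 - N * (\<theta> - 2/N)))) (riesz (\<lambda>x. ennreal (V x) * g x))"
      using weak_bound_riesz[OF 1] C N\<theta> \<theta> by (simp add: N_def \<omega>_def)
    also have "(C * \<kappa> powr (2/N) * (1 + 1 / (N/2*\<theta> - 1))) *
       (\<omega> / 2 + \<omega> powr (\<theta> - 2/N) / (N - 2 - N * (\<theta> - 2/N))) = C * \<kappa> powr (2/N) * k"
      by (simp add: k_def)
    also have "\<dots> = C / 4" unfolding \<kappa>2 using k by simp
    finally show "weak_bound \<theta> (C / 4) (riesz (\<lambda>x. ennreal (V x) * g x))" by simp
  qed
qed

section \<open>Integrability, weak bounds and distribution functions\<close>

text \<open>The pointwise bound h \<le> \<delta> + \<open>\<delta>^(1-r) h^r\<close> does the work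
  of Hoelder's inequality: optimizing the free parameter \<delta> produces the right power of the
  measure, and a fixed \<delta> suffices for finiteness or convergence.\<close>

lemma nn_integral_young:
  assumes [measurable]: "h \<in> borel_measurable M" "A \<in> sets M" and h0: "\<And>x. 0 \<le> h x" and r: "r > 1" and \<delta>: "\<delta> > 0"
  shows "(\<integral>\<^sup>+x. ennreal (h x) * indicator A x \<partial>M)
    \<le> ennreal \<delta> * emeasure M A + ennreal (\<delta> powr (1 - r)) * (\<integral>\<^sup>+x. ennreal (h x powr r) \<partial>M)"
proof -
  have young: "h x \<le> \<delta> + \<delta> powr (1 - r) * h x powr r" for x
  proof (cases "h x \<le> \<delta>")
    case False
    have "h x = h x powr (1 - r) * h x powr r" using False \<delta> by (simp add: powr_add[symmetric])
    also have "\<dots> \<le> \<delta> powr (1 - r) * h x powr r"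
      using False \<delta> r by (intro mult_right_mono powr_mono2') auto
    finally show ?thesis using \<delta> by simp
  qed (simp add: add_increasing2)
  have "(\<integral>\<^sup>+x. ennreal (h x) * indicator A x \<partial>M)
     \<le> (\<integral>\<^sup>+x. ennreal \<delta> * indicator A x + ennreal (\<delta> powr (1 - r)) * ennreal (h x powr r) \<partial>M)"
  proof (rule nn_integral_mono)
    fix x
    have "ennreal (h x) \<le> ennreal \<delta> + ennreal (\<delta> powr (1 - r)) * ennreal (h x powr r)"
      using young[of x] \<delta> by (simp add: ennreal_mult'[symmetric] ennreal_plus[symmetric] del: ennreal_plus)
    then show "ennreal (h x) * indicator A x \<le> ennreal \<delta> * indicator A x + ennreal (\<delta> powr (1 - r)) * ennreal (h x powr r)"
      by (auto split: split_indicator)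
  qed
  also have "\<dots> = ennreal \<delta> * emeasure M A + ennreal (\<delta> powr (1 - r)) * (\<integral>\<^sup>+x. ennreal (h x powr r) \<partial>M)"
    by (subst nn_integral_add) (auto simp: nn_integral_cmult)
  finally show ?thesis .
qed

lemma weak_bound_Lp:
  fixes h :: "'a::euclidean_space \<Rightarrow> real"
  assumes [measurable]: "h \<in> borel_measurable borel" and h0: "\<And>x. 0 \<le> h x" and r: "r > 1"
    and K: "(\<integral>\<^sup>+x. ennreal (h x powr r) \<partial>lborel) \<le> ennreal K" "K > 0"
  shows "weak_bound (1 - 1/r) (2 * K powr (1/r)) (\<lambda>x. ennreal (h x))"
  unfolding weak_bound_def
proof (intro conjI ballI impI)
  show "(\<lambda>x. ennreal (h x)) \<in> borel_measurable borel" by simp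
  fix A :: "'a set" assume A: "A \<in> sets borel" "emeasure lborel A < \<infinity>"
  have [measurable]: "A \<in> sets borel" by fact
  define m where "m = measure lborel A"
  have em: "emeasure lborel A = ennreal m" using A by (simp add: m_def emeasure_eq_ennreal_measure)
  show "(\<integral>\<^sup>+x\<in>A. ennreal (h x) \<partial>lborel) \<le> ennreal (2 * K powr (1/r) * measure lborel A powr (1 - 1/r))"
  proof (cases "m = 0")
    case True
    then have "emeasure lborel A = 0" using em by simp
    then have "A \<in> null_sets lborel" by (simp add: null_setsI)
    then show ?thesis by (simp add: nn_integral_null_set)
  next
    case False
    then have m: "m > 0" by (simp add: m_def less_le)
    \<comment> \<open>Balances \<delta> m against \<open>\<delta>^(1-r) K\<close>; both then equal
      \<open>K^(1/r) m^(1-1/r)\<close>.\<close>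
    define \<delta> where "\<delta> = (K / m) powr (1/r)"
    have \<delta>: "\<delta> > 0" using K m by (simp add: \<delta>_def)
    have "(\<integral>\<^sup>+x\<in>A. ennreal (h x) \<partial>lborel)
       \<le> ennreal \<delta> * ennreal m + ennreal (\<delta> powr (1 - r)) * (\<integral>\<^sup>+x. ennreal (h x powr r) \<partial>lborel)"
      using nn_integral_young[of h lborel A r \<delta>] h0 r \<delta> A by (simp add: em)
    also have "\<dots> \<le> ennreal \<delta> * ennreal m + ennreal (\<delta> powr (1 - r)) * ennreal K"
      by (intro add_left_mono mult_left_mono K) auto
    also have "\<dots> = ennreal (\<delta> * m + \<delta> powr (1 - r) * K)"
      using \<delta> m K by (simp add: ennreal_mult'[symmetric] ennreal_plus[symmetric] del: ennreal_plus)
    also have "\<delta> * m + \<delta> powr (1 - r) * K = 2 * K powr (1/r) * m powr (1 - 1/r)"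
    proof -
      have 1: "\<delta> * m = K powr (1/r) * m powr (1 - 1/r)"
        using K m by (simp add: \<delta>_def powr_divide powr_diff)
      have "\<delta> powr (1 - r) = \<delta> / \<delta> powr r" using \<delta> by (simp add: powr_diff)
      also have "\<delta> powr r = K / m" using K m r by (simp add: \<delta>_def powr_powr)
      finally have "\<delta> powr (1 - r) * K = \<delta> * m" using K m by (simp add: field_simps)
      then show ?thesis unfolding 1[symmetric] using 1 by simp
    qed
    finally show ?thesis by (simp add: m_def)
  qed
qed

text \<open>Chebyshev's inequality bounds t m by C \<open>m^\<theta>\<close>, where m is the measure
  of the superlevel set, and this is solved for m. Dividing by \<open>m^\<theta>\<close> requires m
  to be finite, so the set is first exhausted by its intersections with balls.\<close>

lemma weak_bound_imp_distribution:
  fixes u :: "'a::euclidean_space \<Rightarrow> real"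
  assumes [measurable]: "u \<in> borel_measurable borel"
    and w: "weak_bound \<theta> C (\<lambda>x. ennreal (u x))" and \<theta>: "\<theta> < 1" and C: "0 \<le> C" and t: "t > 0"
  shows "emeasure lborel {x. u x > t} \<le> ennreal ((C / t) powr (1 / (1 - \<theta>)))"
proof -
  define A where "A n = {x. u x > t} \<inter> ball 0 (real n)" for n
  have [measurable]: "A n \<in> sets borel" for n unfolding A_def by measurable
  have "incseq A" by (auto simp: A_def incseq_def)
  moreover have "(\<Union>n. A n) = {x. u x > t}"
    by (auto simp: A_def) (meson reals_Archimedean2)
  ultimately have S: "emeasure lborel {x. u x > t} = (SUP n. emeasure lborel (A n))"
    using SUP_emeasure_incseq[of A lborel] by (metis \<open>\<And>n. A n \<in> sets borel\<close> image_subsetI sets_lborel)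
  have "emeasure lborel (A n) \<le> ennreal ((C / t) powr (1 / (1 - \<theta>)))" for n
  proof -
    have "emeasure lborel (A n) \<le> emeasure lborel (ball (0::'a) (real n))"
      by (intro emeasure_mono) (auto simp: A_def)
    also have "\<dots> < \<infinity>" using emeasure_bounded_finite[of "ball (0::'a) (real n)"] by simp
    finally have fin: "emeasure lborel (A n) < \<infinity>" .
    define m where "m = measure lborel (A n)"
    have em: "emeasure lborel (A n) = ennreal m" using fin by (simp add: m_def emeasure_eq_ennreal_measure)
    have "m \<le> (C / t) powr (1 / (1 - \<theta>))"
    proof (cases "m = 0")
      case False
      then have m: "m > 0" by (simp add: m_def less_le)
      have "ennreal t * ennreal m = (\<integral>\<^sup>+x. ennreal t * indicator (A n) x \<partial>lborel)"
        by (simp add: nn_integral_cmult em)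
      also have "\<dots> \<le> (\<integral>\<^sup>+x. ennreal (u x) * indicator (A n) x \<partial>lborel)"
        by (intro nn_integral_mono) (auto simp: A_def split: split_indicator intro!: ennreal_leI)
      also have "\<dots> \<le> ennreal (C * m powr \<theta>)"
        unfolding m_def by (intro weak_boundD[OF w] fin) auto
      finally have "t * m \<le> C * m powr \<theta>" using t m C by (simp add: ennreal_mult'[symmetric])
      then have "m / m powr \<theta> \<le> C / t" using t m by (simp add: field_simps)
      then have "m powr (1 - \<theta>) \<le> C / t" using m by (simp add: powr_diff)
      then have "(m powr (1 - \<theta>)) powr (1 / (1 - \<theta>)) \<le> (C / t) powr (1 / (1 - \<theta>))"
        using \<theta> by (intro powr_mono2) auto
      then show ?thesis using \<theta> m by (simp add: powr_powr)
    qed simp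
    then show ?thesis by (simp add: em ennreal_leI)
  qed
  then show ?thesis unfolding S by (intro SUP_least)
qed

lemma distribution_norm_powr:
  assumes s: "s > 0" and t: "t > 0"
  shows "emeasure lborel {x::'a::euclidean_space. norm x powr - s > t}
    \<le> ennreal (unit_ball_vol (real DIM('a)) * t powr - (real DIM('a) / s))"
proof -
  have "norm x < t powr - (1/s)" if "norm x powr - s > t" for x :: 'a
  proof -
    have x: "norm x > 0" using that t by (cases "x = 0") auto
    have "(norm x powr - s) powr - (1/s) < t powr - (1/s)"
      using that t s by (intro powr_less_mono2_neg) auto
    then show ?thesis using x s by (simp add: powr_powr)
  qed
  then have "emeasure lborel {x::'a. norm x powr - s > t} \<le> emeasure lborel {x::'a. dist 0 x < t powr - (1/s)}"
    by (intro emeasure_mono) auto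
  also have "\<dots> = ennreal (unit_ball_vol (real DIM('a)) * t powr - (real DIM('a) / s))"
    using emeasure_dist_ball[of "t powr - (1/s)" "0::'a"] by (simp add: powr_powr)
  finally show ?thesis .
qed

text \<open>Chebyshev's inequality for the r-th power, which is a multiple of
  \<open>u powr p\<close> because p = e r. With e = 4/(N - 2) and r = N/2 this p is the critical
  exponent, so the potential \<open>u powr e\<close> on A lies in weak \<open>L^(N/2)\<close> with a
  size governed by the critical integral of u over A.\<close>

lemma distribution_powr:
  fixes u :: "'a::euclidean_space \<Rightarrow> real"
  assumes [measurable]: "u \<in> borel_measurable borel" "A \<in> sets borel" and u0: "\<And>x. 0 \<le> u x"
    and b: "b > 0" and e: "e > 0" and r: "r > 0" and p: "p = e * r" and t: "t > 0"
    and K: "(\<integral>\<^sup>+x\<in>A. ennreal (u x powr p) \<partial>lborel) \<le> ennreal K"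
    and \<kappa>: "b powr r * K \<le> \<kappa>" "0 \<le> K"
  shows "emeasure lborel {x. b * u x powr e * indicator A x > t} \<le> ennreal (\<kappa> * t powr - r)"
proof -
  have "ennreal ((t/b) powr r) * emeasure lborel {x. b * u x powr e * indicator A x > t}
     = (\<integral>\<^sup>+x. ennreal ((t/b) powr r) * indicator {x. b * u x powr e * indicator A x > t} x \<partial>lborel)"
    by (simp add: nn_integral_cmult)
  also have "\<dots> \<le> (\<integral>\<^sup>+x\<in>A. ennreal (u x powr p) \<partial>lborel)"
  proof (rule nn_integral_mono)
    fix x
    show "ennreal ((t/b) powr r) * indicator {x. b * u x powr e * indicator A x > t} x \<le> ennreal (u x powr p) * indicator A x"
    proof (cases "b * u x powr e * indicator A x > t")
      case True
      then have A: "x \<in> A" using t by (auto split: split_indicator_asm)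
      then have "t / b < u x powr e" using True b by (simp add: field_simps)
      then have "(t / b) powr r \<le> (u x powr e) powr r" using t b r by (intro powr_mono2) auto
      then show ?thesis using A by (auto simp: p powr_powr ennreal_leI split: split_indicator)
    qed auto
  qed
  finally have 1: "ennreal ((t/b) powr r) * emeasure lborel {x. b * u x powr e * indicator A x > t} \<le> ennreal K"
    using K by order
  have "emeasure lborel {x. b * u x powr e * indicator A x > t}
     = ennreal ((t/b) powr - r) * (ennreal ((t/b) powr r) * emeasure lborel {x. b * u x powr e * indicator A x > t})"
    using t b by (simp add: mult.assoc[symmetric] ennreal_mult'[symmetric] powr_add[symmetric])
  also have "\<dots> \<le> ennreal ((t/b) powr - r) * ennreal K" by (intro mult_left_mono 1) auto
  also have "\<dots> = ennreal (b powr r * K * t powr - r)"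
    using t b \<kappa>(2) by (simp add: ennreal_mult'[symmetric] powr_divide powr_minus divide_simps mult_ac)
  also have "\<dots> \<le> ennreal (\<kappa> * t powr - r)" using \<kappa> by (intro ennreal_leI mult_right_mono) auto
  finally show ?thesis .
qed

section \<open>Integrability and boundedness of subsolutions of the integral equation\<close>

text \<open>With e = 4/(N - 2) the exponent on the left is \<open>crit_exp N s - 1\<close>. For X =
  \<open>v^e\<close> and Y = \<open>r^(-2)\<close> the left side is the weighted geometric mean
  \<open>X^(1-s/2) Y^(s/2)\<close> times v, so this is a weighted Young inequality. Since s < 2, the
  weight of X is positive, and this permits an arbitrarily small factor in front of Y.\<close>

lemma young_critical:
  fixes s e \<epsilon> :: real
  assumes s: "0 \<le> s" "s < 2" and e: "e > 0" and \<epsilon>: "\<epsilon> > 0"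
  shows "\<exists>b>0. \<forall>v\<ge>0. \<forall>r\<ge>0. v powr (e * (1 - s/2) + 1) / r powr s \<le> \<epsilon> * r powr - 2 * v + b * (v powr e * v)"
proof -
  define k where "k = 1 - s/2"
  have k: "k > 0" using s by (simp add: k_def)
  \<comment> \<open>The factor that appears when \<open>Y powr k \<le> X powr k / \<epsilon>\<close>
    is raised to the power (s/2)/k.\<close>
  define b where "b = \<epsilon> powr (- (s / 2) / k)"
  have b: "b > 0" using \<epsilon> by (simp add: b_def)
  have "v powr (e * (1 - s/2) + 1) / r powr s \<le> \<epsilon> * r powr - 2 * v + b * (v powr e * v)" if "v \<ge> 0" "r \<ge> 0" for v r
  proof (cases "v = 0 \<or> r = 0")
    \<comment> \<open>A power of 0 is 0 for every exponent, and division by 0 gives 0, so the left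
      side vanishes at v = 0 and at r = 0.\<close>
    case True
    then show ?thesis using that \<epsilon> b by auto
  next
    case False
    then have v: "v > 0" and r: "r > 0" using that by auto
    define X where "X = v powr e"
    define Y where "Y = r powr - 2"
    have X: "X > 0" and Y: "Y > 0" using v r by (auto simp: X_def Y_def)
    have L: "v powr (e * (1 - s/2) + 1) / r powr s = X powr k * Y powr (s/2) * v"
    proof -
      have "v powr (e * (1 - s/2) + 1) = X powr k * v"
        using v by (simp add: X_def powr_powr powr_add k_def)
      moreover have "Y powr (s/2) = r powr - s" by (simp add: Y_def powr_powr)
      then have "Y powr (s/2) = 1 / r powr s" by (simp only: powr_minus_divide)
      ultimately show ?thesis by simp
    qed
    show ?thesis
    proof (cases "X powr k * Y powr (s/2) \<le> \<epsilon> * Y")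
      case True
      then have "X powr k * Y powr (s/2) * v \<le> \<epsilon> * Y * v" using v by simp
      moreover have "0 \<le> b * (v powr e * v)" using b v by simp
      ultimately show ?thesis unfolding L Y_def by linarith
    next
      case False
      have "Y powr (s/2) = Y / Y powr k" using Y by (simp add: k_def powr_diff)
      with False have "\<epsilon> * Y powr k < X powr k" using Y by (simp add: field_simps)
      then have "Y powr k \<le> X powr k / \<epsilon>" using \<epsilon> by (simp add: field_simps)
      then have "(Y powr k) powr ((s/2)/k) \<le> (X powr k / \<epsilon>) powr ((s/2)/k)"
        using s k by (intro powr_mono2) auto
      then have "Y powr (s/2) \<le> X powr (s/2) * b"
        using k X Y \<epsilon> by (simp add: powr_powr powr_divide b_def powr_minus_divide)
      then have "X powr k * Y powr (s/2) * v \<le> X powr k * (X powr (s/2) * b) * v"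
        using v by (intro mult_right_mono mult_left_mono) auto
      also have "X powr k * (X powr (s/2) * b) * v = b * ((X powr k * X powr (s/2)) * v)" by simp
      also have "X powr k * X powr (s/2) = X" using X by (simp add: powr_add[symmetric] k_def)
      finally show ?thesis unfolding L using \<epsilon> v r by (simp add: X_def add_increasing)
    qed
  qed
  then show ?thesis using b by blast
qed

text \<open>The exponent 1 + s/2 is the midpoint of s and 2. Being above s, it leaves room to trade
  part of the singularity against a power of v; being below 2, it makes the small radii contribute a
  bounded amount to the Riesz potential. The resulting power of v may be large, as v will have
  arbitrarily high weak integrability.\<close>

lemma young_local:
  fixes s q :: real
  assumes s: "0 \<le> s" "s < 2" and q: "q > 0" and v: "v \<ge> 0" and r: "r \<ge> 0"
  shows "v powr q / r powr s \<le> r powr - (1 + s/2) + v powr (q * (1 + s/2) / (1 - s/2))"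
proof (cases "v = 0 \<or> r = 0")
  case False
  then have v: "v > 0" and r: "r > 0" using v r by auto
  define k where "k = 1 - s/2"
  have k: "k > 0" using s by (simp add: k_def)
  show ?thesis
  \<comment> \<open>At the threshold \<open>v powr q = r powr - k\<close> the left side equals
    \<open>r powr - (1 + s/2)\<close>.\<close>
  proof (cases "v powr q \<le> r powr - k")
    case True
    have "v powr q / r powr s \<le> r powr - k / r powr s" using True by (intro divide_right_mono) auto
    also have "\<dots> = r powr (- k - s)" by (rule powr_diff[symmetric])
    also have "- k - s = - (1 + s/2)" by (simp add: k_def)
    finally show ?thesis by (simp add: add_increasing2)
  next
    case False
    then have "(r powr - k) powr (s/k) \<le> (v powr q) powr (s/k)"
      using s k by (intro powr_mono2) auto
    moreover have "(r powr - k) powr (s/k) = r powr - s" "(v powr q) powr (s/k) = v powr (q * s / k)"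
      using k by (simp_all add: powr_powr)
    ultimately have "1 / r powr s \<le> v powr (q * s / k)" by (simp only: powr_minus_divide)
    then have "v powr q * (1 / r powr s) \<le> v powr q * v powr (q * s / k)" by (intro mult_left_mono) auto
    also have "\<dots> = v powr (q + q * s / k)" by (simp add: powr_add)
    also have "q + q * s / k = q * (1 + s/2) / (1 - s/2)" using k by (simp add: k_def field_simps)
    finally show ?thesis by (simp add: add_increasing)
  qed
qed (use v r q in auto)

lemma tail_small:
  fixes u :: "'a::euclidean_space \<Rightarrow> real"
  assumes [measurable]: "u \<in> borel_measurable borel"
    and fin: "(\<integral>\<^sup>+x. ennreal (u x powr p) \<partial>lborel) < \<infinity>" and K: "K > 0"
  shows "\<exists>M\<ge>0. (\<integral>\<^sup>+x. ennreal (u x powr p) * indicator {x. u x > M} x \<partial>lborel) \<le> ennreal K"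
proof -
  have "(\<lambda>n. \<integral>\<^sup>+x. ennreal (u x powr p) * indicator {x. u x > real n} x \<partial>lborel) \<longlonglongrightarrow> (\<integral>\<^sup>+x. 0 \<partial>(lborel :: 'a measure))"
  proof (rule nn_integral_dominated_convergence[where w = "\<lambda>x. ennreal (u x powr p)"])
    show "AE x in lborel. (\<lambda>n. ennreal (u x powr p) * indicator {x. u x > real n} x) \<longlonglongrightarrow> 0"
    proof (intro AE_I2 tendsto_eventually)
      fix x
      obtain m :: nat where "u x \<le> real m" using real_arch_simple by blast
      then have "\<not> u x > real n" if "n \<ge> m" for n using that by (simp add: not_less order_trans)
      then show "\<forall>\<^sub>F n in sequentially. ennreal (u x powr p) * indicator {x. u x > real n} x = 0"
        by (intro eventually_sequentiallyI[of m]) auto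
    qed
  qed (use fin in \<open>auto split: split_indicator\<close>)
  then have "\<forall>\<^sub>F n in sequentially. (\<integral>\<^sup>+x. ennreal (u x powr p) * indicator {x. u x > real n} x \<partial>lborel) < ennreal K"
    using K by (intro order_tendstoD) auto
  then obtain n where "(\<integral>\<^sup>+x. ennreal (u x powr p) * indicator {x. u x > real n} x \<partial>lborel) < ennreal K"
    using eventually_happens by force
  then show ?thesis by (intro exI[of _ "real n"]) auto
qed

text \<open>Where u \<le> M, the power \<open>u powr (q * r)\<close> is at most
  \<open>M powr (q * r - p)\<close> times \<open>u powr p\<close>, so the critical integral controls
  it.\<close>

lemma weak_bound_truncated_power:
  fixes u :: "'a::euclidean_space \<Rightarrow> real"
  assumes [measurable]: "u \<in> borel_measurable borel" and u0: "\<And>x. 0 \<le> u x"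
    and fin: "(\<integral>\<^sup>+x. ennreal (u x powr p) \<partial>lborel) \<le> ennreal K" and K: "K \<ge> 0"
    and r: "r > 1" "q * r \<ge> p" and M: "M \<ge> 0"
  shows "\<exists>C\<ge>0. weak_bound (1 - 1/r) C (\<lambda>x. ennreal (u x powr q * indicator {x. u x \<le> M} x))"
proof -
  \<comment> \<open>Adding 1 makes the constant positive, as \<open>weak_bound_Lp\<close>
    demands.\<close>
  define K' where "K' = M powr (q * r - p) * K + 1"
  have K': "K' > 0" using K by (simp add: K'_def add_nonneg_pos)
  have "(\<integral>\<^sup>+x. ennreal ((u x powr q * indicator {x. u x \<le> M} x) powr r) \<partial>lborel)
    \<le> (\<integral>\<^sup>+x. ennreal (M powr (q * r - p)) * ennreal (u x powr p) \<partial>lborel)"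
  proof (rule nn_integral_mono)
    fix x
    show "ennreal ((u x powr q * indicator {x. u x \<le> M} x) powr r) \<le> ennreal (M powr (q * r - p)) * ennreal (u x powr p)"
    proof (cases "u x \<le> M")
      case True
      have "(u x powr q) powr r = u x powr (q * r - p) * u x powr p" by (simp add: powr_powr powr_add[symmetric])
      also have "\<dots> \<le> M powr (q * r - p) * u x powr p"
        using True u0 r M by (intro mult_right_mono powr_mono2) auto
      finally show ?thesis using True by (simp add: ennreal_mult'[symmetric] ennreal_leI)
    qed (use r in auto)
  qed
  also have "\<dots> = ennreal (M powr (q * r - p)) * (\<integral>\<^sup>+x. ennreal (u x powr p) \<partial>lborel)"
    by (simp add: nn_integral_cmult)
  also have "\<dots> \<le> ennreal (M powr (q * r - p)) * ennreal K" by (intro mult_left_mono fin) auto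
  also have "\<dots> \<le> ennreal K'" by (simp add: ennreal_mult'[symmetric] K'_def ennreal_leI)
  finally have "weak_bound (1 - 1/r) (2 * K' powr (1/r)) (\<lambda>x. ennreal (u x powr q * indicator {x. u x \<le> M} x))"
    using K' r u0 by (intro weak_bound_Lp) auto
  then show ?thesis using K' by (intro exI[of _ "2 * K' powr (1/r)"]) auto
qed

lemma distribution_cmult_norm_powr:
  assumes c: "c > 0" and s: "s > 0" and t: "t > 0"
  shows "emeasure lborel {x::'a::euclidean_space. c * norm x powr - s > t}
    \<le> ennreal (unit_ball_vol (real DIM('a)) * c powr (real DIM('a) / s) * t powr - (real DIM('a) / s))"
proof -
  have "{x::'a. c * norm x powr - s > t} = {x. norm x powr - s > t / c}" using c by (auto simp: field_simps)
  also have "emeasure lborel \<dots> \<le> ennreal (unit_ball_vol (real DIM('a)) * (t / c) powr - (real DIM('a) / s))"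
    using c t s by (intro distribution_norm_powr) auto
  finally show ?thesis using c t by (simp add: powr_divide powr_minus field_simps)
qed

text \<open>The lower end \<open>1/2 + 1/N\<close> is 1 - 1/p for the critical exponent p, so the
  claim is weak integrability to any finite exponent from p on. The operator T below collects the
  Hardy term and the nonlinear term on {u > M}; the nonlinear term on {u \<le> M} becomes the source
  F.\<close>

lemma potential_weak_bound:
  fixes u f :: "'a::euclidean_space \<Rightarrow> real"
  defines "N \<equiv> real DIM('a)"
  assumes N: "N \<ge> 3"
    and u [measurable]: "u \<in> borel_measurable borel" and f [measurable]: "f \<in> borel_measurable borel"
    and u0: "\<And>x. 0 \<le> u x"
    and fin: "(\<integral>\<^sup>+x. ennreal (u x powr (2 * N / (N - 2))) \<partial>lborel) < \<infinity>"
    and growth: "\<And>\<epsilon>. \<epsilon> > 0 \<Longrightarrow> \<exists>b>0. \<forall>x. f x \<le> \<epsilon> * norm x powr - 2 * u x + b * (u x powr (4 / (N - 2)) * u x)"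
    and c: "c > 0" and le: "AE x in lborel. ennreal (u x) \<le> ennreal c * riesz (\<lambda>y. ennreal (f y)) x"
    and \<theta>: "1/2 + 1/N \<le> \<theta>" "\<theta> < 1"
  shows "\<exists>C\<ge>0. weak_bound \<theta> C (\<lambda>x. ennreal (u x))"
proof -
  define p where "p = 2 * N / (N - 2)"
  define e where "e = 4 / (N - 2)"
  define \<omega> where "\<omega> = unit_ball_vol N"
  define \<theta>\<^sub>0 where "\<theta>\<^sub>0 = 1/2 + 1/N"
  have \<omega>: "\<omega> > 0" using N by (simp add: \<omega>_def)
  have e: "e > 0" and p: "p > 1" using N by (auto simp: e_def p_def field_simps)
  have \<theta>\<^sub>0: "2 / N < \<theta>\<^sub>0" "\<theta>\<^sub>0 < 1" "\<theta>\<^sub>0 = 1 - 1/p" using N by (auto simp: \<theta>\<^sub>0_def p_def field_simps)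
  have \<theta>1: "2 / N < \<theta>" using \<theta>\<^sub>0 \<theta> by (simp add: \<theta>\<^sub>0_def)
  obtain K where K: "(\<integral>\<^sup>+x. ennreal (u x powr p) \<partial>lborel) \<le> ennreal K" "K > 0"
  proof -
    obtain k where "k \<ge> 0" "(\<integral>\<^sup>+x. ennreal (u x powr p) \<partial>lborel) = ennreal k"
      using fin unfolding p_def by (metis ennreal_cases infinity_ennreal_def less_irrefl)
    then show ?thesis using that[of "k + 1"] by (simp add: ennreal_leI)
  qed
  obtain \<kappa>\<^sub>0 where \<kappa>\<^sub>0: "\<kappa>\<^sub>0 > 0" "\<And>(V::'a \<Rightarrow> real) (g::'a \<Rightarrow> ennreal) C. V \<in> borel_measurable borel \<Longrightarrow> (\<And>x. 0 \<le> V x) \<Longrightarrow>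
       (\<And>t. t > 0 \<Longrightarrow> emeasure lborel {x. V x > t} \<le> ennreal (\<kappa>\<^sub>0 * t powr - (N / 2))) \<Longrightarrow>
       0 \<le> C \<Longrightarrow> weak_bound \<theta>\<^sub>0 C g \<Longrightarrow> weak_bound \<theta>\<^sub>0 (C / 4) (riesz (\<lambda>x. ennreal (V x) * g x))"
    using small_potential[where 'a='a, of \<theta>\<^sub>0] \<theta>\<^sub>0 unfolding N_def by blast
  obtain \<kappa>\<^sub>1 where \<kappa>\<^sub>1: "\<kappa>\<^sub>1 > 0" "\<And>(V::'a \<Rightarrow> real) (g::'a \<Rightarrow> ennreal) C. V \<in> borel_measurable borel \<Longrightarrow> (\<And>x. 0 \<le> V x) \<Longrightarrow>
       (\<And>t. t > 0 \<Longrightarrow> emeasure lborel {x. V x > t} \<le> ennreal (\<kappa>\<^sub>1 * t powr - (N / 2))) \<Longrightarrow>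
       0 \<le> C \<Longrightarrow> weak_bound \<theta> C g \<Longrightarrow> weak_bound \<theta> (C / 4) (riesz (\<lambda>x. ennreal (V x) * g x))"
    using small_potential[where 'a='a, of \<theta>] \<theta> \<theta>1 unfolding N_def by blast
  \<comment> \<open>One and the same operator has to contract at the initial exponent
    \<open>\<theta>\<^sub>0\<close> and at the target exponent \<theta>.\<close>
  define \<kappa> where "\<kappa> = min \<kappa>\<^sub>0 \<kappa>\<^sub>1"
  have \<kappa>: "\<kappa> > 0" "\<kappa> \<le> \<kappa>\<^sub>0" "\<kappa> \<le> \<kappa>\<^sub>1" using \<kappa>\<^sub>0 \<kappa>\<^sub>1 by (auto simp: \<kappa>_def)
  \<comment> \<open>Makes the distribution function of a \<open>|x|^(-2)\<close> at most \<kappa>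
    \<open>t^(-N/2)\<close>. It enters \<open>growth\<close> as a/c, to compensate for the factor c
    in \<open>le\<close>.\<close>
  define a where "a = (\<kappa> / \<omega>) powr (2/N)"
  have a: "a > 0" "\<omega> * a powr (N / 2) = \<kappa>" using \<kappa> \<omega> N by (auto simp: a_def powr_powr)
  obtain b where b: "b > 0" and f_le: "\<And>x. f x \<le> a / c * norm x powr - 2 * u x + b * (u x powr e * u x)"
    using growth[of "a / c"] a c unfolding e_def by auto
  have cb: "c * b > 0" using c b by simp
  \<comment> \<open>The coefficient b grows as a shrinks and cannot be made small, so the second
    potential is made small through the tail of the critical integral.\<close>
  obtain M where M: "M \<ge> 0" "(\<integral>\<^sup>+x. ennreal (u x powr p) * indicator {x. u x > M} x \<partial>lborel) \<le> ennreal (\<kappa> / (c * b) powr (N/2))"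
    using tail_small[OF u, of p "\<kappa> / (c * b) powr (N/2)"] fin \<kappa> c b by (auto simp: p_def)
  define V1 where "V1 x = a * norm x powr - 2" for x :: 'a
  define V2 where "V2 x = c * b * u x powr e * indicator {x. u x > M} x" for x
  have V1 [measurable]: "V1 \<in> borel_measurable borel" "\<And>x. 0 \<le> V1 x" using a by (auto simp: V1_def[abs_def])
  have V2 [measurable]: "V2 \<in> borel_measurable borel" "\<And>x. 0 \<le> V2 x" using cb by (auto simp: V2_def[abs_def])
  have d1: "emeasure lborel {x. V1 x > t} \<le> ennreal (\<kappa> * t powr - (N / 2))" if "t > 0" for t
    using distribution_cmult_norm_powr[OF a(1) _ that, of 2, where 'a='a] a(2) by (simp add: V1_def \<omega>_def N_def)
  have d2: "emeasure lborel {x. V2 x > t} \<le> ennreal (\<kappa> * t powr - (N / 2))" if "t > 0" for t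
    unfolding V2_def using N e cb M \<kappa> that
    by (intro distribution_powr[OF u _ u0 _ _ _ _ _ M(2)]) (auto simp: e_def p_def field_simps)
  have mono\<kappa>: "ennreal (\<kappa> * t powr - (N / 2)) \<le> ennreal (\<kappa>\<^sub>0 * t powr - (N / 2))"
    "ennreal (\<kappa> * t powr - (N / 2)) \<le> ennreal (\<kappa>\<^sub>1 * t powr - (N / 2))" for t
    using \<kappa> by (auto intro!: ennreal_leI mult_right_mono)
  define T where "T g = riesz (\<lambda>x. ennreal (V1 x) * g x + ennreal (V2 x) * g x)" for g
  \<comment> \<open>Stated for an arbitrary exponent \<open>\<theta>'\<close> to serve both
    exponents; the two potentials contribute C/4 each.\<close>
  have halves: "weak_bound \<theta>' (C/2) (T g)"
    if "\<And>(V::'a \<Rightarrow> real) (g::'a \<Rightarrow> ennreal) C. V \<in> borel_measurable borel \<Longrightarrow> (\<And>x. 0 \<le> V x) \<Longrightarrow>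
       (\<And>t. t > 0 \<Longrightarrow> emeasure lborel {x. V x > t} \<le> ennreal (\<kappa> * t powr - (N / 2))) \<Longrightarrow>
       0 \<le> C \<Longrightarrow> weak_bound \<theta>' C g \<Longrightarrow> weak_bound \<theta>' (C / 4) (riesz (\<lambda>x. ennreal (V x) * g x))"
      and C: "0 \<le> C" and g: "weak_bound \<theta>' C g" for \<theta>' C g
  proof -
    note [measurable] = weak_bound_measurable[OF g]
    have "weak_bound \<theta>' (C/4 + C/4) (\<lambda>x. riesz (\<lambda>x. ennreal (V1 x) * g x) x + riesz (\<lambda>x. ennreal (V2 x) * g x) x)"
      using C g V1 V2 d1 d2 by (intro weak_bound_add that(1)) auto
    moreover have "T g = (\<lambda>x. riesz (\<lambda>x. ennreal (V1 x) * g x) x + riesz (\<lambda>x. ennreal (V2 x) * g x) x)"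
      unfolding T_def by (intro ext riesz_add) auto
    ultimately show ?thesis by simp
  qed
  have T0: "weak_bound \<theta>\<^sub>0 (C/2) (T g)" if "0 \<le> C" "weak_bound \<theta>\<^sub>0 C g" for C g
    by (rule halves[OF \<kappa>\<^sub>0(2)[OF _ _ order_trans[OF _ mono\<kappa>(1)]] that])
  have T1: "weak_bound \<theta> (C/2) (T g)" if "0 \<le> C" "weak_bound \<theta> C g" for C g
    by (rule halves[OF \<kappa>\<^sub>1(2)[OF _ _ order_trans[OF _ mono\<kappa>(2)]] that])
  \<comment> \<open>Chosen so that h has weak exponent \<theta> - 2/N and hence F has exponent
    \<theta>. For \<open>\<theta> = \<theta>\<^sub>0\<close> one gets (e + 1) r = p exactly, so the
    condition of \<open>weak_bound_truncated_power\<close> is just met at the lower end.\<close>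
  define r where "r = 1 / (1 - \<theta> + 2/N)"
  have r: "r > 1" "1 - 1/r = \<theta> - 2/N" "(e + 1) * r \<ge> p"
  proof -
    have pos: "1 - \<theta> + 2/N > 0" using \<theta> N by (simp add: add_pos_pos)
    show "r > 1" unfolding r_def using \<theta>1 pos by (simp add: field_simps)
    show "1 - 1/r = \<theta> - 2/N" by (simp add: r_def)
    have "1 - \<theta> + 2/N \<le> 1/2 + 1/N" using \<theta> by (simp add: field_simps)
    also have "\<dots> = (e + 1) / p" using N by (simp add: e_def p_def field_simps)
    finally show "(e + 1) * r \<ge> p" using pos p by (simp add: r_def field_simps)
  qed
  define h where "h x = u x powr (e + 1) * indicator {x. u x \<le> M} x" for x
  have [measurable]: "h \<in> borel_measurable borel" unfolding h_def[abs_def] by measurable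
  obtain D where D: "D \<ge> 0" "weak_bound (1 - 1/r) D (\<lambda>x. ennreal (h x))"
    using weak_bound_truncated_power[OF u u0 K(1) _ r(1,3) M(1)] K(2) unfolding h_def by auto
  define F where "F = riesz (\<lambda>x. ennreal (c * b) * ennreal (h x))"
  have F: "\<exists>C\<ge>0. weak_bound \<theta> C F"
  proof -
    have "weak_bound (\<theta> - 2/N) (c * b * D) (\<lambda>x. ennreal (c * b) * ennreal (h x))"
      using D cb r(2) by (intro weak_bound_cmult) auto
    from weak_bound_riesz[OF this] D cb \<theta> \<theta>1
    have "weak_bound \<theta> ((c * b * D) * (\<omega> / 2 + \<omega> powr (\<theta> - 2/N) / (N - 2 - N * (\<theta> - 2/N)))) F"
      by (simp add: F_def N_def \<omega>_def)
    \<comment> \<open>Passing to the maximum of the explicit constant and 0 saves a check of its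
      sign.\<close>
    then show ?thesis by (meson weak_bound_mono_const max.cobounded1 max.cobounded2)
  qed
  then obtain C1 where C1: "C1 \<ge> 0" "weak_bound \<theta> C1 F" by auto
  have le': "AE x in lborel. ennreal (u x) \<le> T (\<lambda>x. ennreal (u x)) x + F x"
    using le
  proof eventually_elim
    case (elim x)
    have "ennreal c * riesz (\<lambda>y. ennreal (f y)) x = riesz (\<lambda>y. ennreal c * ennreal (f y)) x"
      by (simp add: riesz_cmult)
    also have "\<dots> \<le> riesz (\<lambda>y. (ennreal (V1 y) * ennreal (u y) + ennreal (V2 y) * ennreal (u y)) + ennreal (c * b) * ennreal (h y)) x"
    proof (intro riesz_mono AE_I2)
      fix y
      have "u y powr e * u y = u y powr (e + 1)" using u0[of y] by (cases "u y = 0") (auto simp: powr_add)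
      then have "c * b * u y powr e * u y = V2 y * u y + c * b * h y"
        by (auto simp: V2_def h_def split: split_indicator)
      moreover have "c * f y \<le> c * (a / c * norm y powr - 2 * u y + b * (u y powr e * u y))"
        using f_le[of y] c by (intro mult_left_mono) auto
      moreover have "c * (a / c * norm y powr - 2 * u y + b * (u y powr e * u y)) = V1 y * u y + c * b * u y powr e * u y"
        using c by (simp add: V1_def distrib_left)
      ultimately have "c * f y \<le> V1 y * u y + V2 y * u y + c * b * h y" by linarith
      moreover have "h y \<ge> 0" by (simp add: h_def)
      ultimately show "ennreal c * ennreal (f y) \<le> (ennreal (V1 y) * ennreal (u y) + ennreal (V2 y) * ennreal (u y)) + ennreal (c * b) * ennreal (h y)"
        using c b u0[of y] V1(2)[of y] V2(2)[of y]
        by (simp add: ennreal_mult'[symmetric] ennreal_plus[symmetric] ennreal_leI del: ennreal_plus)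
    qed
    also have "\<dots> = T (\<lambda>x. ennreal (u x)) x + F x"
      unfolding T_def F_def by (subst riesz_add) auto
    finally show ?case using elim by order
  qed
  have u_weak: "weak_bound \<theta>\<^sub>0 (2 * K powr (1/p)) (\<lambda>x. ennreal (u x))"
    unfolding \<theta>\<^sub>0(3) by (intro weak_bound_Lp u u0 p K)
  have Tmono: "T g x \<le> T h x" if "AE x in lborel. g x \<le> h x" for g h x
    unfolding T_def using that
    by (intro riesz_mono) (auto elim!: eventually_mono intro!: add_mono mult_left_mono)
  have Tadd: "T (\<lambda>y. g y + h y) x = T g x + T h x"
    if [measurable]: "g \<in> borel_measurable borel" "h \<in> borel_measurable borel" for g h x
    unfolding T_def by (subst riesz_add[symmetric]) (auto simp: distrib_left add_ac)
  have "weak_bound \<theta> (2 * C1) (\<lambda>x. ennreal (u x))"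
    by (rule weak_bound_neumann[where T = T and F = F, OF T0 T1 Tmono Tadd le' u_weak _ C1(2,1)]) (use K in auto)
  then show ?thesis using C1 by (intro exI[of _ "2 * C1"]) auto
qed

section \<open>Pointwise bounds for Riesz potentials\<close>

text \<open>Inserting the ball estimate leaves the integral of \<open>t^(1-N+N\<theta>)\<close> over
  S. It converges at 0 when N\<theta> > N - 2 and at infinity when N\<theta> < N - 2, so no single
  \<theta> serves both ends, and a bounded potential is obtained from two different weak bounds on
  the density.\<close>

lemma riesz_on_bounded:
  fixes h :: "'a::euclidean_space \<Rightarrow> ennreal"
  defines "N \<equiv> real DIM('a)"
  assumes h: "weak_bound \<theta> C h" and C: "0 \<le> C" and \<theta>: "0 \<le> \<theta>"
    and S [measurable]: "S \<in> sets borel" and S0: "S \<subseteq> {0..}"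
    and J: "(\<integral>\<^sup>+t. indicator S t * ennreal (t powr (1 - N + N * \<theta>)) \<partial>lborel) = ennreal J"
  shows "riesz_on S h x \<le> ennreal (C * unit_ball_vol N powr \<theta> * J)"
proof -
  define \<omega> where "\<omega> = unit_ball_vol N"
  define D where "D = C * \<omega> powr \<theta>"
  have \<omega>: "\<omega> \<ge> 0" and D: "D \<ge> 0" using C by (auto simp: \<omega>_def D_def N_def)
  have "(\<integral>\<^sup>+t. indicator S t * ennreal (t powr (1 - N)) *
      ball_int h x t \<partial>lborel)
    \<le> (\<integral>\<^sup>+t. ennreal D * (indicator S t * ennreal (t powr (1 - N + N * \<theta>))) \<partial>lborel)"
  proof (rule nn_integral_mono)
    fix t :: real
    show "indicator S t * ennreal (t powr (1 - N)) * ball_int h x t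
      \<le> ennreal D * (indicator S t * ennreal (t powr (1 - N + N * \<theta>)))"
    proof (cases "t \<in> S")
      case True
      have "ennreal (t powr (1 - N)) * ball_int h x t
        \<le> ennreal (t powr (1 - N)) * ennreal (C * (\<omega> * t powr N) powr \<theta>)"
        using ball_integral_le_1[OF h C \<theta>, of t x] True S0
        by (intro mult_left_mono) (auto simp: N_def \<omega>_def)
      also have "\<dots> = ennreal (D * (t powr (1 - N) * t powr (N * \<theta>)))"
        using C \<omega> by (simp add: ennreal_mult'[symmetric] D_def powr_mult powr_powr mult_ac)
      also have "t powr (1 - N) * t powr (N * \<theta>) = t powr (1 - N + N * \<theta>)" by (simp add: powr_add[symmetric])
      finally show ?thesis using True D by (simp add: ennreal_mult')
    qed auto
  qed
  also have "\<dots> = ennreal D * ennreal J" by (subst nn_integral_cmult) (simp_all add: J)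
  finally show ?thesis using D by (simp add: ennreal_mult' D_def \<omega>_def N_def)
qed

lemma riesz_near_bounded:
  fixes h :: "'a::euclidean_space \<Rightarrow> ennreal"
  assumes h: "weak_bound \<theta> C h" and C: "0 \<le> C" and \<theta>: "0 \<le> \<theta>" "real DIM('a) * \<theta> > real DIM('a) - 2"
  shows "\<exists>K\<ge>0. \<forall>x. riesz_on {0..1} h x \<le> ennreal K"
proof -
  let ?J = "1 / (2 - real DIM('a) + real DIM('a) * \<theta>)"
  have "(\<integral>\<^sup>+t. indicator {0..1} t * ennreal (t powr (1 - real DIM('a) + real DIM('a) * \<theta>)) \<partial>lborel) = ennreal ?J"
    using nn_integral_powr_0[of "1 - real DIM('a) + real DIM('a) * \<theta>" 1] \<theta> by (simp add: algebra_simps)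
  from riesz_on_bounded[OF h C \<theta>(1) _ _ this]
  show ?thesis using C \<theta> by (intro exI[of _ "C * unit_ball_vol (real DIM('a)) powr \<theta> * ?J"]) auto
qed

lemma riesz_far_bounded:
  fixes h :: "'a::euclidean_space \<Rightarrow> ennreal"
  assumes h: "weak_bound \<theta> C h" and C: "0 \<le> C" and \<theta>: "0 \<le> \<theta>" "real DIM('a) * \<theta> < real DIM('a) - 2"
  shows "\<exists>K\<ge>0. \<forall>x. riesz_on {1..} h x \<le> ennreal K"
proof -
  let ?J = "- (1 / (2 - real DIM('a) + real DIM('a) * \<theta>))"
  have J: "(\<integral>\<^sup>+t. indicator {1..} t * ennreal (t powr (1 - real DIM('a) + real DIM('a) * \<theta>)) \<partial>lborel) = ennreal ?J"
    using nn_integral_powr_inf[of "1 - real DIM('a) + real DIM('a) * \<theta>" 1] \<theta> by (simp add: algebra_simps)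
  have J0: "?J \<ge> 0" using \<theta> by (auto intro!: divide_nonneg_neg)
  show ?thesis
    using riesz_on_bounded[OF h C \<theta>(1) _ _ J] mult_nonneg_nonneg[OF mult_nonneg_nonneg[OF C powr_ge_zero] J0]
    by (intro exI[of _ "C * unit_ball_vol (real DIM('a)) powr \<theta> * ?J"]) auto
qed

lemma riesz_le_near_far:
  fixes h :: "'a::euclidean_space \<Rightarrow> ennreal"
  assumes [measurable]: "h \<in> borel_measurable borel"
  shows "riesz h x \<le> riesz_on {0..1} h x + riesz_on {1..} h x"
  unfolding riesz_def
  by (subst nn_integral_add[symmetric]) (auto intro!: nn_integral_mono split: split_indicator)

text \<open>For radii above 1 the critical integrability of u is enough, through
  \<open>young_critical\<close>. For radii below 1 the density has to lie in weak \<open>L^r\<close>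
  with r > N/2, and \<open>young_local\<close> reduces this to a sufficiently high weak exponent for
  u.\<close>

lemma riesz_power_bounded:
  fixes u :: "'a::euclidean_space \<Rightarrow> real"
  defines "N \<equiv> real DIM('a)"
  assumes N: "N \<ge> 3"
    and u [measurable]: "u \<in> borel_measurable borel"
    and u0: "\<And>x. 0 \<le> u x"
    and fin: "(\<integral>\<^sup>+x. ennreal (u x powr (2 * N / (N - 2))) \<partial>lborel) < \<infinity>"
    and weak: "\<And>\<theta>. 1/2 + 1/N \<le> \<theta> \<Longrightarrow> \<theta> < 1 \<Longrightarrow> \<exists>C\<ge>0. weak_bound \<theta> C (\<lambda>x. ennreal (u x))"
    and s: "0 \<le> s" "s < 2"
  shows "\<exists>K\<ge>0. \<forall>x. riesz (\<lambda>y. ennreal (u y powr (4 / (N - 2) * (1 - s/2) + 1) / norm y powr s)) x \<le> ennreal K"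
proof -
  define p where "p = 2 * N / (N - 2)"
  define e where "e = 4 / (N - 2)"
  define q where "q = e * (1 - s/2) + 1"
  define \<omega> where "\<omega> = unit_ball_vol N"
  have \<omega>: "\<omega> > 0" using N by (simp add: \<omega>_def)
  have e: "e > 0" and p: "p > 1" using N by (auto simp: e_def p_def field_simps)
  have q: "q > 0" using e s by (auto simp: q_def intro!: add_nonneg_pos)
  define f where "f y = u y powr q / norm y powr s" for y
  have [measurable]: "f \<in> borel_measurable borel" unfolding f_def[abs_def] by measurable
  have f0: "f y \<ge> 0" for y by (simp add: f_def)
  obtain K where K: "(\<integral>\<^sup>+x. ennreal (u x powr p) \<partial>lborel) \<le> ennreal K" "K > 0"
  proof -
    obtain k where "k \<ge> 0" "(\<integral>\<^sup>+x. ennreal (u x powr p) \<partial>lborel) = ennreal k"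
      using fin unfolding p_def by (metis ennreal_cases infinity_ennreal_def less_irrefl)
    then show ?thesis using that[of "k + 1"] by (simp add: ennreal_leI)
  qed
  define \<theta>\<^sub>0 where "\<theta>\<^sub>0 = 1/2 + 1/N"
  have \<theta>\<^sub>0: "N / 2 * \<theta>\<^sub>0 > 1" "\<theta>\<^sub>0 < 1" using N by (auto simp: \<theta>\<^sub>0_def field_simps)
  obtain C0 where C0: "C0 \<ge> 0" "weak_bound \<theta>\<^sub>0 C0 (\<lambda>x. ennreal (u x))" using weak[of \<theta>\<^sub>0] \<theta>\<^sub>0(2) by (auto simp: \<theta>\<^sub>0_def)
  have far: "\<exists>D\<ge>0. weak_bound (\<theta>\<^sub>0 - 2/N) D (\<lambda>y. ennreal (f y))"
  proof -
    obtain b where b: "b > 0" "\<And>v r. v \<ge> 0 \<Longrightarrow> r \<ge> 0 \<Longrightarrow> v powr q / r powr s \<le> 1 * r powr - 2 * v + b * (v powr e * v)"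
      using young_critical[OF s e, of 1] unfolding q_def by auto
    define \<kappa> where "\<kappa> = b powr (N/2) * K"
    have \<kappa>: "\<kappa> > 0" using b K by (simp add: \<kappa>_def)
    have d1: "emeasure lborel {x::'a. norm x powr - 2 > t} \<le> ennreal (\<omega> * t powr - (N/2))" if "t > 0" for t
      using distribution_norm_powr[OF _ that, of 2, where 'a='a] by (simp add: \<omega>_def N_def)
    have d2: "emeasure lborel {x. b * u x powr e * indicator UNIV x > t} \<le> ennreal (\<kappa> * t powr - (N/2))" if "t > 0" for t
      using N e b K that
      by (intro distribution_powr[OF u _ u0, where p=p and K=K]) (auto simp: e_def p_def field_simps \<kappa>_def)
    have N2: "N / 2 > 0" using N by simp
    have 1: "weak_bound (\<theta>\<^sub>0 - 2/N) (C0 * \<omega> powr (2/N) * (1 + 1 / (N/2 * \<theta>\<^sub>0 - 1))) (\<lambda>x. ennreal (norm x powr - 2) * ennreal (u x))"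
      using weak_bound_mult[OF _ _ d1 \<omega> N2 \<theta>\<^sub>0(1) C0(2,1)] by simp
    have 2: "weak_bound (\<theta>\<^sub>0 - 2/N) (C0 * \<kappa> powr (2/N) * (1 + 1 / (N/2 * \<theta>\<^sub>0 - 1))) (\<lambda>x. ennreal (b * u x powr e * indicator UNIV x) * ennreal (u x))"
      using weak_bound_mult[OF _ _ d2 \<kappa> N2 \<theta>\<^sub>0(1) C0(2,1)] b by simp
    have nn: "C0 * \<omega> powr (2/N) * (1 + 1 / (N/2 * \<theta>\<^sub>0 - 1)) \<ge> 0" "C0 * \<kappa> powr (2/N) * (1 + 1 / (N/2 * \<theta>\<^sub>0 - 1)) \<ge> 0"
      using C0 \<theta>\<^sub>0 by auto
    have "ennreal (f x) \<le> ennreal (norm x powr - 2) * ennreal (u x) + ennreal (b * u x powr e * indicator UNIV x) * ennreal (u x)" for x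
      using b(2)[of "u x" "norm x"] b(1) u0[of x]
      by (simp add: f_def ennreal_mult'[symmetric] ennreal_plus[symmetric] mult_ac ennreal_leI del: ennreal_plus)
    then have "weak_bound (\<theta>\<^sub>0 - 2/N) (C0 * \<omega> powr (2/N) * (1 + 1 / (N/2 * \<theta>\<^sub>0 - 1)) + C0 * \<kappa> powr (2/N) * (1 + 1 / (N/2 * \<theta>\<^sub>0 - 1))) (\<lambda>y. ennreal (f y))"
      by (intro weak_bound_mono[OF weak_bound_add[OF 1 2 nn]]) auto
    then show ?thesis using nn by (meson add_nonneg_nonneg)
  qed
  then obtain D where D: "D \<ge> 0" "weak_bound (\<theta>\<^sub>0 - 2/N) D (\<lambda>y. ennreal (f y))" by auto
  have th: "\<theta>\<^sub>0 - 2/N \<ge> 0" "N * (\<theta>\<^sub>0 - 2/N) < N - 2"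
    using N by (auto simp: \<theta>\<^sub>0_def field_simps)
  obtain K1 where K1: "K1 \<ge> 0" "\<And>x. (\<integral>\<^sup>+t. indicator {1..} t * ennreal (t powr (1 - N)) *
      ball_int (\<lambda>y. ennreal (f y)) x t \<partial>lborel) \<le> ennreal K1"
    using riesz_far_bounded[OF D(2,1)] th unfolding N_def by blast
  define s' where "s' = 1 + s/2"
  define m where "m = q * s' / (1 - s/2)"
  have s': "s' > 0" "s' < 2" using s by (auto simp: s'_def)
  have m: "m > 0" using q s s' by (auto simp: m_def)
  \<comment> \<open>At least N m, so that \<open>u powr m\<close> lies in weak
    \<open>L^(P/m)\<close> with P/m \<ge> N, well above N/2; and at least p, so that
    \<open>weak\<close> applies to 1 - 1/P.\<close>
  define P where "P = max p (N * m)"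
  have P: "P > 1" "P / m \<ge> N" "P \<ge> p" using p m by (auto simp: P_def field_simps)
  have "1/2 + 1/N = 1 - 1/p" using N by (simp add: p_def field_simps)
  also have "\<dots> \<le> 1 - 1/P" using P p by (simp add: frac_le)
  finally obtain C where C: "C \<ge> 0" "weak_bound (1 - 1/P) C (\<lambda>x. ennreal (u x))"
    using weak[of "1 - 1/P"] P by auto
  define \<kappa> where "\<kappa> = C powr P + 1"
  have \<kappa>: "\<kappa> > 0" by (simp add: \<kappa>_def add_nonneg_pos)
  have d1: "emeasure lborel {x::'a. norm x powr - s' > t} \<le> ennreal (\<omega> * t powr - (N/s'))" if "t > 0" for t
    using distribution_norm_powr[OF s'(1) that, where 'a='a] by (simp add: \<omega>_def N_def)
  have d2: "emeasure lborel {x. u x powr m > t} \<le> ennreal (\<kappa> * t powr - (P/m))" if "t > 0" for t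
  proof -
    have "emeasure lborel {x. u x powr m > t} \<le> emeasure lborel {x. u x > t powr (1/m)}"
    proof (intro emeasure_mono subsetI)
      fix x assume "x \<in> {x. u x powr m > t}"
      then have "t powr (1/m) < (u x powr m) powr (1/m)" using that m by (intro powr_less_mono2) auto
      then show "x \<in> {x. u x > t powr (1/m)}" using u0[of x] m by (simp add: powr_powr)
    qed auto
    also have "\<dots> \<le> ennreal ((C / t powr (1/m)) powr (1 / (1 - (1 - 1/P))))"
      using P C that by (intro weak_bound_imp_distribution) auto
    also have "(C / t powr (1/m)) powr (1 / (1 - (1 - 1/P))) = C powr P * t powr - (P/m)"
      using that C by (simp add: powr_divide powr_powr powr_minus_divide)
    also have "ennreal \<dots> \<le> ennreal (\<kappa> * t powr - (P/m))" by (intro ennreal_leI mult_right_mono) (auto simp: \<kappa>_def)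
    finally show ?thesis .
  qed
  have "1 * m < N * m" using N m by (intro mult_strict_right_mono) auto
  also have "\<dots> \<le> P" by (simp add: P_def)
  finally have mP: "m < P" by simp
  have Nm: "N / s' > 0" "N / s' * 1 > 1" "P/m > 0" "P/m * 1 > 1" using N s' P m mP by (auto simp: field_simps)
  have 1: "weak_bound (1 - s'/N) (\<omega> powr (s'/N) * (1 + 1 / (N/s' - 1))) (\<lambda>x::'a. ennreal (norm x powr - s'))"
    using weak_bound_mult[OF _ _ d1 \<omega> Nm(1,2) weak_bound_one] by simp
  have 2: "weak_bound (1 - m/P) (\<kappa> powr (m/P) * (1 + 1 / (P/m - 1))) (\<lambda>x. ennreal (u x powr m))"
    using weak_bound_mult[OF _ _ d2 \<kappa> Nm(3,4) weak_bound_one] by simp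
  have e1: "1 - s'/N \<ge> 0" "N * (1 - s'/N) > N - 2" using N s' by (auto simp: field_simps)
  have "N * (m / P) \<le> 1" using P m by (simp add: field_simps)
  then have e2: "1 - m/P \<ge> 0" "N * (1 - m/P) > N - 2"
    using P m Nm by (simp_all add: field_simps)
  have nn: "\<omega> powr (s'/N) * (1 + 1 / (N/s' - 1)) \<ge> 0" "\<kappa> powr (m/P) * (1 + 1 / (P/m - 1)) \<ge> 0"
    using Nm by auto
  obtain K2 where K2: "K2 \<ge> 0" "\<And>x::'a. (\<integral>\<^sup>+t. indicator {0..1} t * ennreal (t powr (1 - N)) *
      ball_int (\<lambda>y. ennreal (norm y powr - s')) x t \<partial>lborel) \<le> ennreal K2"
    using riesz_near_bounded[OF 1 nn(1)] e1 unfolding N_def by blast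
  obtain K3 where K3: "K3 \<ge> 0" "\<And>x. (\<integral>\<^sup>+t. indicator {0..1} t * ennreal (t powr (1 - N)) *
      ball_int (\<lambda>y. ennreal (u y powr m)) x t \<partial>lborel) \<le> ennreal K3"
    using riesz_near_bounded[OF 2 nn(2)] e2 unfolding N_def by blast
  have "riesz (\<lambda>y. ennreal (f y)) x \<le> ennreal (K2 + K3 + K1)" for x
  proof -
    have fb: "ennreal (f y) \<le> ennreal (norm y powr - s') + ennreal (u y powr m)" for y
      using young_local[OF s q u0[of y] norm_ge_zero[of y]]
      by (simp add: f_def s'_def m_def ennreal_plus[symmetric] ennreal_leI del: ennreal_plus)
    have "(\<integral>\<^sup>+t. indicator {0..1} t * ennreal (t powr (1 - N)) *
      ball_int (\<lambda>y. ennreal (f y)) x t \<partial>lborel)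
      \<le> (\<integral>\<^sup>+t. indicator {0..1} t * ennreal (t powr (1 - N)) *
      ball_int (\<lambda>y. (ennreal (norm y powr - s') + ennreal (u y powr m))) x t \<partial>lborel)"
      by (intro nn_integral_mono mult_left_mono mult_right_mono fb) auto
    also have "\<dots> = (\<integral>\<^sup>+t. indicator {0..1} t * ennreal (t powr (1 - N)) *
      ball_int (\<lambda>y. ennreal (norm y powr - s')) x t \<partial>lborel) +
      (\<integral>\<^sup>+t. indicator {0..1} t * ennreal (t powr (1 - N)) *
      ball_int (\<lambda>y. ennreal (u y powr m)) x t \<partial>lborel)"
      by (subst nn_integral_add[symmetric]; (simp add: distrib_right distrib_left)?)
         (auto simp: nn_integral_add distrib_left)
    also have "\<dots> \<le> ennreal K2 + ennreal K3" by (intro add_mono K2 K3)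
    finally have "(\<integral>\<^sup>+t. indicator {0..1} t * ennreal (t powr (1 - N)) *
      ball_int (\<lambda>y. ennreal (f y)) x t \<partial>lborel) \<le> ennreal K2 + ennreal K3" .
    then have "riesz (\<lambda>y. ennreal (f y)) x \<le> ennreal K2 + ennreal K3 + ennreal K1"
      by (intro order_trans[OF riesz_le_near_far] add_mono K1(2)[unfolded N_def]) (simp_all add: N_def)
    then show ?thesis using K1 K2 K3 by (simp add: ennreal_plus)
  qed
  then show ?thesis using K1 K2 K3 unfolding f_def q_def e_def
    by (intro exI[of _ "K2 + K3 + K1"]) auto
qed

section \<open>Smooth functions\<close>

lemma partial_deriv_eq:
  "(f has_derivative f') (at x) \<Longrightarrow> partial_deriv i f x = f' (axis i 1)"
  unfolding partial_deriv_def by (simp add: frechet_derivative_at[symmetric])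

lemma partial_deriv_add:
  assumes "f differentiable (at x)" "g differentiable (at x)"
  shows "partial_deriv i (\<lambda>x. f x + g x) x = partial_deriv i f x + partial_deriv i g x"
  using assms[unfolded frechet_derivative_works]
  by (subst partial_deriv_eq[OF has_derivative_add]) (auto simp: partial_deriv_def)

lemma partial_deriv_diff:
  assumes "f differentiable (at x)" "g differentiable (at x)"
  shows "partial_deriv i (\<lambda>x. f x - g x) x = partial_deriv i f x - partial_deriv i g x"
  using assms[unfolded frechet_derivative_works]
  by (subst partial_deriv_eq[OF has_derivative_diff]) (auto simp: partial_deriv_def)

lemma partial_deriv_mult:
  assumes "f differentiable (at x)" "g differentiable (at x)"
  shows "partial_deriv i (\<lambda>x. f x * g x) x = partial_deriv i f x * g x + f x * partial_deriv i g x"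
  using assms[unfolded frechet_derivative_works]
  by (subst partial_deriv_eq[OF has_derivative_mult]) (auto simp: partial_deriv_def)

lemma partial_deriv_const [simp]: "partial_deriv i (\<lambda>x. c) x = 0"
  by (subst partial_deriv_eq[OF has_derivative_const]) simp

lemma partial_deriv_component: "partial_deriv i (\<lambda>x. x $ j) x = (if i = j then 1 else 0)"
proof -
  have "((\<lambda>x::real^'a. x $ j) has_derivative (\<lambda>x. x $ j)) (at x)"
    by (rule bounded_linear.has_derivative[OF bounded_linear_vec_nth, of "\<lambda>x. x"]) simp
  from partial_deriv_eq[OF this, of i] show ?thesis by (auto simp: axis_def)
qed

lemma partial_deriv_compose:
  assumes "(D has_real_derivative d) (at (f x))" "f differentiable (at x)"
  shows "partial_deriv i (\<lambda>x. D (f x)) x = d * partial_deriv i f x"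
    "(\<lambda>x. D (f x)) differentiable (at x)"
proof -
  have "(D has_derivative (*) d) (at (f x))" using assms(1) by (simp add: has_field_derivative_def)
  from has_derivative_compose[OF assms(2)[unfolded frechet_derivative_works] this]
  have *: "((\<lambda>x. D (f x)) has_derivative (\<lambda>x'. d * frechet_derivative f (at x) x')) (at x)" .
  then show "partial_deriv i (\<lambda>x. D (f x)) x = d * partial_deriv i f x"
    by (subst partial_deriv_eq) (auto simp: partial_deriv_def)
  show "(\<lambda>x. D (f x)) differentiable (at x)" using * by (auto simp: differentiable_def)
qed

definition smooth :: "(real ^ 'n::finite \<Rightarrow> real) \<Rightarrow> bool" where
  "smooth f \<longleftrightarrow> (\<forall>k. Ck k f)"

text \<open>At its last level \<open>Ck (Suc k)\<close> states continuity only for the derivatives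
  of order k + 1; for the lower orders continuity follows from differentiability.\<close>

lemma Ck_Suc_imp: "Ck (Suc k) f \<Longrightarrow> Ck k f"
proof (induction k arbitrary: f)
  case 0
  then show ?case by (auto intro!: continuous_at_imp_continuous_on differentiable_imp_continuous_within)
next
  case (Suc k)
  then show ?case by (metis Ck.simps(2))
qed

lemma smooth_iff: "smooth f \<longleftrightarrow> (\<forall>x. f differentiable (at x)) \<and> (\<forall>i. smooth (partial_deriv i f))"
  unfolding smooth_def by (metis Ck.simps(2) Ck_Suc_imp)

lemma smooth_differentiable: "smooth f \<Longrightarrow> f differentiable (at x)"
  using smooth_iff by auto

lemma smooth_partial_deriv: "smooth f \<Longrightarrow> smooth (partial_deriv i f)"
  using smooth_iff by auto

lemma smooth_continuous: "smooth f \<Longrightarrow> continuous_on UNIV f"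
  unfolding smooth_def by (metis Ck.simps(1))

lemma Ck_const [simp]: "Ck k (\<lambda>x. c)"
proof (induction k arbitrary: c)
  case (Suc k)
  have "partial_deriv i (\<lambda>x::real^'a. c) = (\<lambda>x. 0)" for i by auto
  then show ?case using Suc by simp
qed simp

lemma Ck_component [simp]: "Ck k (\<lambda>x. x $ j)"
proof (cases k)
  case 0
  then show ?thesis by (simp add: continuous_on_component continuous_on_id)
next
  case (Suc k')
  have "partial_deriv i (\<lambda>x::real^'a. x $ j) = (\<lambda>x. if i = j then 1 else 0)" for i
    by (auto simp: partial_deriv_component)
  moreover have "(\<lambda>x::real^'a. x $ j) differentiable (at x)" for x
    by (intro bounded_linear_imp_differentiable bounded_linear_vec_nth)
  ultimately show ?thesis by (simp add: Suc)
qed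

lemma Ck_add: "Ck k f \<Longrightarrow> Ck k g \<Longrightarrow> Ck k (\<lambda>x. f x + g x)"
proof (induction k arbitrary: f g)
  case 0
  then show ?case by (auto intro: continuous_on_add)
next
  case (Suc k)
  have "partial_deriv i (\<lambda>x. f x + g x) = (\<lambda>x. partial_deriv i f x + partial_deriv i g x)" for i
    using Suc.prems by (auto simp: partial_deriv_add)
  then show ?case using Suc by (auto intro: differentiable_add)
qed

lemma Ck_mult: "Ck k f \<Longrightarrow> Ck k g \<Longrightarrow> Ck k (\<lambda>x. f x * g x)"
proof (induction k arbitrary: f g)
  case 0
  then show ?case by (auto intro: continuous_on_mult)
next
  case (Suc k)
  have "partial_deriv i (\<lambda>x. f x * g x) = (\<lambda>x. partial_deriv i f x * g x + f x * partial_deriv i g x)" for i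
    using Suc.prems by (auto simp: partial_deriv_mult)
  moreover have "Ck k (\<lambda>x. partial_deriv i f x * g x + f x * partial_deriv i g x)" for i
    using Suc.prems by (intro Ck_add Suc.IH Ck_Suc_imp[OF Suc.prems(1)] Ck_Suc_imp[OF Suc.prems(2)]) auto
  ultimately show ?case using Suc.prems by (auto intro: differentiable_mult)
qed

text \<open>The family D lists all derivatives of the outer function, so the chain rule stays within
  expressions of the form \<open>D j (f x)\<close> and the induction closes. Derivatives are
  required only at values of f, which admits outer functions like \<open>shifted_power\<close> that
  are smooth on a half-line only.\<close>

lemma Ck_compose:
  assumes D: "\<And>j x. (D j has_real_derivative D (Suc j) (f x)) (at (f x))" and f: "smooth f"
  shows "Ck k (\<lambda>x. D j (f x))"
proof (induction k arbitrary: j)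
  case 0
  have "(\<lambda>x. D j (f x)) differentiable (at x)" for x
    by (rule partial_deriv_compose(2)[OF D smooth_differentiable[OF f]])
  then show ?case by (auto intro!: continuous_at_imp_continuous_on differentiable_imp_continuous_within)
next
  case (Suc k)
  have "partial_deriv i (\<lambda>x. D j (f x)) = (\<lambda>x. D (Suc j) (f x) * partial_deriv i f x)" for i
    using partial_deriv_compose(1)[OF D smooth_differentiable[OF f]] by auto
  moreover have "Ck k (\<lambda>x. D (Suc j) (f x) * partial_deriv i f x)" for i
    using smooth_partial_deriv[OF f] by (intro Ck_mult Suc.IH) (auto simp: smooth_def)
  moreover have "(\<lambda>x. D j (f x)) differentiable (at x)" for x
    by (rule partial_deriv_compose(2)[OF D smooth_differentiable[OF f]])
  ultimately show ?case by simp
qed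

lemma smooth_const [simp]: "smooth (\<lambda>x. c)" and smooth_component [simp]: "smooth (\<lambda>x. x $ j)"
  and smooth_add: "smooth f \<Longrightarrow> smooth g \<Longrightarrow> smooth (\<lambda>x. f x + g x)"
  and smooth_mult: "smooth f \<Longrightarrow> smooth g \<Longrightarrow> smooth (\<lambda>x. f x * g x)"
  by (auto simp: smooth_def Ck_add Ck_mult)

lemma smooth_diff: "smooth f \<Longrightarrow> smooth g \<Longrightarrow> smooth (\<lambda>x. f x - g x)"
  using smooth_add[of f "\<lambda>x. (-1) * g x"] smooth_mult[of "\<lambda>x. -1" g] by simp

lemma smooth_compose:
  assumes "\<And>j x. (D j has_real_derivative D (Suc j) (f x)) (at (f x))" "smooth f"
  shows "smooth (\<lambda>x. D j (f x))"
  unfolding smooth_def by (intro allI Ck_compose assms)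

lemma smooth_sum: "finite I \<Longrightarrow> (\<And>i. i \<in> I \<Longrightarrow> smooth (f i)) \<Longrightarrow> smooth (\<lambda>x. \<Sum>i\<in>I. f i x)"
  by (induction I rule: finite_induct) (auto intro: smooth_add)

lemma smooth_prod: "finite I \<Longrightarrow> (\<And>i. i \<in> I \<Longrightarrow> smooth (f i)) \<Longrightarrow> smooth (\<lambda>x. \<Prod>i\<in>I. f i x)"
  by (induction I rule: finite_induct) (auto intro: smooth_mult)

section \<open>Radial functions and the smooth cut-off kernel\<close>

lemma norm_power2_eq_sum: "(norm (x - a :: real ^ 'n))\<^sup>2 = (\<Sum>i\<in>UNIV. (x $ i - a $ i) * (x $ i - a $ i))"
  by (simp add: norm_vec_def L2_set_def power2_eq_square sum_nonneg)

lemma smooth_norm_power2: "smooth (\<lambda>x. (norm (x - a))\<^sup>2)"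
  unfolding norm_power2_eq_sum by (intro smooth_sum smooth_mult smooth_diff) auto

lemma partial_deriv_norm_power2: "partial_deriv i (\<lambda>x. (norm (x - a))\<^sup>2) x = 2 * (x $ i - a $ i)"
proof -
  have "((\<lambda>x. (x - a) \<bullet> (x - a)) has_derivative (\<lambda>h. (x - a) \<bullet> h + h \<bullet> (x - a))) (at x)"
    by (auto intro!: derivative_eq_intros)
  then have "((\<lambda>x. (norm (x - a))\<^sup>2) has_derivative (\<lambda>h. (x - a) \<bullet> h + h \<bullet> (x - a))) (at x)"
    by (simp add: power2_norm_eq_inner)
  from partial_deriv_eq[OF this, of i] show ?thesis by (simp add: inner_axis inner_commute[of "axis i 1"])
qed

text \<open>Taking the square of the distance as the radial variable keeps everything smooth at the
  centre. The factor in front of G' is the Laplacian of \<open>|x - a|^2\<close>, and the one in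
  front of G'' is the squared length of its gradient.\<close>

lemma radial_laplacian:
  fixes a x :: "real ^ 'n::finite"
  assumes G: "\<And>t. t \<ge> 0 \<Longrightarrow> (G has_real_derivative G' t) (at t)"
    and G': "\<And>t. t \<ge> 0 \<Longrightarrow> (G' has_real_derivative G'' t) (at t)"
  shows "(\<Sum>i\<in>UNIV. partial_deriv i (partial_deriv i (\<lambda>x. G ((norm (x - a))\<^sup>2))) x)
    = 2 * real CARD('n) * G' ((norm (x - a))\<^sup>2) + 4 * (norm (x - a))\<^sup>2 * G'' ((norm (x - a))\<^sup>2)"
proof -
  note d = smooth_differentiable[OF smooth_norm_power2]
  have 1: "partial_deriv i (\<lambda>x. G ((norm (x - a))\<^sup>2)) = (\<lambda>x. G' ((norm (x - a))\<^sup>2) * (2 * (x $ i - a $ i)))" for i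
    using partial_deriv_compose(1)[OF G[OF zero_le_power2] d] by (auto simp: partial_deriv_norm_power2)
  have lin: "smooth (\<lambda>x. 2 * (x $ i - a $ i))" for i by (intro smooth_mult smooth_diff) auto
  have 2: "partial_deriv i (\<lambda>x. 2 * (x $ i - a $ i)) x = 2" for i
    by (subst partial_deriv_mult; (simp add: smooth_differentiable smooth_diff)?)
       (subst partial_deriv_diff; simp add: smooth_differentiable partial_deriv_component)
  have "partial_deriv i (partial_deriv i (\<lambda>x. G ((norm (x - a))\<^sup>2))) x
     = G'' ((norm (x - a))\<^sup>2) * (2 * (x $ i - a $ i)) * (2 * (x $ i - a $ i)) + G' ((norm (x - a))\<^sup>2) * 2" for i
    unfolding 1
    using partial_deriv_compose[OF G'[OF zero_le_power2] d] lin[of i] 2[of i]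
    by (subst partial_deriv_mult) (auto simp: partial_deriv_norm_power2 smooth_differentiable)
  then have "(\<Sum>i\<in>UNIV. partial_deriv i (partial_deriv i (\<lambda>x. G ((norm (x - a))\<^sup>2))) x)
    = (\<Sum>i\<in>UNIV. 4 * G'' ((norm (x - a))\<^sup>2) * ((x $ i - a $ i) * (x $ i - a $ i)) + 2 * G' ((norm (x - a))\<^sup>2))"
    by (intro sum.cong) (simp_all only: algebra_simps, simp_all add: algebra_simps)
  also have "\<dots> = 4 * G'' ((norm (x - a))\<^sup>2) * (norm (x - a))\<^sup>2 + 2 * real CARD('n) * G' ((norm (x - a))\<^sup>2)"
    by (simp add: sum.distrib sum_distrib_left norm_power2_eq_sum)
  finally show ?thesis by (simp add: mult_ac)
qed

text \<open>The $j$-th derivative of $e^{-1/t}$ is a polynomial in $1/t$ times $e^{-1/t}$; \<open>flat j\<close> is the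
  $j$-th derivative of the extension of $e^{-1/t}$ by 0 to $t\le0$.\<close>

primrec flat_poly :: "nat \<Rightarrow> real poly" where
  "flat_poly 0 = 1"
| "flat_poly (Suc j) = [:0, 0, 1:] * (flat_poly j - pderiv (flat_poly j))"

definition flat :: "nat \<Rightarrow> real \<Rightarrow> real" where
  "flat j t = (if t > 0 then poly (flat_poly j) (1 / t) * exp (- (1 / t)) else 0)"

lemma poly_exp_tendsto_0: "((\<lambda>x. poly p x * exp (- x)) \<longlongrightarrow> 0) at_top" for p :: "real poly"
proof -
  have "((\<lambda>x::real. \<Sum>i\<le>degree p. coeff p i * (x ^ i / exp x)) \<longlongrightarrow> (\<Sum>i\<le>degree p. coeff p i * 0)) at_top"
    by (intro tendsto_sum tendsto_mult tendsto_const tendsto_power_div_exp_0)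
  then show ?thesis by (simp add: poly_altdef sum_distrib_right exp_minus divide_inverse mult.assoc)
qed

text \<open>The critical point is t = 0. There the difference quotient from the right is, with x =
  1/h, a polynomial in x times \<open>e^(-x)\<close>, which tends to 0 as x grows.\<close>

lemma flat_deriv: "(flat j has_real_derivative flat (Suc j) t) (at t)"
proof -
  consider "t > 0" | "t < 0" | "t = 0" by linarith
  then show ?thesis
  proof cases
    case 1
    have "((\<lambda>t. poly (flat_poly j) (1 / t) * exp (- (1 / t))) has_real_derivative flat (Suc j) t) (at t)"
    proof -
      have inv: "((\<lambda>t. 1 / t) has_real_derivative - (1 / t * (1 / t))) (at t)"
        using 1 by (auto intro!: derivative_eq_intros simp: power2_eq_square)
      have "((\<lambda>t. poly (flat_poly j) (1 / t)) has_real_derivative poly (pderiv (flat_poly j)) (1 / t) * - (1 / t * (1 / t))) (at t)"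
        by (rule DERIV_chain2[OF poly_DERIV inv])
      moreover have "((\<lambda>t. exp (- (1 / t))) has_real_derivative exp (- (1 / t)) * - (- (1 / t * (1 / t)))) (at t)"
        by (rule DERIV_chain2[OF DERIV_exp DERIV_minus[OF inv]])
      ultimately have "((\<lambda>t. poly (flat_poly j) (1 / t) * exp (- (1 / t))) has_real_derivative
         poly (pderiv (flat_poly j)) (1 / t) * - (1 / t * (1 / t)) * exp (- (1 / t)) + exp (- (1 / t)) * - (- (1 / t * (1 / t))) * poly (flat_poly j) (1 / t)) (at t)"
        by (rule DERIV_mult)
      also have "poly (pderiv (flat_poly j)) (1 / t) * - (1 / t * (1 / t)) * exp (- (1 / t)) + exp (- (1 / t)) * - (- (1 / t * (1 / t))) * poly (flat_poly j) (1 / t)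
         = flat (Suc j) t" using 1 by (simp add: flat_def algebra_simps)
      finally show ?thesis .
    qed
    then show ?thesis
      by (rule has_field_derivative_transform_within_open[of _ _ _ "{0<..}"]) (use 1 in \<open>auto simp: flat_def\<close>)
  next
    case 2
    have "((\<lambda>t. 0) has_real_derivative flat (Suc j) t) (at t)"
      using 2 by (auto simp: flat_def)
    then show ?thesis
      by (rule has_field_derivative_transform_within_open[of _ _ _ "{..<0}"]) (use 2 in \<open>auto simp: flat_def\<close>)
  next
    case 3
    have R: "((\<lambda>h. flat j h / h) \<longlongrightarrow> 0) (at_right 0)"
    proof -
      \<comment> \<open>The extra polynomial factor x is the 1/h of the difference quotient.\<close>
      have "((\<lambda>x. poly ([:0, 1:] * flat_poly j) x * exp (- x)) \<longlongrightarrow> 0) at_top"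
        by (rule poly_exp_tendsto_0)
      then have "((\<lambda>h. poly ([:0, 1:] * flat_poly j) (inverse h) * exp (- (inverse h))) \<longlongrightarrow> 0) (at_right 0)"
        by (rule filterlim_compose) (rule filterlim_inverse_at_top_right)
      then show ?thesis
        by (rule tendsto_cong[THEN iffD1, rotated])
           (auto simp: eventually_at_right_field flat_def field_simps intro!: exI[of _ 1])
    qed
    have L: "((\<lambda>h. flat j h / h) \<longlongrightarrow> 0) (at_left 0)"
      by (rule tendsto_eventually) (auto simp: eventually_at_left_field flat_def intro!: exI[of _ "-1"])
    have "((\<lambda>h. flat j h / h) \<longlongrightarrow> 0) (at 0)" using L R by (simp add: filterlim_split_at)
    then show ?thesis using 3 by (simp add: has_field_derivative_iff flat_def)
  qed
qed

lemma flat_nonneg: "0 \<le> flat 0 t" and flat_le_1: "flat 0 t \<le> 1"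
  and flat_pos: "t > 0 \<Longrightarrow> 0 < flat 0 t" and flat_zero: "t \<le> 0 \<Longrightarrow> flat j t = 0"
  by (auto simp: flat_def)

lemma flat_mono: "s \<le> t \<Longrightarrow> flat 0 s \<le> flat 0 t"
  by (auto simp: flat_def frac_le)

text \<open>The cut-off is evaluated at \<open>1 - t / R\<^sup>2\<close> with t \<ge> 0, so
  arguments up to 1 are all that occur.\<close>

lemma flat_bounded: "\<exists>B\<ge>0. \<forall>t\<le>1. \<bar>flat j t\<bar> \<le> B"
proof -
  have "continuous_on {0..1} (flat j)"
    by (meson continuous_at_imp_continuous_on DERIV_isCont flat_deriv)
  then have "bounded (flat j ` {0..1})"
    by (intro compact_imp_bounded compact_continuous_image) auto
  then obtain B where "\<forall>t\<in>{0..1}. \<bar>flat j t\<bar> \<le> B"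
    by (auto simp: bounded_iff)
  then have B: "\<bar>flat j t\<bar> \<le> B" if "t \<in> {0..1}" for t using that by blast
  have "\<bar>flat j t\<bar> \<le> max B 0" if "t \<le> 1" for t
    using B[of t] that flat_zero[of t j] by (cases "t \<ge> 0") auto
  then show ?thesis by (intro exI[of _ "max B 0"]) auto
qed

lemma smooth_flat: "smooth f \<Longrightarrow> smooth (\<lambda>x. flat 0 (f x))"
  by (rule smooth_compose[where D = flat]) (auto intro: flat_deriv)

lemma test_functions_iff: "f \<in> test_functions \<longleftrightarrow> smooth f \<and> bounded {x. f x \<noteq> 0}"
  by (auto simp: test_functions_def smooth_def compact_eq_bounded_closed bounded_closure
      dest: bounded_subset[OF _ closure_subset])

text \<open>The $j$-th derivative of $(t+\delta)^{-k}$.\<close>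

definition shifted_power :: "real \<Rightarrow> real \<Rightarrow> nat \<Rightarrow> real \<Rightarrow> real" where
  "shifted_power \<delta> k j t = (\<Prod>i<j. - (k + real i)) * (t + \<delta>) powr (- k - real j)"

lemma shifted_power_deriv:
  assumes "t + \<delta> > 0"
  shows "(shifted_power \<delta> k j has_real_derivative shifted_power \<delta> k (Suc j) t) (at t)"
proof -
  have "((\<lambda>t. (t + \<delta>) powr (- k - real j)) has_real_derivative (- k - real j) * (t + \<delta>) powr (- k - real j - 1) * 1) (at t)"
    using assms by (intro DERIV_chain2[OF has_real_derivative_powr]) (auto intro!: derivative_eq_intros)
  then have "((\<lambda>t. (\<Prod>i<j. - (k + real i)) * (t + \<delta>) powr (- k - real j)) has_real_derivative
      (\<Prod>i<j. - (k + real i)) * ((- k - real j) * (t + \<delta>) powr (- k - real j - 1) * 1)) (at t)"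
    by (rule DERIV_cmult)
  also have "(\<Prod>i<j. - (k + real i)) * ((- k - real j) * (t + \<delta>) powr (- k - real j - 1) * 1) = shifted_power \<delta> k (Suc j) t"
    by (simp add: shifted_power_def algebra_simps)
  finally show ?thesis by (simp add: shifted_power_def[abs_def])
qed

text \<open>Here L is 2N G' + 4t G'' for G(t) =
  \<open>(t + \<delta>) powr - k * flat 0 (1 - t / R\<^sup>2)\<close>, that is, the Laplacian of the
  cut-off kernel in the variable t = \<open>|x - a|^2\<close>. Because N = 2k + 2, the terms in
  which the cut-off is not differentiated combine to -4k(k + 1)\<delta>
  \<open>A powr (- k - 2)\<close> times the cut-off, which expresses superharmonicity of the
  regularized kernel. All other terms carry a factor \<open>R^(-2)\<close> and vanish for t \<ge>
  \<open>R^2\<close>.\<close>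

lemma cutoff_laplacian_bound:
  fixes N k \<delta> R B t :: real
  assumes N: "N = 2 * k + 2" and k: "k > 0" and \<delta>: "\<delta> > 0" and R: "R > 0" "2 * \<delta> \<le> R\<^sup>2" and t: "t > 0"
    and B: "\<And>s. s \<le> 1 \<Longrightarrow> \<bar>flat 1 s\<bar> \<le> B" "\<And>s. s \<le> 1 \<Longrightarrow> \<bar>flat 2 s\<bar> \<le> B" "B \<ge> 0"
  defines "A \<equiv> t + \<delta>" and "\<tau> \<equiv> 1 - t / R\<^sup>2"
  defines "L \<equiv> 2 * N * (- k * A powr (- k - 1) * flat 0 \<tau> - A powr - k * flat 1 \<tau> / R\<^sup>2)
    + 4 * t * (k * (k + 1) * A powr (- k - 2) * flat 0 \<tau> + 2 * k * A powr (- k - 1) * flat 1 \<tau> / R\<^sup>2 + A powr - k * flat 2 \<tau> / R\<^sup>2 / R\<^sup>2)"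
  shows "- L \<ge> (if t < \<delta> then 4 * k * (k + 1) * 2 powr (- k - 2) * flat 0 (1/2) * \<delta> powr (- k - 1) else 0)
      - (if t < R\<^sup>2 then (2 * N + 8 * k + 4) * B / R\<^sup>2 * t powr - k else 0)"
proof -
  have A: "A > 0" "t \<le> A" using t \<delta> by (auto simp: A_def)
  have R2: "R\<^sup>2 > 0" using R by simp
  have A1: "A powr (- k - 1) = A * A powr (- k - 2)"
    using A powr_add[of A 1 "- k - 2"] arg_cong[of "1 + (- k - 2)" "- k - 1" "\<lambda>e. A powr e"] by simp
  have A2: "A powr - k = A * A powr (- k - 1)"
    using A powr_add[of A 1 "- k - 1"] arg_cong[of "1 + (- k - 1)" "- k" "\<lambda>e. A powr e"] by simp
  \<comment> \<open>P is the superharmonic part; E collects the terms containing a derivative of the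
    cut-off.\<close>
  define P where "P = 4 * k * (k + 1) * \<delta> * A powr (- k - 2) * flat 0 \<tau>"
  define E where "E = A powr - k * (2 * N * flat 1 \<tau> / R\<^sup>2) - 8 * k * (t * A powr (- k - 1)) * flat 1 \<tau> / R\<^sup>2 - 4 * A powr - k * (t / R\<^sup>2) * flat 2 \<tau> / R\<^sup>2"
  have L: "- L = P + E"
  proof -
    have "4 * t * (k * (k + 1) * A powr (- k - 2) * flat 0 \<tau>) + 2 * N * (- k * A powr (- k - 1) * flat 0 \<tau>) = - P"
      unfolding A1 P_def N by (simp add: A_def algebra_simps)
    then show ?thesis unfolding L_def E_def by (simp add: algebra_simps)
  qed
  have E: "\<bar>E\<bar> \<le> (if t < R\<^sup>2 then (2 * N + 8 * k + 4) * B / R\<^sup>2 * t powr - k else 0)"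
  proof (cases "t < R\<^sup>2")
    case False
    then have "\<tau> \<le> 0" using R2 by (simp add: \<tau>_def field_simps)
    then show ?thesis using False by (simp add: E_def flat_zero)
  next
    case True
    have \<tau>: "\<tau> \<le> 1" using t R2 by (simp add: \<tau>_def)
    have Np: "N > 0" using N k by simp
    have e1: "\<bar>A powr - k * (2 * N * flat 1 \<tau> / R\<^sup>2)\<bar> \<le> A powr - k * (2 * N * B / R\<^sup>2)"
      using B(1)[OF \<tau>] Np by (auto simp: abs_mult intro!: mult_left_mono divide_right_mono)
    have "t * A powr (- k - 1) \<le> A powr - k" unfolding A2 using A by (intro mult_right_mono) auto
    then have "\<bar>8 * k * (t * A powr (- k - 1)) * flat 1 \<tau> / R\<^sup>2\<bar> \<le> 8 * k * A powr - k * B / R\<^sup>2"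
      using B(1)[OF \<tau>] k t by (auto simp: abs_mult intro!: mult_mono divide_right_mono)
    moreover have "\<bar>4 * A powr - k * (t / R\<^sup>2) * flat 2 \<tau> / R\<^sup>2\<bar> \<le> 4 * A powr - k * (1 * B) / R\<^sup>2"
    proof -
      have "t / R\<^sup>2 * \<bar>flat 2 \<tau>\<bar> \<le> 1 * B" using B(2)[OF \<tau>] t True R2 B(3) by (intro mult_mono) auto
      then have "4 * A powr - k * (t / R\<^sup>2 * \<bar>flat 2 \<tau>\<bar>) / R\<^sup>2 \<le> 4 * A powr - k * (1 * B) / R\<^sup>2"
        by (intro divide_right_mono mult_left_mono) auto
      then show ?thesis using t by (simp add: abs_mult)
    qed
    ultimately have "\<bar>E\<bar> \<le> A powr - k * (2 * N * B / R\<^sup>2) + 8 * k * A powr - k * B / R\<^sup>2 + 4 * A powr - k * (1 * B) / R\<^sup>2"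
      unfolding E_def using e1 by linarith
    also have "\<dots> = (2 * N + 8 * k + 4) * B / R\<^sup>2 * A powr - k" using R2 by (simp add: field_simps)
    also have "\<dots> \<le> (2 * N + 8 * k + 4) * B / R\<^sup>2 * t powr - k"
      using A t k Np B R2 by (intro mult_left_mono powr_mono2') auto
    finally show ?thesis using True by simp
  qed
  have P: "P \<ge> (if t < \<delta> then 4 * k * (k + 1) * 2 powr (- k - 2) * flat 0 (1/2) * \<delta> powr (- k - 1) else 0)"
  proof (cases "t < \<delta>")
    case True
    \<comment> \<open>For t < \<delta> the assumption \<open>2 * \<delta> \<le> R\<^sup>2\<close>
      keeps the argument of the cut-off above 1/2, and A is at most 2\<delta>; hence the factors
      \<open>flat 0 (1/2)\<close> and \<open>2 powr (- k - 2)\<close>.\<close>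
    have "1 / 2 \<le> \<tau>" using True R R2 by (simp add: \<tau>_def field_simps)
    then have f: "flat 0 (1/2) \<le> flat 0 \<tau>" by (rule flat_mono)
    have "2 powr (- k - 2) * \<delta> powr (- k - 1) = \<delta> * (2 * \<delta>) powr (- k - 2)"
      using \<delta> powr_add[of \<delta> 1 "- k - 2"] arg_cong[of "1 + (- k - 2)" "- k - 1" "\<lambda>e. \<delta> powr e"] by (simp add: powr_mult)
    also have "\<dots> \<le> \<delta> * A powr (- k - 2)"
      using \<delta> k True A by (intro mult_left_mono powr_mono2') (auto simp: A_def)
    finally have "(4 * k * (k + 1)) * (2 powr (- k - 2) * \<delta> powr (- k - 1)) * flat 0 (1/2) \<le> (4 * k * (k + 1)) * (\<delta> * A powr (- k - 2)) * flat 0 \<tau>"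
      using mult_mono[OF mult_left_mono[of _ _ "4 * k * (k + 1)"] f] k \<delta> flat_nonneg by simp
    then show ?thesis using True by (simp add: P_def mult_ac)
  next
    case False
    then show ?thesis using k \<delta> flat_nonneg[of \<tau>] by (simp add: P_def)
  qed
  show ?thesis unfolding L using P E by linarith
qed

text \<open>The first term on the left approximates a point mass at a: its integral does not depend
  on \<epsilon>. It matters that c and B are uniform in \<epsilon>, R and a. The point a is excluded
  because \<open>norm (a - x) powr (2 - N)\<close> is 0 at x = a by convention, whereas \<psi> is
  positive there.\<close>

lemma almost_fundamental_solution:
  assumes N3: "CARD('n::finite) \<ge> 3"
  shows "\<exists>c B. c > 0 \<and> B \<ge> 0 \<and> (\<forall>\<epsilon> R (a::real^'n). \<epsilon> > 0 \<longrightarrow> R > 0 \<longrightarrow> 2 * \<epsilon>\<^sup>2 \<le> R\<^sup>2 \<longrightarrow>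
    (\<exists>\<psi>\<in>test_functions. \<forall>x. x \<noteq> a \<longrightarrow>
      \<bar>\<psi> x\<bar> \<le> norm (a - x) powr (2 - real CARD('n)) \<and>
      c * \<epsilon> powr - real CARD('n) * indicator {x. dist a x < \<epsilon>} x
        - B / R\<^sup>2 * (norm (a - x) powr (2 - real CARD('n)) * indicator {x. dist a x < R} x)
      \<le> - (\<Sum>i\<in>UNIV. partial_deriv i (partial_deriv i \<psi>) x)))"
proof -
  define N where "N = real CARD('n)"
  define k where "k = (N - 2) / 2"
  have N: "N = 2 * k + 2" by (simp add: k_def field_simps)
  have k: "k > 0" using N3 by (simp add: N_def k_def)
  obtain B1 where B1: "B1 \<ge> 0" "\<And>t. t \<le> 1 \<Longrightarrow> \<bar>flat 1 t\<bar> \<le> B1" using flat_bounded[of 1] by auto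
  obtain B2 where B2: "B2 \<ge> 0" "\<And>t. t \<le> 1 \<Longrightarrow> \<bar>flat 2 t\<bar> \<le> B2" using flat_bounded[of 2] by auto
  define B where "B = max B1 B2"
  have B: "B \<ge> 0" "\<And>t. t \<le> 1 \<Longrightarrow> \<bar>flat 1 t\<bar> \<le> B" "\<And>t. t \<le> 1 \<Longrightarrow> \<bar>flat 2 t\<bar> \<le> B"
    using B1 B2 by (simp_all add: B_def le_max_iff_disj)
  define c where "c = 4 * k * (k + 1) * 2 powr (- k - 2) * flat 0 (1/2)"
  have c: "c > 0" using k flat_pos[of "1/2"] by (simp add: c_def)
  have main: "\<exists>\<psi>\<in>test_functions. \<forall>x. x \<noteq> a \<longrightarrow>
      \<bar>\<psi> x\<bar> \<le> norm (a - x) powr (2 - N) \<and>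
      c * \<epsilon> powr - N * indicator {x. dist a x < \<epsilon>} x
        - (2 * N + 8 * k + 4) * B / R\<^sup>2 * (norm (a - x) powr (2 - N) * indicator {x. dist a x < R} x)
      \<le> - (\<Sum>i\<in>UNIV. partial_deriv i (partial_deriv i \<psi>) x)"
    if \<epsilon>: "\<epsilon> > 0" and R: "R > 0" "2 * \<epsilon>\<^sup>2 \<le> R\<^sup>2" for \<epsilon> R and a :: "real^'n"
  proof -
    \<comment> \<open>With this choice \<open>\<delta> powr (- k - 1)\<close> is
      \<open>\<epsilon> powr - N\<close>, and |x - a| < \<epsilon> means t < \<delta>.\<close>
    define \<delta> where "\<delta> = \<epsilon>\<^sup>2"
    have \<delta>: "\<delta> > 0" using \<epsilon> by (simp add: \<delta>_def)
    define G where "G t = shifted_power \<delta> k 0 t * flat 0 (1 - t / R\<^sup>2)" for t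
    define G' where "G' t = shifted_power \<delta> k 1 t * flat 0 (1 - t / R\<^sup>2) - shifted_power \<delta> k 0 t * flat 1 (1 - t / R\<^sup>2) / R\<^sup>2" for t
    define G'' where "G'' t = shifted_power \<delta> k 2 t * flat 0 (1 - t / R\<^sup>2) - 2 * shifted_power \<delta> k 1 t * flat 1 (1 - t / R\<^sup>2) / R\<^sup>2
        + shifted_power \<delta> k 0 t * flat 2 (1 - t / R\<^sup>2) / R\<^sup>2 / R\<^sup>2" for t
    have fl: "((\<lambda>t. flat j (1 - t / R\<^sup>2)) has_real_derivative flat (Suc j) (1 - t / R\<^sup>2) * (- 1 / R\<^sup>2)) (at t)" for j t
    proof (rule DERIV_chain2[OF flat_deriv])
      show "((\<lambda>t. 1 - t / R\<^sup>2) has_real_derivative - 1 / R\<^sup>2) (at t)"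
        using DERIV_diff[OF DERIV_const DERIV_cdivide[OF DERIV_ident], of 1 "R\<^sup>2" t UNIV] by simp
    qed
    have sh: "(shifted_power \<delta> k j has_real_derivative shifted_power \<delta> k (Suc j) t) (at t)" if "t \<ge> 0" for j t
      using that \<delta> by (intro shifted_power_deriv) auto
    have dG: "(G has_real_derivative G' t) (at t)" if "t \<ge> 0" for t
      using DERIV_mult[OF sh[OF that, of 0] fl[of 0 t]] unfolding G_def[abs_def] G'_def by (simp add: mult_ac)
    have dG': "(G' has_real_derivative G'' t) (at t)" if "t \<ge> 0" for t
    proof -
      have eq: "S2 * F0 + F1 * (- 1 / r) * S1 - (S1 * F1 + F2 * (- 1 / r) * S0) / r
          = S2 * F0 - 2 * S1 * F1 / r + S0 * F2 / r / r" for S0 S1 S2 F0 F1 F2 r :: real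
        by (simp add: add_divide_distrib diff_divide_distrib mult_ac)
      have nat: "Suc 0 = 1" "Suc 1 = 2" by simp_all
      show ?thesis unfolding G'_def[abs_def]
        by (rule DERIV_cong[OF DERIV_diff[OF DERIV_mult[OF sh[OF that, of 1] fl[of 0 t]]
              DERIV_cdivide[OF DERIV_mult[OF sh[OF that, of 0] fl[of 1 t]], of "R\<^sup>2"]]])
           (unfold G''_def nat, rule eq)
    qed
    define \<psi> where "\<psi> x = G ((norm (x - a))\<^sup>2)" for x
    have sm: "smooth \<psi>"
    proof -
      have 1: "smooth (\<lambda>x. shifted_power \<delta> k 0 ((norm (x - a))\<^sup>2))"
        by (rule smooth_compose[where D = "shifted_power \<delta> k", OF sh smooth_norm_power2]) simp
      have 2: "smooth (\<lambda>x. flat 0 (1 - (norm (x - a))\<^sup>2 * (1 / R\<^sup>2)))"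
        by (intro smooth_flat smooth_diff smooth_mult smooth_const smooth_norm_power2)
      show ?thesis using smooth_mult[OF 1 2] by (simp add: \<psi>_def[abs_def] G_def)
    qed
    have supp: "dist a x < R" if "\<psi> x \<noteq> 0" for x
    proof -
      have "0 < 1 - (norm (x - a))\<^sup>2 / R\<^sup>2"
        using that flat_zero[of "1 - (norm (x - a))\<^sup>2 / R\<^sup>2" 0] unfolding \<psi>_def G_def
        by (metis mult_zero_right not_le)
      then have "(norm (x - a))\<^sup>2 < R\<^sup>2" using R by (simp add: field_simps)
      then show ?thesis using R by (simp add: dist_norm norm_minus_commute power2_less_imp_less)
    qed
    then have "{x. \<psi> x \<noteq> 0} \<subseteq> ball a R" by auto
    then have test: "\<psi> \<in> test_functions"
      using sm bounded_subset[OF bounded_ball] by (auto simp: test_functions_iff)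
    have "\<bar>\<psi> x\<bar> \<le> norm (a - x) powr (2 - N) \<and>
      c * \<epsilon> powr - N * indicator {x. dist a x < \<epsilon>} x
        - (2 * N + 8 * k + 4) * B / R\<^sup>2 * (norm (a - x) powr (2 - N) * indicator {x. dist a x < R} x)
      \<le> - (\<Sum>i\<in>UNIV. partial_deriv i (partial_deriv i \<psi>) x)" if x: "x \<noteq> a" for x
    proof
      define t where "t = (norm (x - a))\<^sup>2"
      have t: "t > 0" using x by (simp add: t_def)
      have tk: "t powr - k = norm (a - x) powr (2 - N)"
      proof -
        have "t = norm (a - x) powr 2" using x by (simp add: t_def norm_minus_commute powr_realpow)
        then show ?thesis by (simp only: powr_powr) (simp add: N)
      qed
      have "\<bar>\<psi> x\<bar> = (t + \<delta>) powr - k * flat 0 (1 - t / R\<^sup>2)"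
        using flat_nonneg by (simp add: \<psi>_def G_def shifted_power_def t_def abs_mult)
      also have "\<dots> \<le> t powr - k * 1"
        using t \<delta> k flat_nonneg flat_le_1 by (intro mult_mono powr_mono2') auto
      finally show "\<bar>\<psi> x\<bar> \<le> norm (a - x) powr (2 - N)" by (simp add: tk)
      have lap: "(\<Sum>i\<in>UNIV. partial_deriv i (partial_deriv i \<psi>) x) = 2 * N * G' t + 4 * t * G'' t"
        unfolding \<psi>_def[abs_def] N_def t_def by (rule radial_laplacian[OF dG dG'])
      have de: "dist a x < \<epsilon> \<longleftrightarrow> t < \<delta>" and dR: "dist a x < R \<longleftrightarrow> t < R\<^sup>2"
      proof -
        have "dist a x < \<rho> \<longleftrightarrow> t < \<rho>\<^sup>2" if "\<rho> > 0" for \<rho>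
          using power_mono_iff[of \<rho> "norm (x - a)" 2] that
          by (simp add: t_def dist_norm norm_minus_commute not_le[symmetric])
        then show "dist a x < \<epsilon> \<longleftrightarrow> t < \<delta>" "dist a x < R \<longleftrightarrow> t < R\<^sup>2"
          using \<epsilon> R by (simp_all add: \<delta>_def)
      qed
      have \<epsilon>N: "\<epsilon> powr - N = \<delta> powr (- k - 1)"
      proof -
        have "\<delta> = \<epsilon> powr 2" using \<epsilon> by (simp add: \<delta>_def powr_realpow)
        then show ?thesis
          by (simp only: powr_powr) (rule arg_cong[where f = "\<lambda>e. \<epsilon> powr e"], simp add: N)
      qed
      have "(if t < \<delta> then c * \<delta> powr (- k - 1) else 0) - (if t < R\<^sup>2 then (2 * N + 8 * k + 4) * B / R\<^sup>2 * t powr - k else 0)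
         \<le> - (2 * N * G' t + 4 * t * G'' t)"
      proof -
        have S: "shifted_power \<delta> k 0 t = (t + \<delta>) powr - k" "shifted_power \<delta> k 1 t = - k * (t + \<delta>) powr (- k - 1)"
          "shifted_power \<delta> k 2 t = k * (k + 1) * (t + \<delta>) powr (- k - 2)"
          by (simp_all add: shifted_power_def numeral_2_eq_2 algebra_simps)
        have "G' t = - k * (t + \<delta>) powr (- k - 1) * flat 0 (1 - t / R\<^sup>2) - (t + \<delta>) powr - k * flat 1 (1 - t / R\<^sup>2) / R\<^sup>2"
          by (simp only: G'_def S)
        moreover have "G'' t = k * (k + 1) * (t + \<delta>) powr (- k - 2) * flat 0 (1 - t / R\<^sup>2) + 2 * k * (t + \<delta>) powr (- k - 1) * flat 1 (1 - t / R\<^sup>2) / R\<^sup>2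
           + (t + \<delta>) powr - k * flat 2 (1 - t / R\<^sup>2) / R\<^sup>2 / R\<^sup>2"
          unfolding G''_def S by simp
        ultimately show ?thesis
          using cutoff_laplacian_bound[OF N k \<delta> R(1) _ t B(2,3,1)] R(2) by (simp only: c_def \<delta>_def)
      qed
      then show "c * \<epsilon> powr - N * indicator {x. dist a x < \<epsilon>} x
        - (2 * N + 8 * k + 4) * B / R\<^sup>2 * (norm (a - x) powr (2 - N) * indicator {x. dist a x < R} x)
         \<le> - (\<Sum>i\<in>UNIV. partial_deriv i (partial_deriv i \<psi>) x)"
        unfolding lap \<epsilon>N tk[symmetric] indicator_def mem_Collect_eq de dR
        by (cases "t < \<delta>"; cases "t < R\<^sup>2") (simp_all only: if_True if_False, simp_all)
    qed
    with test show ?thesis by (intro bexI[of _ \<psi>]) auto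
  qed
  have B': "(2 * N + 8 * k + 4) * B \<ge> 0" using B N k by auto
  show ?thesis unfolding N_def[symmetric]
    by (intro exI[of _ c] exI[of _ "(2 * N + 8 * k + 4) * B"] conjI allI impI c B' main)
qed

section \<open>Test functions and weak gradients\<close>

lemma test_smooth: "f \<in> test_functions \<Longrightarrow> smooth f"
  by (simp add: test_functions_iff)

lemma test_support:
  assumes "f \<in> test_functions"
  obtains r where "r > 0" "\<And>x. f x \<noteq> 0 \<Longrightarrow> norm x \<le> r"
  using assms by (auto simp: test_functions_iff bounded_pos)

lemma test_partial_deriv:
  assumes "f \<in> test_functions"
  shows "partial_deriv i f \<in> test_functions"
proof -
  obtain r where r: "r > 0" "\<And>x. f x \<noteq> 0 \<Longrightarrow> norm x \<le> r" using test_support[OF assms] by blast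
  have "norm x \<le> r" if "partial_deriv i f x \<noteq> 0" for x
  proof (rule ccontr)
    assume x: "\<not> norm x \<le> r"
    have "((\<lambda>x. 0) has_derivative (\<lambda>x. 0)) (at x)" by simp
    moreover have "open {x :: real^'a. norm x > r}" by (intro open_Collect_less continuous_intros)
    ultimately have "(f has_derivative (\<lambda>x. 0)) (at x)"
      by (rule has_derivative_transform_within_open) (use x r in force)+
    from partial_deriv_eq[OF this] show False using that by simp
  qed
  then have "{x. partial_deriv i f x \<noteq> 0} \<subseteq> cball 0 r" by auto
  then show ?thesis using assms bounded_subset[OF bounded_cball]
    by (auto simp: test_functions_iff smooth_partial_deriv)
qed

lemma test_mult:
  assumes "f \<in> test_functions" "smooth g"
  shows "(\<lambda>x. f x * g x) \<in> test_functions"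
proof -
  have "bounded {x. f x * g x \<noteq> 0}"
    by (rule bounded_subset[of "{x. f x \<noteq> 0}"]) (use assms in \<open>auto simp: test_functions_iff\<close>)
  then show ?thesis using assms by (simp add: test_functions_iff smooth_mult)
qed

lemma test_diff:
  assumes "f \<in> test_functions" "g \<in> test_functions"
  shows "(\<lambda>x. f x - g x) \<in> test_functions"
proof -
  have "bounded {x. f x - g x \<noteq> 0}"
    by (rule bounded_subset[of "{x. f x \<noteq> 0} \<union> {x. g x \<noteq> 0}"]) (use assms in \<open>auto simp: test_functions_iff\<close>)
  then show ?thesis using assms by (simp add: test_functions_iff smooth_diff)
qed

lemma test_continuous: "f \<in> test_functions \<Longrightarrow> continuous_on S f"
  using continuous_on_subset smooth_continuous test_smooth by blast

lemma test_measurable: "f \<in> test_functions \<Longrightarrow> f \<in> borel_measurable borel"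
  by (intro borel_measurable_continuous_onI test_continuous)

lemma test_bounded:
  assumes "f \<in> test_functions"
  obtains B r where "B \<ge> 0" "r > 0" "\<And>x. \<bar>f x\<bar> \<le> B" "\<And>x. norm x > r \<Longrightarrow> f x = 0"
proof -
  obtain r where r: "r > 0" "\<And>x. f x \<noteq> 0 \<Longrightarrow> norm x \<le> r" using test_support[OF assms] by blast
  have "bounded (f ` cball 0 r)"
    by (intro compact_imp_bounded compact_continuous_image test_continuous assms) auto
  then obtain B where B: "\<forall>x\<in>cball 0 r. \<bar>f x\<bar> \<le> B" by (auto simp: bounded_iff)
  have "\<bar>f x\<bar> \<le> max B 0" for x
  proof (cases "norm x \<le> r")
    case True
    then show ?thesis using B by (simp add: le_max_iff_disj)
  next
    case False
    then have "f x = 0" using r(2)[of x] by auto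
    then show ?thesis by simp
  qed
  moreover have "f x = 0" if "norm x > r" for x using r(2)[of x] that by auto
  ultimately show ?thesis using r(1) by (intro that[of "max B 0" r]) auto
qed

lemma test_integrable:
  assumes "f \<in> test_functions"
  shows "integrable lborel f"
proof -
  obtain B r where *: "B \<ge> 0" "r > 0" "\<And>x. \<bar>f x\<bar> \<le> B" "\<And>x. norm x > r \<Longrightarrow> f x = 0"
    using test_bounded[OF assms] by blast
  have "integrable lborel (\<lambda>x. indicator (cball 0 r) x *\<^sub>R f x)"
    by (intro borel_integrable_compact test_continuous assms) auto
  moreover have "(\<lambda>x. indicator (cball 0 r) x *\<^sub>R f x) = f"
  proof
    fix x show "indicator (cball 0 r) x *\<^sub>R f x = f x" using *(4)[of x] by (cases "norm x \<le> r") auto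
  qed
  ultimately show ?thesis by simp
qed

text \<open>The difference quotients integrate to 0 by translation invariance.\<close>

lemma integral_partial_deriv_eq_0:
  fixes f :: "real ^ 'n::finite \<Rightarrow> real"
  assumes f: "f \<in> test_functions"
  shows "(\<integral>x. partial_deriv i f x \<partial>lborel) = 0"
proof -
  define e where "e = (axis i 1 :: real ^ 'n)"
  have ne: "norm e = 1" by (simp add: e_def)
  obtain r where r: "r > 0" "\<And>x. f x \<noteq> 0 \<Longrightarrow> norm x \<le> r" using test_support[OF f] by blast
  obtain B where B: "B \<ge> 0" "\<And>x. \<bar>partial_deriv i f x\<bar> \<le> B"
    using test_bounded[OF test_partial_deriv[OF f]] by metis
  define s where "s n = 1 / real (Suc n)" for n
  have s: "0 < s n" "s n \<le> 1" for n by (auto simp: s_def field_simps)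
  have s0: "s \<longlonglongrightarrow> 0" unfolding s_def using LIMSEQ_inverse_real_of_nat by (simp add: inverse_eq_divide)
  define q where "q n x = (f (x + s n *\<^sub>R e) - f x) / s n" for n x
  note [measurable] = test_measurable[OF f] test_measurable[OF test_partial_deriv[OF f]]
  have line: "((\<lambda>t. f (x + t *\<^sub>R e)) has_real_derivative partial_deriv i f (x + t *\<^sub>R e)) (at t)" for x t
  proof -
    have "(f has_derivative frechet_derivative f (at (x + t *\<^sub>R e))) (at (x + t *\<^sub>R e))"
      using smooth_differentiable[OF test_smooth[OF f]] frechet_derivative_works by blast
    moreover have "((\<lambda>t. x + t *\<^sub>R e) has_derivative (\<lambda>h. h *\<^sub>R e)) (at t)"
      by (auto intro!: derivative_eq_intros)
    ultimately have d: "((\<lambda>t. f (x + t *\<^sub>R e)) has_derivative (\<lambda>h. frechet_derivative f (at (x + t *\<^sub>R e)) (h *\<^sub>R e))) (at t)"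
      using has_derivative_compose by blast
    have "linear (frechet_derivative f (at (x + t *\<^sub>R e)))"
      using smooth_differentiable[OF test_smooth[OF f]] linear_frechet_derivative by blast
    then have "(\<lambda>h. frechet_derivative f (at (x + t *\<^sub>R e)) (h *\<^sub>R e)) = (*) (partial_deriv i f (x + t *\<^sub>R e))"
      by (auto simp: linear_cmul partial_deriv_def e_def mult.commute)
    then show ?thesis using d by (simp add: has_field_derivative_def)
  qed
  \<comment> \<open>By the mean value theorem the quotients obey the bound on the derivative, and
    since s n \<le> 1 they all vanish outside one ball; together this gives the dominating
    function.\<close>
  have q_bound: "norm (q n x) \<le> B * indicator (cball 0 (r + 1)) x" for n x
  proof (cases "norm x \<le> r + 1")
    case True
    have "\<exists>\<xi>. 0 < \<xi> \<and> \<xi> < s n \<and> f (x + s n *\<^sub>R e) - f (x + 0 *\<^sub>R e) = (s n - 0) * partial_deriv i f (x + \<xi> *\<^sub>R e)"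
      by (rule MVT2[OF s(1), where f = "\<lambda>t. f (x + t *\<^sub>R e)" and f' = "\<lambda>t. partial_deriv i f (x + t *\<^sub>R e)"]) (rule line)
    then obtain \<xi> where "f (x + s n *\<^sub>R e) - f (x + 0 *\<^sub>R e) = (s n - 0) * partial_deriv i f (x + \<xi> *\<^sub>R e)" by blast
    then have "q n x = partial_deriv i f (x + \<xi> *\<^sub>R e)" using s[of n] by (simp add: q_def)
    then show ?thesis using B True by simp
  next
    case False
    have "norm x \<le> norm (x + s n *\<^sub>R e) + norm (s n *\<^sub>R e)"
      using norm_triangle_ineq4[of "x + s n *\<^sub>R e" "s n *\<^sub>R e"] by simp
    then have "norm (x + s n *\<^sub>R e) > r" using False s[of n] ne by simp
    then have "f (x + s n *\<^sub>R e) = 0" "f x = 0" using r(2)[of "x + s n *\<^sub>R e"] r(2)[of x] False by auto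
    then show ?thesis by (simp add: q_def B)
  qed
  have q_lim: "(\<lambda>n. q n x) \<longlonglongrightarrow> partial_deriv i f x" for x
  proof -
    have "((\<lambda>h. (f (x + h *\<^sub>R e) - f x) / h) \<longlongrightarrow> partial_deriv i f x) (at 0)"
      using line[of x 0] by (simp add: has_field_derivative_iff)
    moreover have "filterlim s (at 0) sequentially"
      unfolding filterlim_at
    proof
      show "\<forall>\<^sub>F n in sequentially. s n \<in> UNIV \<and> s n \<noteq> 0" using s(1) by (intro always_eventually) (simp add: less_imp_neq[THEN not_sym])
    qed (rule s0)
    ultimately show ?thesis unfolding q_def by (rule filterlim_compose)
  qed
  have "(\<lambda>n. \<integral>x. q n x \<partial>lborel) \<longlonglongrightarrow> (\<integral>x. partial_deriv i f x \<partial>lborel)"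
  proof (rule integral_dominated_convergence[where w = "\<lambda>x. B * indicator (cball 0 (r + 1)) x"])
    show "integrable lborel (\<lambda>x::real^'n. B * indicator (cball 0 (r + 1)) x)"
      using emeasure_bounded_finite[of "cball (0::real^'n) (r + 1)"]
      by (intro integrable_mult_right integrable_real_indicator) auto
    show "q n \<in> borel_measurable lborel" for n unfolding q_def[abs_def] by measurable
  qed (use q_bound q_lim in auto)
  moreover have "(\<integral>x. q n x \<partial>lborel) = 0" for n
  proof -
    have shift: "integrable lborel (\<lambda>x. f (s n *\<^sub>R e + x))" "(\<integral>x. f (s n *\<^sub>R e + x) \<partial>lborel) = (\<integral>x. f x \<partial>lborel)"
    proof -
      have "integrable (distr lborel borel ((+) (s n *\<^sub>R e))) f"
        unfolding lborel_distr_plus by (rule test_integrable[OF f])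
      then show "integrable lborel (\<lambda>x. f (s n *\<^sub>R e + x))" by (subst (asm) integrable_distr_eq) auto
      have "(\<integral>x. f x \<partial>lborel) = (\<integral>x. f x \<partial>(distr lborel borel ((+) (s n *\<^sub>R e))))"
        unfolding lborel_distr_plus ..
      then show "(\<integral>x. f (s n *\<^sub>R e + x) \<partial>lborel) = (\<integral>x. f x \<partial>lborel)" by (subst (asm) integral_distr) auto
    qed
    then show ?thesis using test_integrable[OF f] by (simp add: q_def add.commute)
  qed
  ultimately show ?thesis by (simp add: LIMSEQ_const_iff)
qed

lemma integral_by_parts:
  assumes f: "f \<in> test_functions" and g: "g \<in> test_functions"
  shows "(\<integral>x. f x * partial_deriv i g x \<partial>lborel) = - (\<integral>x. partial_deriv i f x * g x \<partial>lborel)"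
proof -
  have eq: "partial_deriv i (\<lambda>x. f x * g x) = (\<lambda>x. partial_deriv i f x * g x + f x * partial_deriv i g x)"
    using smooth_differentiable[OF test_smooth[OF f]] smooth_differentiable[OF test_smooth[OF g]]
    by (auto simp: partial_deriv_mult)
  have "(\<integral>x. partial_deriv i (\<lambda>x. f x * g x) x \<partial>lborel) = 0"
    using f g by (intro integral_partial_deriv_eq_0 test_mult test_smooth)
  moreover have "integrable lborel (\<lambda>x. partial_deriv i f x * g x)"
    by (intro test_integrable test_mult test_smooth test_partial_deriv f g)
  moreover have "integrable lborel (\<lambda>x. f x * partial_deriv i g x)"
    by (intro test_integrable test_mult test_smooth test_partial_deriv f g)
  ultimately show ?thesis unfolding eq by simp
qed

lemma has_weak_gradient_test:
  assumes f: "f \<in> test_functions"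
  shows "has_weak_gradient f (gradient f)"
  unfolding has_weak_gradient_def
proof (intro conjI allI impI ballI)
  fix K :: "(real^'a) set" assume K: "compact K"
  have KB: "K \<in> sets borel" using K by (simp add: borel_compact)
  show "set_integrable lebesgue K f"
    unfolding set_integrable_def using borel_integrable_compact[OF K test_continuous[OF f]] f
    by (subst integrable_completion) (auto intro!: borel_measurable_scaleR borel_measurable_indicator KB test_measurable)
  have cg: "continuous_on S (gradient f)" for S
    unfolding gradient_def[abs_def] using test_continuous[OF test_partial_deriv[OF f]] by (intro continuous_on_vec_lambda)
  show "set_integrable lebesgue K (gradient f)"
    unfolding set_integrable_def using borel_integrable_compact[OF K cg]
    by (subst integrable_completion) (auto intro!: borel_measurable_scaleR borel_measurable_indicator KB borel_measurable_continuous_onI cg)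
next
  fix \<psi> :: "real^'a \<Rightarrow> real" and i assume \<psi>: "\<psi> \<in> test_functions"
  have "(\<lambda>x. f x * partial_deriv i \<psi> x) \<in> test_functions" "(\<lambda>x. partial_deriv i f x * \<psi> x) \<in> test_functions"
    by (intro test_mult test_smooth test_partial_deriv f \<psi>)+
  then show "(\<integral>x. f x * partial_deriv i \<psi> x \<partial>lebesgue) = - (\<integral>x. gradient f x $ i * \<psi> x \<partial>lebesgue)"
    using integral_by_parts[OF f \<psi>, of i] by (simp add: gradient_def integral_completion test_measurable)
qed

section \<open>Uniqueness of weak gradients\<close>

lemma integrable_mult_test:
  fixes h :: "real ^ 'n::finite \<Rightarrow> real"
  assumes h: "\<And>K. compact K \<Longrightarrow> set_integrable lebesgue K h" and \<phi>: "\<phi> \<in> test_functions"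
  shows "integrable lebesgue (\<lambda>x. h x * \<phi> x)"
proof -
  obtain B r where B: "B \<ge> 0" "\<And>x. \<bar>\<phi> x\<bar> \<le> B" and r: "\<And>x. norm x > r \<Longrightarrow> \<phi> x = 0"
    using test_bounded[OF \<phi>] by metis
  have i: "integrable lebesgue (\<lambda>x. indicator (cball 0 r) x * h x)"
    using h[of "cball 0 r"] by (simp add: set_integrable_def)
  have eq: "(\<lambda>x. h x * \<phi> x) = (\<lambda>x. (indicator (cball 0 r) x * h x) * \<phi> x)"
  proof
    fix x show "h x * \<phi> x = (indicator (cball 0 r) x * h x) * \<phi> x" using r[of x] by (cases "norm x \<le> r") auto
  qed
  have m: "(\<lambda>x. h x * \<phi> x) \<in> borel_measurable lebesgue" unfolding eq
    by (intro borel_measurable_times borel_measurable_integrable[OF i] measurable_completion)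
       (simp add: test_measurable[OF \<phi>])
  show ?thesis
  proof (rule Bochner_Integration.integrable_bound[OF integrable_mult_right[OF i, of B] m], intro AE_I2)
    fix x
    show "norm (h x * \<phi> x) \<le> norm (B * (indicator (cball 0 r) x * h x))"
      using mult_right_mono[OF B(2)[of x], of "\<bar>h x\<bar>"] r[of x] B(1)
      by (cases "norm x \<le> r") (auto simp: abs_mult mult.commute)
  qed
qed

lemma set_integrable_component:
  fixes H :: "'a \<Rightarrow> real ^ 'n::finite"
  shows "set_integrable M K H \<Longrightarrow> set_integrable M K (\<lambda>x. H x $ i)"
  using integrable_bounded_linear[OF bounded_linear_vec_nth, of M "\<lambda>x. indicator K x *\<^sub>R H x" i]
  by (simp add: set_integrable_def)

text \<open>As m grows, these smooth functions tend pointwise to the indicator of the open box: each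
  factor vanishes outside its half-space and tends to 1 inside, and all values stay in [0, 1]. They
  take the place of mollified indicators.\<close>

definition box_bump :: "real ^ 'n \<Rightarrow> real ^ 'n \<Rightarrow> nat \<Rightarrow> real ^ 'n::finite \<Rightarrow> real" where
  "box_bump a b m x = (\<Prod>i\<in>UNIV. flat 0 (real m * (x $ i - a $ i)) * flat 0 (real m * (b $ i - x $ i)))"

lemma box_bump_support: "x \<notin> box a b \<Longrightarrow> box_bump a b m x = 0"
proof -
  assume "x \<notin> box a b"
  then obtain i where "\<not> (a $ i < x $ i \<and> x $ i < b $ i)" by (auto simp: mem_box_cart)
  then have "flat 0 (real m * (x $ i - a $ i)) * flat 0 (real m * (b $ i - x $ i)) = 0"
    by (auto simp: not_less mult_nonneg_nonpos flat_zero)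
  then show ?thesis unfolding box_bump_def by (intro prod_zero) auto
qed

lemma box_bump_test: "box_bump a b m \<in> test_functions"
proof -
  have "smooth (\<lambda>x. \<Prod>i\<in>UNIV. flat 0 (real m * (x $ i - a $ i)) * flat 0 (real m * (b $ i - x $ i)))"
    by (intro smooth_prod smooth_mult[OF smooth_flat smooth_flat] smooth_mult[OF smooth_const] smooth_diff
        smooth_const smooth_component) auto
  moreover have "bounded {x. box_bump a b m x \<noteq> 0}"
    by (rule bounded_subset[OF bounded_box[of a b]]) (use box_bump_support in blast)
  ultimately show ?thesis by (simp add: test_functions_iff box_bump_def[abs_def])
qed

lemma box_bump_bounds: "0 \<le> box_bump a b m x" "box_bump a b m x \<le> 1"
  unfolding box_bump_def
  by (auto intro!: prod_nonneg prod_le_1 mult_nonneg_nonneg mult_le_one flat_nonneg flat_le_1)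

lemma flat_tendsto_1:
  assumes "t > 0"
  shows "(\<lambda>m. flat 0 (real m * t)) \<longlonglongrightarrow> 1"
proof -
  have "(\<lambda>m. exp (- (inverse (real m) * (1 / t)))) \<longlonglongrightarrow> exp (- (0 * (1 / t)))"
    by (intro tendsto_intros lim_inverse_n)
  moreover have "\<forall>\<^sub>F m in sequentially. exp (- (inverse (real m) * (1 / t))) = flat 0 (real m * t)"
    using eventually_gt_at_top[of 0] by eventually_elim (use assms in \<open>auto simp: flat_def field_simps\<close>)
  ultimately show ?thesis by (simp add: tendsto_cong)
qed

lemma box_bump_tendsto: "(\<lambda>m. box_bump a b m x) \<longlonglongrightarrow> indicator (box a b) x"
proof (cases "x \<in> box a b")
  case True
  then have "(\<lambda>m. box_bump a b m x) \<longlonglongrightarrow> (\<Prod>i\<in>(UNIV::'a set). 1 * 1)"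
    unfolding box_bump_def by (intro tendsto_prod tendsto_mult flat_tendsto_1) (auto simp: mem_box_cart)
  then show ?thesis using True by simp
qed (simp add: box_bump_support)

lemma integral_box_eq_0:
  fixes w :: "real ^ 'n::finite \<Rightarrow> real"
  assumes w: "\<And>K. compact K \<Longrightarrow> set_integrable lebesgue K w"
    and 0: "\<And>\<psi>. \<psi> \<in> test_functions \<Longrightarrow> (\<integral>x. w x * \<psi> x \<partial>lebesgue) = 0"
  shows "(\<integral>x. indicator (box a b) x * w x \<partial>lebesgue) = 0"
proof -
  have int: "integrable lebesgue (\<lambda>x. indicator (cbox a b) x * w x)"
    using w[of "cbox a b"] by (simp add: set_integrable_def)
  have "(\<lambda>m. \<integral>x. w x * box_bump a b m x \<partial>lebesgue) \<longlonglongrightarrow> (\<integral>x. indicator (box a b) x * w x \<partial>lebesgue)"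
  proof (rule integral_dominated_convergence[where w = "\<lambda>x. \<bar>indicator (cbox a b) x * w x\<bar>"])
    have eq: "(\<lambda>x. w x * box_bump a b m x) = (\<lambda>x. indicator (cbox a b) x * w x * box_bump a b m x)" for m
      using box_bump_support[of _ a b m] box_subset_cbox[of a b] by (fastforce simp: indicator_def)
    have bb: "box_bump a b m \<in> borel_measurable lebesgue" for m
      using test_measurable[OF box_bump_test, of a b m] by (simp add: measurable_completion)
    show "(\<lambda>x. w x * box_bump a b m x) \<in> borel_measurable lebesgue" for m
      unfolding eq by (intro borel_measurable_times borel_measurable_integrable[OF int] bb)
    have eq2: "(\<lambda>x. indicator (box a b) x * w x) = (\<lambda>x. indicator (box a b) x * (indicator (cbox a b) x * w x))"
      using box_subset_cbox[of a b] by (fastforce simp: indicator_def)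
    show "(\<lambda>x. indicator (box a b) x * w x) \<in> borel_measurable lebesgue"
      unfolding eq2 by (intro borel_measurable_times borel_measurable_integrable[OF int] borel_measurable_indicator) auto
    show "AE x in lebesgue. (\<lambda>m. w x * box_bump a b m x) \<longlonglongrightarrow> indicator (box a b) x * w x"
    proof (intro AE_I2)
      fix x
      show "(\<lambda>m. w x * box_bump a b m x) \<longlonglongrightarrow> indicator (box a b) x * w x"
        using tendsto_mult[OF tendsto_const[of "w x"] box_bump_tendsto[of a b x]]
        by (simp add: mult.commute[of "w x" "indicator _ _"])
    qed
    show "AE x in lebesgue. norm (w x * box_bump a b m x) \<le> \<bar>indicator (cbox a b) x * w x\<bar>" for m
    proof (intro AE_I2)
      fix x
      show "norm (w x * box_bump a b m x) \<le> \<bar>indicator (cbox a b) x * w x\<bar>"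
      proof (cases "x \<in> box a b")
        case True
        then show ?thesis using box_bump_bounds[where a=a and b=b and m=m and x=x] box_subset_cbox[of a b]
          by (auto simp: abs_mult mult_left_le)
      qed (simp add: box_bump_support)
    qed
  qed (use int in auto)
  then show ?thesis using 0[OF box_bump_test] by (simp add: LIMSEQ_const_iff)
qed

text \<open>The positive and negative parts of W are densities of finite measures that agree on open
  boxes. Boxes are closed under intersection and generate the Borel sets, so the two measures are
  equal, and then so are their densities almost everywhere.\<close>

lemma AE_eq_0_if_integral_box_eq_0:
  fixes W :: "'a::euclidean_space \<Rightarrow> real"
  assumes W: "integrable lborel W" and 0: "\<And>a b. (\<integral>x. indicator (box a b) x * W x \<partial>lborel) = 0"
  shows "AE x in lborel. W x = 0"
proof -
  have [measurable]: "W \<in> borel_measurable borel" using W by auto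
  define p where "p x = ennreal (W x)" for x
  define n where "n x = ennreal (- W x)" for x
  have [measurable]: "p \<in> borel_measurable borel" "n \<in> borel_measurable borel"
    unfolding p_def[abs_def] n_def[abs_def] by auto
  have fin: "(\<integral>\<^sup>+x. p x \<partial>lborel) < \<infinity>" "(\<integral>\<^sup>+x. n x \<partial>lborel) < \<infinity>"
    using W unfolding real_integrable_def p_def n_def by (auto simp: less_top)
  have box: "(\<integral>\<^sup>+x. p x * indicator (box a b) x \<partial>lborel) = (\<integral>\<^sup>+x. n x * indicator (box a b) x \<partial>lborel)" for a b
  proof -
    have int: "integrable lborel (\<lambda>x. indicator (box a b) x * W x)"
      using integrable_mult_indicator[OF _ W, of "box a b"] by simp
    have 1: "(\<integral>\<^sup>+x. p x * indicator (box a b) x \<partial>lborel) = (\<integral>\<^sup>+x. ennreal (indicator (box a b) x * W x) \<partial>lborel)"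
      by (intro nn_integral_cong) (auto simp: p_def split: split_indicator)
    have 2: "(\<integral>\<^sup>+x. n x * indicator (box a b) x \<partial>lborel) = (\<integral>\<^sup>+x. ennreal (- (indicator (box a b) x * W x)) \<partial>lborel)"
      by (intro nn_integral_cong) (auto simp: n_def split: split_indicator)
    have "enn2real (\<integral>\<^sup>+x. ennreal (indicator (box a b) x * W x) \<partial>lborel) = enn2real (\<integral>\<^sup>+x. ennreal (- (indicator (box a b) x * W x)) \<partial>lborel)"
      using 0[of a b] real_lebesgue_integral_def[OF int] by simp
    moreover have "(\<integral>\<^sup>+x. ennreal (indicator (box a b) x * W x) \<partial>lborel) < \<infinity>" "(\<integral>\<^sup>+x. ennreal (- (indicator (box a b) x * W x)) \<partial>lborel) < \<infinity>"
      using int unfolding real_integrable_def by (auto simp: less_top)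
    ultimately show ?thesis unfolding 1 2 by (metis ennreal_enn2real infinity_ennreal_def)
  qed
  have "density lborel p = density lborel n"
  proof (rule measure_eqI_generator_eq[where E = "range (\<lambda>(a, b). box a b :: 'a set)" and \<Omega> = UNIV
        and A = "\<lambda>n::nat. box (- (real n *\<^sub>R One)) (real n *\<^sub>R One)"])
    show "Int_stable (range (\<lambda>(a, b). box a b :: 'a set))"
      by (auto simp: Int_stable_def box_Int_box)
    show "sets (density lborel p) = sigma_sets UNIV (range (\<lambda>(a, b). box a b))"
      "sets (density lborel n) = sigma_sets UNIV (range (\<lambda>(a, b). box a b))"
      by (simp_all add: borel_eq_box)
    show "range (\<lambda>n::nat. box (- (real n *\<^sub>R One)) (real n *\<^sub>R One :: 'a)) \<subseteq> range (\<lambda>(a, b). box a b)" by auto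
    show "(\<Union>n::nat. box (- (real n *\<^sub>R One)) (real n *\<^sub>R One :: 'a)) = UNIV" by (rule UN_box_eq_UNIV)
  next
    fix k :: nat
    have "emeasure (density lborel p) (box (- (real k *\<^sub>R One)) (real k *\<^sub>R One)) \<le> (\<integral>\<^sup>+x. p x \<partial>lborel)"
      by (subst emeasure_density) (auto intro!: nn_integral_mono split: split_indicator)
    then show "emeasure (density lborel p) (box (- (real k *\<^sub>R One)) (real k *\<^sub>R One)) \<noteq> \<infinity>"
      using fin(1) by (auto simp: top_unique)
  next
    fix X :: "'a set" assume "X \<in> range (\<lambda>(a, b). box a b)"
    then obtain a b where X: "X = box a b" by auto
    show "emeasure (density lborel p) X = emeasure (density lborel n) X"
      unfolding X by (subst (1 2) emeasure_density) (auto simp: box)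
  qed auto
  then have "AE x in lborel. p x = n x"
    using fin by (subst (asm) finite_density_unique) auto
  then show ?thesis
  proof eventually_elim
    case (elim x)
    then show ?case by (cases "W x \<ge> 0") (auto simp: p_def n_def ennreal_neg)
  qed
qed

text \<open>As w is only locally integrable and Lebesgue measurable, it is restricted to growing
  boxes \<open>Q k\<close> and replaced there by an integrable Borel function. A box intersected
  with \<open>Q k\<close> is again a box, so the vanishing integrals carry over to this
  function.\<close>

lemma fundamental_lemma_AE_0:
  fixes w :: "real ^ 'n::finite \<Rightarrow> real"
  assumes w: "\<And>K. compact K \<Longrightarrow> set_integrable lebesgue K w"
    and 0: "\<And>\<psi>. \<psi> \<in> test_functions \<Longrightarrow> (\<integral>x. w x * \<psi> x \<partial>lebesgue) = 0"
  shows "AE x in lebesgue. w x = 0"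
proof -
  define Q where "Q k = box (- (real k *\<^sub>R One)) (real k *\<^sub>R One :: real ^ 'n)" for k :: nat
  have "AE x in lebesgue. indicator (Q k) x * w x = 0" for k
  proof -
    have "set_integrable lebesgue (Q k) w" unfolding Q_def
      by (rule set_integrable_subset[OF w[of "cbox (- (real k *\<^sub>R One)) (real k *\<^sub>R One)"]]) (auto intro: box_subset_cbox[THEN subsetD])
    then have int: "integrable lebesgue (\<lambda>x. indicator (Q k) x * w x)" by (simp add: set_integrable_def)
    obtain W where W: "W \<in> borel_measurable lborel" "AE x in lborel. indicator (Q k) x * w x = W x"
      using completion_ex_borel_measurable_real[OF borel_measurable_integrable[OF int]] by auto
    have AE: "AE x in lebesgue. indicator (Q k) x * w x = W x" using W(2) by (rule AE_completion)
    have Wm: "W \<in> borel_measurable lebesgue" using W(1) by (rule measurable_completion)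
    have "integrable lebesgue W"
      using int AE Wm borel_measurable_integrable[OF int] by (subst integrable_cong_AE[symmetric]) auto
    then have intW: "integrable lborel W" using W(1) by (simp add: integrable_completion)
    have "(\<integral>x. indicator (box a b) x * W x \<partial>lborel) = 0" for a b
    proof -
      obtain a' b' where Q: "box a b \<inter> Q k = box a' b'" unfolding Q_def box_Int_box by blast
      have "(\<integral>x. indicator (box a b) x * W x \<partial>lborel) = (\<integral>x. indicator (box a b) x * W x \<partial>lebesgue)"
        using W(1) by (subst integral_completion) auto
      also have "\<dots> = (\<integral>x. indicator (box a b) x * (indicator (Q k) x * w x) \<partial>lebesgue)"
      proof (rule integral_cong_AE)
        have b: "(indicator (box a b) :: _ \<Rightarrow> real) \<in> borel_measurable lebesgue"
          by (intro borel_measurable_indicator) auto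
        show "(\<lambda>x. indicator (box a b) x * W x) \<in> borel_measurable lebesgue"
          by (rule borel_measurable_times[OF b Wm])
        show "(\<lambda>x. indicator (box a b) x * (indicator (Q k) x * w x)) \<in> borel_measurable lebesgue"
          by (rule borel_measurable_times[OF b borel_measurable_integrable[OF int]])
        show "AE x in lebesgue. indicator (box a b) x * W x = indicator (box a b) x * (indicator (Q k) x * w x)"
          using AE by eventually_elim simp
      qed
      also have "\<dots> = (\<integral>x. indicator (box a' b') x * w x \<partial>lebesgue)"
        unfolding Q[symmetric] by (simp add: indicator_inter_arith mult.assoc)
      also have "\<dots> = 0" by (rule integral_box_eq_0[OF w 0])
      finally show ?thesis .
    qed
    from AE_eq_0_if_integral_box_eq_0[OF intW this] have "AE x in lebesgue. W x = 0" by (rule AE_completion)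
    with AE show ?thesis by eventually_elim simp
  qed
  then have "AE x in lebesgue. \<forall>k. indicator (Q k) x * w x = 0" unfolding AE_all_countable by blast
  then show ?thesis
  proof eventually_elim
    case (elim x)
    have "x \<in> (\<Union>k. Q k)" unfolding Q_def using UN_box_eq_UNIV by blast
    with elim show ?case by (metis UN_E indicator_simps(1) mult_1)
  qed
qed

lemma weak_gradient_unique:
  assumes "has_weak_gradient u G" "has_weak_gradient u H"
  shows "AE x in lebesgue. G x = H x"
proof -
  have comp: "set_integrable lebesgue K (\<lambda>x. G x $ i)" if "has_weak_gradient u G" "compact K" for K G i
    using that by (intro set_integrable_component) (simp add: has_weak_gradient_def)
  have "AE x in lebesgue. G x $ i - H x $ i = 0" for i
  proof (rule fundamental_lemma_AE_0)
    show "set_integrable lebesgue K (\<lambda>x. G x $ i - H x $ i)" if "compact K" for K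
      using comp[OF assms(1) that, of i] comp[OF assms(2) that, of i] by (rule set_integral_diff)
    show "(\<integral>x. (G x $ i - H x $ i) * \<psi> x \<partial>lebesgue) = 0" if "\<psi> \<in> test_functions" for \<psi>
      using assms integrable_mult_test[OF comp[OF assms(1)] that, of i] integrable_mult_test[OF comp[OF assms(2)] that, of i] that
      by (auto simp: left_diff_distrib has_weak_gradient_def)
  qed
  then have "AE x in lebesgue. \<forall>i. G x $ i - H x $ i = 0" unfolding AE_all_countable by blast
  then show ?thesis by eventually_elim (simp add: vec_eq_iff)
qed

section \<open>Convergence in Lebesgue spaces and existence of weak gradients\<close>

lemma set_integrable_Lp:
  fixes v :: "'a \<Rightarrow> 'b::{banach, second_countable_topology}"
  assumes [measurable]: "v \<in> borel_measurable M" "A \<in> sets M" and A: "emeasure M A < \<infinity>" and r: "r > 1"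
    and fin: "(\<integral>\<^sup>+x. ennreal (norm (v x) powr r) \<partial>M) < \<infinity>"
  shows "set_integrable M A v"
  unfolding set_integrable_def
proof (rule integrableI_bounded)
  have "(\<integral>\<^sup>+x. ennreal (norm (indicator A x *\<^sub>R v x)) \<partial>M) = (\<integral>\<^sup>+x. ennreal (norm (v x)) * indicator A x \<partial>M)"
    by (intro nn_integral_cong) (auto split: split_indicator)
  also have "\<dots> \<le> ennreal 1 * emeasure M A + ennreal (1 powr (1 - r)) * (\<integral>\<^sup>+x. ennreal (norm (v x) powr r) \<partial>M)"
    by (rule nn_integral_young) (use r in auto)
  also have "\<dots> < \<infinity>" using A fin by simp
  finally show "(\<integral>\<^sup>+x. ennreal (norm (indicator A x *\<^sub>R v x)) \<partial>M) < \<infinity>" .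
qed measurable

text \<open>In \<open>nn_integral_young\<close> the first term is made at most d/2 by the choice of
  \<delta>, uniformly in k; for this fixed \<delta> the second term tends to 0.\<close>

lemma Lp_tendsto_imp_L1_tendsto:
  fixes v :: "nat \<Rightarrow> 'a \<Rightarrow> 'b::{banach, second_countable_topology}"
  assumes [measurable]: "\<And>k. v k \<in> borel_measurable M" "A \<in> sets M" and A: "emeasure M A < \<infinity>" and r: "r > 1"
    and lim: "(\<lambda>k. \<integral>\<^sup>+x. ennreal (norm (v k x) powr r) \<partial>M) \<longlonglongrightarrow> 0"
  shows "(\<lambda>k. \<integral>\<^sup>+x. ennreal (norm (v k x)) * indicator A x \<partial>M) \<longlonglongrightarrow> 0"
proof (rule order_tendstoI)
  fix e :: ennreal assume "0 < e"
  then obtain d where d: "d > 0" "ennreal d < e"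
    by (metis dense ennreal_cases ennreal_less_zero_iff less_top_ennreal order_less_trans top.not_eq_extremum)
  define m where "m = measure M A"
  have em: "emeasure M A = ennreal m" using A by (simp add: m_def emeasure_eq_ennreal_measure)
  have m: "m \<ge> 0" by (simp add: m_def)
  define \<delta> where "\<delta> = d / (2 * (m + 1))"
  have \<delta>: "\<delta> > 0" "\<delta> * m \<le> d / 2" using d m by (auto simp: \<delta>_def field_simps)
  have "(\<lambda>k. ennreal (\<delta> powr (1 - r)) * (\<integral>\<^sup>+x. ennreal (norm (v k x) powr r) \<partial>M)) \<longlonglongrightarrow> ennreal (\<delta> powr (1 - r)) * 0"
    by (intro ennreal_tendsto_cmult lim) auto
  then have "\<forall>\<^sub>F k in sequentially. ennreal (\<delta> powr (1 - r)) * (\<integral>\<^sup>+x. ennreal (norm (v k x) powr r) \<partial>M) < ennreal (d / 2)"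
    using d by (intro order_tendstoD) auto
  then show "\<forall>\<^sub>F k in sequentially. (\<integral>\<^sup>+x. ennreal (norm (v k x)) * indicator A x \<partial>M) < e"
  proof eventually_elim
    case (elim k)
    have "(\<integral>\<^sup>+x. ennreal (norm (v k x)) * indicator A x \<partial>M)
        \<le> ennreal \<delta> * emeasure M A + ennreal (\<delta> powr (1 - r)) * (\<integral>\<^sup>+x. ennreal (norm (v k x) powr r) \<partial>M)"
      by (rule nn_integral_young) (use r \<delta> in auto)
    also have "\<dots> \<le> ennreal (d / 2) + ennreal (d / 2)"
      using elim \<delta> m by (intro add_mono) (auto simp: em ennreal_mult'[symmetric] intro!: ennreal_leI)
    also have "\<dots> = ennreal d" using d by (simp add: ennreal_plus[symmetric] del: ennreal_plus)
    finally show ?case using d(2) by order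
  qed
qed simp

lemma four_power: "((2::real)^j * y)\<^sup>2 = 4^j * y\<^sup>2"
  by (induction j) (auto simp: power2_eq_square)

text \<open>The Riesz-Fischer argument: a subsequence with rapidly decreasing increments converges
  almost everywhere, and Fatou's lemma then gives convergence in \<open>L^2\<close> of the whole
  sequence.\<close>

lemma L2_complete:
  fixes g :: "nat \<Rightarrow> 'a \<Rightarrow> 'b::{banach, second_countable_topology}"
  assumes [measurable]: "\<And>k. g k \<in> borel_measurable M"
    and cauchy: "\<And>e::real. e > 0 \<Longrightarrow> \<exists>K. \<forall>m\<ge>K. \<forall>n\<ge>K. (\<integral>\<^sup>+x. ennreal ((norm (g m x - g n x))\<^sup>2) \<partial>M) \<le> ennreal e"
  shows "\<exists>G\<in>borel_measurable M. (\<lambda>k. \<integral>\<^sup>+x. ennreal ((norm (g k x - G x))\<^sup>2) \<partial>M) \<longlonglongrightarrow> 0"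
proof -
  have "\<exists>K. \<forall>m\<ge>K. \<forall>n\<ge>K. (\<integral>\<^sup>+x. ennreal ((norm (g m x - g n x))\<^sup>2) \<partial>M) \<le> ennreal ((1/8)^j)" for j :: nat
    by (rule cauchy) simp
  then obtain K where K: "\<And>j m n. m \<ge> K j \<Longrightarrow> n \<ge> K j \<Longrightarrow> (\<integral>\<^sup>+x. ennreal ((norm (g m x - g n x))\<^sup>2) \<partial>M) \<le> ennreal ((1/8)^j)"
    by metis
  \<comment> \<open>Summing the thresholds makes \<open>r j \<ge> K i\<close> for every i \<le> j,
    so each index respects all earlier tolerances too.\<close>
  define r where "r j = (\<Sum>i\<le>j. K i) + j" for j
  have rK: "r j \<ge> K j" for j unfolding r_def by (simp add: lessThan_Suc_atMost[symmetric] trans_le_add2)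
  have rmono: "r j \<ge> K i" if "i \<le> j" for i j
    unfolding r_def using that by (intro trans_le_add1 member_le_sum) auto
  have rj: "r j \<ge> j" for j by (simp add: r_def)
  define d where "d j x = (norm (g (r (Suc j)) x - g (r j) x))\<^sup>2" for j x
  have [measurable]: "d j \<in> borel_measurable M" for j unfolding d_def[abs_def] by measurable
  \<comment> \<open>Against increments of squared norm at most \<open>8^(-j)\<close> the weight
    \<open>4^j\<close> still leaves a convergent series, and finiteness of the weighted sum at x
    bounds the increments there by a multiple of \<open>2^(-j)\<close>.\<close>
  have "(\<integral>\<^sup>+x. (\<Sum>j. ennreal (4^j * d j x)) \<partial>M) = (\<Sum>j. \<integral>\<^sup>+x. ennreal (4^j * d j x) \<partial>M)"
    by (rule nn_integral_suminf) auto
  also have "\<dots> \<le> (\<Sum>j. ennreal ((1/2)^j))"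
  proof (intro suminf_le allI)
    fix j
    have "(\<integral>\<^sup>+x. ennreal (4^j * d j x) \<partial>M) = ennreal (4^j) * (\<integral>\<^sup>+x. ennreal (d j x) \<partial>M)"
      by (simp add: ennreal_mult' nn_integral_cmult)
    also have "\<dots> \<le> ennreal (4^j) * ennreal ((1/8)^j)"
      unfolding d_def by (intro mult_left_mono K rmono) auto
    also have "\<dots> = ennreal ((1/2)^j)" by (simp add: ennreal_mult'[symmetric] power_mult_distrib[symmetric])
    finally show "(\<integral>\<^sup>+x. ennreal (4^j * d j x) \<partial>M) \<le> ennreal ((1/2)^j)" .
  qed auto
  also have "\<dots> = ennreal (\<Sum>j. (1/2)^j)" by (intro suminf_ennreal2) (auto simp: summable_geometric)
  also have "\<dots> < \<infinity>" by simp
  finally have "(\<integral>\<^sup>+x. (\<Sum>j. ennreal (4^j * d j x)) \<partial>M) \<noteq> \<infinity>" by simp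
  then have AE: "AE x in M. (\<Sum>j. ennreal (4^j * d j x)) \<noteq> \<infinity>"
    by (intro nn_integral_PInf_AE) auto
  define G where "G x = lim (\<lambda>j. g (r j) x)" for x
  have [measurable]: "G \<in> borel_measurable M" unfolding G_def[abs_def] by measurable
  have conv: "AE x in M. (\<lambda>j. g (r j) x) \<longlonglongrightarrow> G x"
    using AE
  proof eventually_elim
    case (elim x)
    then obtain C where C: "(\<Sum>j. ennreal (4^j * d j x)) = ennreal C" "C \<ge> 0"
      by (metis ennreal_cases infinity_ennreal_def)
    have nb: "norm (g (r (Suc j)) x - g (r j) x) \<le> sqrt C * (1/2)^j" for j
    proof -
      have "ennreal (4^j * d j x) = (\<Sum>i\<in>{j}. ennreal (4^i * d i x))" by simp
      also have "\<dots> \<le> ennreal C" unfolding C(1)[symmetric] by (rule sum_le_suminf) auto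
      finally have "4^j * d j x \<le> C" using C(2) by simp
      then have "(2^j * norm (g (r (Suc j)) x - g (r j) x))\<^sup>2 \<le> C"
        unfolding four_power d_def .
      then have "2^j * norm (g (r (Suc j)) x - g (r j) x) \<le> sqrt C" by (rule real_le_rsqrt)
      then show ?thesis by (simp add: field_simps power_divide)
    qed
    have "summable (\<lambda>j. sqrt C * (1/2::real)^j)" by (rule summable_mult) (simp add: summable_geometric)
    then have "summable (\<lambda>j. g (r (Suc j)) x - g (r j) x)" by (rule summable_comparison_test'[where N = 0]) (rule nb)
    then have "convergent (\<lambda>n. \<Sum>j<n. g (r (Suc j)) x - g (r j) x)" by (simp add: summable_iff_convergent)
    then have "convergent (\<lambda>n. g (r n) x - g (r 0) x)" by (simp add: sum_lessThan_telescope[of "\<lambda>j. g (r j) x"])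
    then have "convergent (\<lambda>n. (g (r n) x - g (r 0) x) + g (r 0) x)" by (intro convergent_add convergent_const)
    then have "convergent (\<lambda>n. g (r n) x)" by simp
    then show ?case by (simp add: G_def convergent_LIMSEQ_iff)
  qed
  have bound: "(\<integral>\<^sup>+x. ennreal ((norm (g k x - G x))\<^sup>2) \<partial>M) \<le> ennreal ((1/8)^i)" if k: "k \<ge> K i" for k i
  proof -
    have "(\<integral>\<^sup>+x. ennreal ((norm (g k x - G x))\<^sup>2) \<partial>M) = (\<integral>\<^sup>+x. liminf (\<lambda>j. ennreal ((norm (g k x - g (r j) x))\<^sup>2)) \<partial>M)"
    proof (rule nn_integral_cong_AE)
      show "AE x in M. ennreal ((norm (g k x - G x))\<^sup>2) = liminf (\<lambda>j. ennreal ((norm (g k x - g (r j) x))\<^sup>2))"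
        using conv
      proof eventually_elim
        case (elim x)
        then have "(\<lambda>j. ennreal ((norm (g k x - g (r j) x))\<^sup>2)) \<longlonglongrightarrow> ennreal ((norm (g k x - G x))\<^sup>2)"
          by (intro tendsto_ennrealI tendsto_intros)
        then show ?case by (intro lim_imp_Liminf[symmetric]) auto
      qed
    qed
    also have "\<dots> \<le> liminf (\<lambda>j. \<integral>\<^sup>+x. ennreal ((norm (g k x - g (r j) x))\<^sup>2) \<partial>M)"
      by (rule nn_integral_liminf) auto
    also have "\<dots> \<le> liminf (\<lambda>j. ennreal ((1/8)^i))"
    proof (rule Liminf_mono)
      show "\<forall>\<^sub>F j in sequentially. (\<integral>\<^sup>+x. ennreal ((norm (g k x - g (r j) x))\<^sup>2) \<partial>M) \<le> ennreal ((1/8)^i)"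
        using eventually_ge_at_top[of i] by eventually_elim (intro K k rmono)
    qed
    also have "\<dots> = ennreal ((1/8)^i)" by (simp add: Liminf_const)
    finally show ?thesis .
  qed
  have "(\<lambda>k. \<integral>\<^sup>+x. ennreal ((norm (g k x - G x))\<^sup>2) \<partial>M) \<longlonglongrightarrow> 0"
  proof (rule order_tendstoI)
    fix e :: ennreal assume "0 < e"
    moreover have "(\<lambda>i. ennreal ((1/8)^i)) \<longlonglongrightarrow> ennreal 0"
      by (intro tendsto_ennrealI LIMSEQ_realpow_zero) auto
    ultimately have "\<forall>\<^sub>F i in sequentially. ennreal ((1/8)^i) < e" by (intro order_tendstoD) auto
    then obtain i where i: "ennreal ((1/8)^i) < e" using eventually_happens by force
    show "\<forall>\<^sub>F k in sequentially. (\<integral>\<^sup>+x. ennreal ((norm (g k x - G x))\<^sup>2) \<partial>M) < e"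
      using eventually_ge_at_top[of "K i"] by eventually_elim (rule order_le_less_trans[OF bound i])
  qed simp
  then show ?thesis by (intro bexI[of _ G]) auto
qed

lemma crit_exp_0: "crit_exp N 0 = 2 * real N / (real N - 2)"
  by (simp add: crit_exp_def)

lemma gradient_diff:
  assumes "f \<in> test_functions" "g \<in> test_functions"
  shows "gradient (\<lambda>x. f x - g x) x = gradient f x - gradient g x"
  using smooth_differentiable[OF test_smooth[OF assms(1)]] smooth_differentiable[OF test_smooth[OF assms(2)]]
  by (simp add: gradient_def vec_eq_iff partial_deriv_diff)

lemma gradient_continuous: "f \<in> test_functions \<Longrightarrow> continuous_on S (gradient f)"
  unfolding gradient_def[abs_def] by (intro continuous_on_vec_lambda test_continuous test_partial_deriv)

lemma gradient_measurable: "f \<in> test_functions \<Longrightarrow> gradient f \<in> borel_measurable borel"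
  by (intro borel_measurable_continuous_onI gradient_continuous)

lemma nn_integral_gradient:
  assumes f: "f \<in> test_functions"
  shows "(\<integral>\<^sup>+x. ennreal ((norm (gradient f x))\<^sup>2) \<partial>lborel) = ennreal ((grad_norm f)\<^sup>2)"
proof -
  have eq: "(\<lambda>x. (norm (gradient f x))\<^sup>2) = (\<lambda>x. \<Sum>i\<in>UNIV. partial_deriv i f x * partial_deriv i f x)"
    by (auto simp: norm_vec_def L2_set_def gradient_def power2_eq_square sum_nonneg)
  have int: "integrable lborel (\<lambda>x. (norm (gradient f x))\<^sup>2)" unfolding eq
    by (intro Bochner_Integration.integrable_sum test_integrable test_mult test_smooth test_partial_deriv f)
  have "(\<integral>x. (norm (gradient f x))\<^sup>2 \<partial>lebesgue) = (\<integral>x. (norm (gradient f x))\<^sup>2 \<partial>lborel)"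
    using int by (intro integral_completion) auto
  then have "(grad_norm f)\<^sup>2 = (\<integral>x. (norm (gradient f x))\<^sup>2 \<partial>lborel)"
    by (simp add: grad_norm_def)
  then show ?thesis using int by (simp add: nn_integral_eq_integral)
qed

text \<open>The constant sequence approximates f. Through this inclusion the weak equation may be
  tested with smooth compactly supported functions.\<close>

lemma test_in_D12:
  assumes f: "f \<in> test_functions"
  shows "f \<in> D12"
proof -
  have "grad_norm (\<lambda>x. f x - f x) = 0"
    using gradient_diff[OF f f] by (simp add: grad_norm_def)
  then have "\<forall>e>0. \<exists>M::nat. \<forall>m\<ge>M. \<forall>n\<ge>M. grad_norm (\<lambda>x. f x - f x) < e" by simp
  moreover have "f \<in> borel_measurable lebesgue" using test_measurable[OF f] by (simp add: measurable_completion)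
  ultimately show ?thesis unfolding D12_def using f by (auto intro!: exI[of _ "\<lambda>k. f"])
qed

text \<open>Since \<phi> is bounded and vanishes outside a ball, convergence in \<open>L^1\<close>
  on that ball is enough to pass to the limit.\<close>

lemma tendsto_integral_test:
  fixes v :: "nat \<Rightarrow> real ^ 'n::finite \<Rightarrow> real"
  assumes \<phi>: "\<phi> \<in> test_functions"
    and v: "\<And>k K. compact K \<Longrightarrow> set_integrable lebesgue K (v k)" and w: "\<And>K. compact K \<Longrightarrow> set_integrable lebesgue K w"
    and r: "\<And>x. norm x > r \<Longrightarrow> \<phi> x = 0"
    and lim: "(\<lambda>k. \<integral>\<^sup>+x. ennreal (norm (v k x - w x)) * indicator (cball 0 r) x \<partial>lebesgue) \<longlonglongrightarrow> 0"
  shows "(\<lambda>k. \<integral>x. v k x * \<phi> x \<partial>lebesgue) \<longlonglongrightarrow> (\<integral>x. w x * \<phi> x \<partial>lebesgue)"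
proof -
  obtain B where B: "B \<ge> 0" "\<And>x. \<bar>\<phi> x\<bar> \<le> B" using test_bounded[OF \<phi>] by metis
  show ?thesis
  proof (rule tendsto_L1_int)
    show "integrable lebesgue (\<lambda>x. v k x * \<phi> x)" for k by (rule integrable_mult_test[OF v \<phi>])
    show "integrable lebesgue (\<lambda>x. w x * \<phi> x)" by (rule integrable_mult_test[OF w \<phi>])
    have "(\<lambda>k. ennreal B * (\<integral>\<^sup>+x. ennreal (norm (v k x - w x)) * indicator (cball 0 r) x \<partial>lebesgue)) \<longlonglongrightarrow> ennreal B * 0"
      by (intro ennreal_tendsto_cmult lim) simp
    then have L: "(\<lambda>k. ennreal B * (\<integral>\<^sup>+x. ennreal (norm (v k x - w x)) * indicator (cball 0 r) x \<partial>lebesgue)) \<longlonglongrightarrow> 0" by simp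
    show "(\<lambda>k. \<integral>\<^sup>+x. ennreal (norm (v k x * \<phi> x - w x * \<phi> x)) \<partial>lebesgue) \<longlonglongrightarrow> 0"
    proof (rule tendsto_sandwich[OF _ _ tendsto_const L])
      show "\<forall>\<^sub>F k in sequentially. (\<integral>\<^sup>+x. ennreal (norm (v k x * \<phi> x - w x * \<phi> x)) \<partial>lebesgue)
         \<le> ennreal B * (\<integral>\<^sup>+x. ennreal (norm (v k x - w x)) * indicator (cball 0 r) x \<partial>lebesgue)"
      proof (intro always_eventually allI)
        fix k
        have m: "(\<lambda>x. ennreal (norm (v k x - w x)) * indicator (cball 0 r) x) \<in> borel_measurable lebesgue"
        proof -
          have "integrable lebesgue (\<lambda>x. indicator (cball 0 r) x *\<^sub>R v k x - indicator (cball 0 r) x *\<^sub>R w x)"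
            using v[of "cball 0 r" k] w[of "cball 0 r"] unfolding set_integrable_def
            by (intro Bochner_Integration.integrable_diff) auto
          then have "(\<lambda>x. ennreal (norm (indicator (cball 0 r) x *\<^sub>R v k x - indicator (cball 0 r) x *\<^sub>R w x))) \<in> borel_measurable lebesgue"
            by measurable
          also have "(\<lambda>x. ennreal (norm (indicator (cball 0 r) x *\<^sub>R v k x - indicator (cball 0 r) x *\<^sub>R w x)))
             = (\<lambda>x. ennreal (norm (v k x - w x)) * indicator (cball 0 r) x)"
            by (auto split: split_indicator)
          finally show ?thesis .
        qed
        have "(\<integral>\<^sup>+x. ennreal (norm (v k x * \<phi> x - w x * \<phi> x)) \<partial>lebesgue)
          \<le> (\<integral>\<^sup>+x. ennreal B * (ennreal (norm (v k x - w x)) * indicator (cball 0 r) x) \<partial>lebesgue)"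
        proof (rule nn_integral_mono)
          fix x
          show "ennreal (norm (v k x * \<phi> x - w x * \<phi> x)) \<le> ennreal B * (ennreal (norm (v k x - w x)) * indicator (cball 0 r) x)"
            unfolding left_diff_distrib[symmetric] using r[of x] B(1) mult_right_mono[OF B(2)[of x], of "\<bar>v k x - w x\<bar>"]
            by (cases "norm x \<le> r") (auto simp: abs_mult ennreal_mult'[symmetric] mult.commute intro!: ennreal_leI)
        qed
        also have "\<dots> = ennreal B * (\<integral>\<^sup>+x. ennreal (norm (v k x - w x)) * indicator (cball 0 r) x \<partial>lebesgue)"
          using m by (rule nn_integral_cmult)
        finally show "(\<integral>\<^sup>+x. ennreal (norm (v k x * \<phi> x - w x * \<phi> x)) \<partial>lebesgue)
           \<le> ennreal B * (\<integral>\<^sup>+x. ennreal (norm (v k x - w x)) * indicator (cball 0 r) x \<partial>lebesgue)" .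
      qed
    qed simp
  qed
qed

lemma compact_emeasure_lebesgue:
  "compact K \<Longrightarrow> K \<in> sets lebesgue" "compact K \<Longrightarrow> emeasure lebesgue K < \<infinity>"
  for K :: "'a::euclidean_space set"
  using emeasure_compact_finite[of K] borel_compact[of K] by auto

lemma D12_approx:
  fixes u :: "real ^ 'n::finite \<Rightarrow> real"
  assumes u: "u \<in> D12"
  obtains f where "\<And>k. f k \<in> test_functions"
    "\<And>e. e > 0 \<Longrightarrow> \<exists>M. \<forall>m\<ge>M. \<forall>n\<ge>M. grad_norm (\<lambda>x. f m x - f n x) < e"
    "(\<lambda>k. \<integral>\<^sup>+x. ennreal (norm (f k x - u x) powr (2 * real CARD('n) / (real CARD('n) - 2))) \<partial>lebesgue) \<longlonglongrightarrow> 0"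
proof -
  from u obtain f where f: "\<forall>k. f k \<in> test_functions"
    "\<forall>e>0. \<exists>M. \<forall>m\<ge>M. \<forall>n\<ge>M. grad_norm (\<lambda>x. f m x - f n x) < e"
    "(\<lambda>k. \<integral>\<^sup>+x. ennreal (\<bar>f k x - u x\<bar> powr crit_exp CARD('n) 0) \<partial>lebesgue) \<longlonglongrightarrow> 0"
    unfolding D12_def by blast
  show ?thesis
  proof (rule that[of f])
    show "f k \<in> test_functions" for k using f(1) ..
    show "\<exists>M. \<forall>m\<ge>M. \<forall>n\<ge>M. grad_norm (\<lambda>x. f m x - f n x) < e" if "e > 0" for e
      using f(2)[THEN spec, THEN mp, OF that] .
    show "(\<lambda>k. \<integral>\<^sup>+x. ennreal (norm (f k x - u x) powr (2 * real CARD('n) / (real CARD('n) - 2))) \<partial>lebesgue) \<longlonglongrightarrow> 0"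
      using f(3) unfolding crit_exp_0 real_norm_def .
  qed
qed

text \<open>The gradients of an approximating sequence are Cauchy in \<open>L^2\<close>. Their limit
  inherits the integration by parts formula, because on the support of a test function convergence
  in \<open>L^2\<close> and in \<open>L^p\<close> both imply convergence in \<open>L^1\<close>.
  Existence is what gives the choice in \<open>weak_grad\<close> its meaning.\<close>

lemma weak_gradient_exists:
  fixes u :: "real ^ 'n::finite \<Rightarrow> real"
  assumes u: "u \<in> D12" and N: "CARD('n) \<ge> 3"
  shows "\<exists>G. has_weak_gradient u G"
proof -
  define p where "p = 2 * real CARD('n) / (real CARD('n) - 2)"
  have p: "p > 1" using N by (auto simp: p_def field_simps)
  obtain f where f: "\<And>k. f k \<in> test_functions"
    and cauchy: "\<And>e. e > 0 \<Longrightarrow> \<exists>M. \<forall>m\<ge>M. \<forall>n\<ge>M. grad_norm (\<lambda>x. f m x - f n x) < e"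
    and lim: "(\<lambda>k. \<integral>\<^sup>+x. ennreal (norm (f k x - u x) powr p) \<partial>lebesgue) \<longlonglongrightarrow> 0"
    by (rule D12_approx[OF u, folded p_def], rule that)
  have um: "u \<in> borel_measurable lebesgue" using u by (simp add: D12_def)
  have fm: "f k \<in> borel_measurable lebesgue" for k using test_measurable[OF f] by (simp add: measurable_completion)
  have "\<exists>G\<in>borel_measurable lborel. (\<lambda>k. \<integral>\<^sup>+x. ennreal ((norm (gradient (f k) x - G x))\<^sup>2) \<partial>lborel) \<longlonglongrightarrow> 0"
  proof (rule L2_complete)
    show "gradient (f k) \<in> borel_measurable lborel" for k using gradient_measurable[OF f] by simp
    fix e :: real assume e: "e > 0"
    then obtain M where M: "\<And>m n. m \<ge> M \<Longrightarrow> n \<ge> M \<Longrightarrow> grad_norm (\<lambda>x. f m x - f n x) < sqrt e"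
      using cauchy[of "sqrt e"] by auto
    have "(\<integral>\<^sup>+x. ennreal ((norm (gradient (f m) x - gradient (f n) x))\<^sup>2) \<partial>lborel) \<le> ennreal e" if "m \<ge> M" "n \<ge> M" for m n
    proof -
      have "(grad_norm (\<lambda>x. f m x - f n x))\<^sup>2 \<le> (sqrt e)\<^sup>2"
        using M[OF that] by (intro power_mono) (auto simp: grad_norm_def)
      then show ?thesis
        using nn_integral_gradient[OF test_diff[OF f[of m] f[of n]]] e
        by (simp add: gradient_diff[OF f f] ennreal_leI)
    qed
    then show "\<exists>K. \<forall>m\<ge>K. \<forall>n\<ge>K. (\<integral>\<^sup>+x. ennreal ((norm (gradient (f m) x - gradient (f n) x))\<^sup>2) \<partial>lborel) \<le> ennreal e"
      by blast
  qed
  then obtain G where Gm': "G \<in> borel_measurable lborel"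
    and limG': "(\<lambda>k. \<integral>\<^sup>+x. ennreal ((norm (gradient (f k) x - G x))\<^sup>2) \<partial>lborel) \<longlonglongrightarrow> 0" by auto
  have Gm: "G \<in> borel_measurable lebesgue" using Gm' by (rule measurable_completion)
  have gm: "gradient (f k) \<in> borel_measurable lebesgue" for k
    using gradient_measurable[OF f] by (simp add: measurable_completion)
  have limG: "(\<lambda>k. \<integral>\<^sup>+x. ennreal (norm (gradient (f k) x - G x) powr 2) \<partial>lebesgue) \<longlonglongrightarrow> 0"
    using limG' by (simp add: nn_integral_completion)
  have su: "set_integrable lebesgue K u" if K: "compact K" for K
  proof -
    have "\<forall>\<^sub>F k in sequentially. (\<integral>\<^sup>+x. ennreal (norm (f k x - u x) powr p) \<partial>lebesgue) < 1"
      using lim by (intro order_tendstoD) auto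
    then obtain k where "(\<integral>\<^sup>+x. ennreal (norm (f k x - u x) powr p) \<partial>lebesgue) < 1"
      using eventually_happens by force
    then have "(\<integral>\<^sup>+x. ennreal (norm (f k x - u x) powr p) \<partial>lebesgue) < \<infinity>" by (simp add: order_less_trans)
    then have "set_integrable lebesgue K (\<lambda>x. f k x - u x)"
      using compact_emeasure_lebesgue[OF K] p fm um by (intro set_integrable_Lp[where r = p] borel_measurable_diff)
    moreover have "set_integrable lebesgue K (f k)"
      using has_weak_gradient_test[OF f] K by (simp add: has_weak_gradient_def)
    ultimately have "set_integrable lebesgue K (\<lambda>x. f k x - (f k x - u x))" by (rule set_integral_diff(1)[rotated])
    then show ?thesis by simp
  qed
  have sG: "set_integrable lebesgue K G" if K: "compact K" for K
  proof -
    have "\<forall>\<^sub>F k in sequentially. (\<integral>\<^sup>+x. ennreal (norm (gradient (f k) x - G x) powr 2) \<partial>lebesgue) < 1"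
      using limG by (intro order_tendstoD) auto
    then obtain k where "(\<integral>\<^sup>+x. ennreal (norm (gradient (f k) x - G x) powr 2) \<partial>lebesgue) < 1"
      using eventually_happens by force
    then have "(\<integral>\<^sup>+x. ennreal (norm (gradient (f k) x - G x) powr 2) \<partial>lebesgue) < \<infinity>" by (simp only: order_less_trans[OF _ ennreal_one_less_top] infinity_ennreal_def)
    then have "set_integrable lebesgue K (\<lambda>x. gradient (f k) x - G x)"
      using compact_emeasure_lebesgue[OF K] gm Gm by (intro set_integrable_Lp[where r = 2] borel_measurable_diff) auto
    moreover have "set_integrable lebesgue K (gradient (f k))"
      using has_weak_gradient_test[OF f] K by (simp add: has_weak_gradient_def)
    ultimately have "set_integrable lebesgue K (\<lambda>x. gradient (f k) x - (gradient (f k) x - G x))" by (rule set_integral_diff(1)[rotated])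
    then show ?thesis by simp
  qed
  have "(\<integral>x. u x * partial_deriv i \<psi> x \<partial>lebesgue) = - (\<integral>x. G x $ i * \<psi> x \<partial>lebesgue)"
    if \<psi>: "\<psi> \<in> test_functions" for \<psi> i
  proof -
    obtain r1 where r1: "\<And>x. norm x > r1 \<Longrightarrow> \<psi> x = 0" using test_bounded[OF \<psi>] by metis
    obtain r2 where r2: "\<And>x. norm x > r2 \<Longrightarrow> partial_deriv i \<psi> x = 0" using test_bounded[OF test_partial_deriv[OF \<psi>]] by metis
    have "(\<lambda>k. \<integral>x. f k x * partial_deriv i \<psi> x \<partial>lebesgue) \<longlonglongrightarrow> (\<integral>x. u x * partial_deriv i \<psi> x \<partial>lebesgue)"
    proof (rule tendsto_integral_test[OF test_partial_deriv[OF \<psi>] _ su r2])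
      show "set_integrable lebesgue K (f k)" if "compact K" for k K
        using has_weak_gradient_test[OF f] that by (simp add: has_weak_gradient_def)
      show "(\<lambda>k. \<integral>\<^sup>+x. ennreal (norm (f k x - u x)) * indicator (cball 0 r2) x \<partial>lebesgue) \<longlonglongrightarrow> 0"
        by (rule Lp_tendsto_imp_L1_tendsto[OF borel_measurable_diff[OF fm um] _ _ p lim])
           (use compact_emeasure_lebesgue[OF compact_cball] in auto)
    qed auto
    moreover have "(\<lambda>k. \<integral>x. gradient (f k) x $ i * \<psi> x \<partial>lebesgue) \<longlonglongrightarrow> (\<integral>x. G x $ i * \<psi> x \<partial>lebesgue)"
    proof (rule tendsto_integral_test[OF \<psi> _ set_integrable_component[OF sG] r1])
      show "set_integrable lebesgue K (\<lambda>x. gradient (f k) x $ i)" if "compact K" for k K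
        using has_weak_gradient_test[OF f] that by (intro set_integrable_component) (simp add: has_weak_gradient_def)
      have L: "(\<lambda>k. \<integral>\<^sup>+x. ennreal (norm (gradient (f k) x - G x)) * indicator (cball 0 r1) x \<partial>lebesgue) \<longlonglongrightarrow> 0"
        by (rule Lp_tendsto_imp_L1_tendsto[OF borel_measurable_diff[OF gm Gm] _ _ _ limG])
           (use compact_emeasure_lebesgue[OF compact_cball] in auto)
      show "(\<lambda>k. \<integral>\<^sup>+x. ennreal (norm (gradient (f k) x $ i - G x $ i)) * indicator (cball 0 r1) x \<partial>lebesgue) \<longlonglongrightarrow> 0"
      proof (rule tendsto_sandwich[OF _ _ tendsto_const L])
        have "norm (gradient (f k) x $ i - G x $ i) \<le> norm (gradient (f k) x - G x)" for k x
          using component_le_norm_cart[of "gradient (f k) x - G x" i] by simp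
        then show "\<forall>\<^sub>F k in sequentially. (\<integral>\<^sup>+x. ennreal (norm (gradient (f k) x $ i - G x $ i)) * indicator (cball 0 r1) x \<partial>lebesgue)
           \<le> (\<integral>\<^sup>+x. ennreal (norm (gradient (f k) x - G x)) * indicator (cball 0 r1) x \<partial>lebesgue)"
          by (intro always_eventually allI nn_integral_mono mult_right_mono ennreal_leI) auto
      qed simp
    qed auto
    then have "(\<lambda>k. - (\<integral>x. gradient (f k) x $ i * \<psi> x \<partial>lebesgue)) \<longlonglongrightarrow> - (\<integral>x. G x $ i * \<psi> x \<partial>lebesgue)"
      by (rule tendsto_minus)
    moreover have "(\<integral>x. f k x * partial_deriv i \<psi> x \<partial>lebesgue) = - (\<integral>x. gradient (f k) x $ i * \<psi> x \<partial>lebesgue)" for k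
      using has_weak_gradient_test[OF f] \<psi> by (simp add: has_weak_gradient_def)
    ultimately show ?thesis using LIMSEQ_unique by force
  qed
  then show ?thesis using su sG unfolding has_weak_gradient_def by blast
qed

text \<open>Integrands built from \<open>weak_grad\<close> or from u are compared with better ones
  up to null sets, and \<open>integral_cong_AE\<close> asks for measurability on both sides;
  completeness of the measure supplies it.\<close>

lemma measurable_completion_AE:
  fixes f g :: "'a \<Rightarrow> real"
  assumes f: "f \<in> borel_measurable (completion M)" and AE: "AE x in completion M. g x = f x"
  shows "g \<in> borel_measurable (completion M)"
proof (rule borel_measurableI)
  fix S :: "real set" assume "open S"
  then have S: "f -` S \<inter> space (completion M) \<in> sets (completion M)" by (intro measurable_sets[OF f]) auto
  have "AE x in completion M. x \<in> f -` S \<inter> space (completion M) \<longleftrightarrow> x \<in> g -` S \<inter> space (completion M)"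
    using AE by eventually_elim auto
  from completion.in_sets_AE[OF this S] show "g -` S \<inter> space (completion M) \<in> sets (completion M)" by auto
qed

text \<open>The partial derivatives of \<psi> are again test functions, so the definition of the
  weak gradient of u applies to each of them and moves the remaining derivative over. From here on
  the equation is used only in this form, with u undifferentiated.\<close>

lemma integral_weak_grad:
  fixes u :: "real ^ 'n::finite \<Rightarrow> real"
  assumes u: "u \<in> D12" and N: "CARD('n) \<ge> 3" and \<psi>: "\<psi> \<in> test_functions"
  shows "(\<integral>x. weak_grad u x \<bullet> weak_grad \<psi> x \<partial>lebesgue)
    = - (\<integral>x. u x * (\<Sum>i\<in>UNIV. partial_deriv i (partial_deriv i \<psi>) x) \<partial>lebesgue)"
proof -
  have G: "has_weak_gradient u (weak_grad u)"
    using weak_gradient_exists[OF u N] unfolding weak_grad_def by (rule someI_ex)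
  have "has_weak_gradient \<psi> (weak_grad \<psi>)"
    using someI[of "has_weak_gradient \<psi>", OF has_weak_gradient_test[OF \<psi>]] by (simp add: weak_grad_def)
  from weak_gradient_unique[OF this has_weak_gradient_test[OF \<psi>]]
  have AE: "AE x in lebesgue. weak_grad \<psi> x = gradient \<psi> x" .
  have su: "set_integrable lebesgue K u" and sG: "set_integrable lebesgue K (\<lambda>x. weak_grad u x $ i)"
    if "compact K" for K i
    using G that by (auto simp: has_weak_gradient_def intro: set_integrable_component)
  have d: "partial_deriv i \<psi> \<in> test_functions" "partial_deriv i (partial_deriv i \<psi>) \<in> test_functions" for i
    by (intro test_partial_deriv \<psi>)+
  have iG: "integrable lebesgue (\<lambda>x. weak_grad u x $ i * partial_deriv i \<psi> x)" for i
    by (rule integrable_mult_test[OF sG d(1)])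
  have iu: "integrable lebesgue (\<lambda>x. u x * partial_deriv i (partial_deriv i \<psi>) x)" for i
    by (rule integrable_mult_test[OF su d(2)])
  have eq: "weak_grad u x \<bullet> gradient \<psi> x = (\<Sum>i\<in>UNIV. weak_grad u x $ i * partial_deriv i \<psi> x)" for x
    by (simp add: inner_vec_def gradient_def)
  have "(\<integral>x. weak_grad u x \<bullet> weak_grad \<psi> x \<partial>lebesgue) = (\<integral>x. weak_grad u x \<bullet> gradient \<psi> x \<partial>lebesgue)"
  proof (rule integral_cong_AE)
    show m: "(\<lambda>x. weak_grad u x \<bullet> gradient \<psi> x) \<in> borel_measurable lebesgue"
      unfolding eq by (intro borel_measurable_sum borel_measurable_integrable[OF iG])
    show AE': "AE x in lebesgue. weak_grad u x \<bullet> weak_grad \<psi> x = weak_grad u x \<bullet> gradient \<psi> x"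
      using AE by eventually_elim simp
    show "(\<lambda>x. weak_grad u x \<bullet> weak_grad \<psi> x) \<in> borel_measurable lebesgue"
      by (rule measurable_completion_AE[OF m AE'])
  qed
  also have "\<dots> = (\<Sum>i\<in>UNIV. \<integral>x. weak_grad u x $ i * partial_deriv i \<psi> x \<partial>lebesgue)"
    unfolding eq by (rule Bochner_Integration.integral_sum) (rule iG)
  also have "\<dots> = (\<Sum>i\<in>UNIV. - (\<integral>x. u x * partial_deriv i (partial_deriv i \<psi>) x \<partial>lebesgue))"
  proof (rule sum.cong)
    fix i
    have "(\<integral>x. u x * partial_deriv i (partial_deriv i \<psi>) x \<partial>lebesgue) = - (\<integral>x. weak_grad u x $ i * partial_deriv i \<psi> x \<partial>lebesgue)"
      using G d(1) by (simp add: has_weak_gradient_def)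
    then show "(\<integral>x. weak_grad u x $ i * partial_deriv i \<psi> x \<partial>lebesgue) = - (\<integral>x. u x * partial_deriv i (partial_deriv i \<psi>) x \<partial>lebesgue)"
      by simp
  qed simp
  also have "\<dots> = - (\<integral>x. u x * (\<Sum>i\<in>UNIV. partial_deriv i (partial_deriv i \<psi>) x) \<partial>lebesgue)"
    unfolding sum_distrib_left
    by (subst Bochner_Integration.integral_sum) (auto intro: iu simp: sum_negf)
  finally show ?thesis .
qed

section \<open>From the weak equation to the integral inequality\<close>

lemma test_uniformly_continuous:
  assumes f: "f \<in> test_functions" and \<eta>: "\<eta> > 0"
  obtains \<epsilon> where "\<epsilon> > 0" "\<And>x y. dist x y < \<epsilon> \<Longrightarrow> \<bar>f x - f y\<bar> < \<eta>"
proof -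
  obtain r where r: "r > 0" "\<And>x. norm x > r \<Longrightarrow> f x = 0" using test_bounded[OF f] by metis
  have "uniformly_continuous_on (cball 0 (r + 1)) f"
    by (intro compact_uniformly_continuous test_continuous f compact_cball)
  then obtain d where d: "d > 0" "\<And>x y. x \<in> cball 0 (r + 1) \<Longrightarrow> y \<in> cball 0 (r + 1) \<Longrightarrow> dist y x < d \<Longrightarrow> dist (f y) (f x) < \<eta>"
    using \<eta> unfolding uniformly_continuous_on_def by meson
  have "\<bar>f x - f y\<bar> < \<eta>" if "dist x y < min d 1" for x y
  proof (cases "norm x \<le> r + 1 \<and> norm y \<le> r + 1")
    case True
    then show ?thesis using d(2)[of y x] that by (simp add: dist_real_def)
  next
    case False
    have "\<bar>norm x - norm y\<bar> \<le> dist x y" by (simp add: dist_norm norm_triangle_ineq3)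
    then have "norm x > r" "norm y > r" using False that by auto
    then show ?thesis using r(2) \<eta> by simp
  qed
  then show ?thesis using d(1) by (intro that[of "min d 1"]) auto
qed

text \<open>This takes the place of Lebesgue's differentiation theorem. For a test function f close
  to v and h = |f - v|, one has v(x) \<le> v(y) + h(y) + h(x) + \<eta> when y is near x. Averaging
  over y and integrating over A leaves errors in h that are small independently of the radius, by
  \<open>ball_integral_le_2\<close>; hence f may be chosen first and the radius afterwards.\<close>

lemma ball_average_lower_bound:
  fixes v :: "real ^ 'n::finite \<Rightarrow> real"
  defines "N \<equiv> real CARD('n)"
  assumes v [measurable]: "v \<in> borel_measurable borel" and v0: "\<And>x. 0 \<le> v x" and p: "p > 1"
    and approx: "\<And>e. e > 0 \<Longrightarrow> \<exists>f\<in>test_functions. (\<integral>\<^sup>+x. ennreal (\<bar>f x - v x\<bar> powr p) \<partial>lborel) \<le> ennreal e"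
    and A: "A \<in> sets borel" "emeasure lborel A < \<infinity>"
    and le: "\<And>\<epsilon>. \<epsilon> > 0 \<Longrightarrow> ennreal (\<epsilon> powr - N) *
        (\<integral>\<^sup>+x\<in>A. ball_int (\<lambda>y. ennreal (v y)) x \<epsilon> \<partial>lborel) \<le> Y"
  shows "ennreal (unit_ball_vol N) * (\<integral>\<^sup>+x\<in>A. ennreal (v x) \<partial>lborel) \<le> Y"
proof (rule ennreal_le_epsilon)
  note [measurable] = A(1)
  define \<omega> where "\<omega> = unit_ball_vol N"
  have \<omega>: "\<omega> > 0" by (simp add: \<omega>_def N_def)
  define m where "m = measure lborel A"
  have em: "emeasure lborel A = ennreal m" using A by (simp add: m_def emeasure_eq_ennreal_measure)
  have m: "m \<ge> 0" by (simp add: m_def)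
  define \<theta> where "\<theta> = 1 - 1/p"
  fix e :: real assume e: "e > 0"
  \<comment> \<open>Each of the three errors will be kept below e/3; the 1 in the denominator avoids
    division by 0 when the coefficient X vanishes.\<close>
  have small: "0 < e / (3 * (X + 1)) \<and> X * (e / (3 * (X + 1))) \<le> e / 3" if X: "X \<ge> 0" for X
  proof -
    have "e / 3 * (X / (X + 1)) \<le> e / 3 * 1" using X e by (intro mult_left_mono) auto
    then show ?thesis using X e by (simp add: mult.commute)
  qed
  define \<eta> where "\<eta> = e / (3 * (\<omega> * m + 1))"
  have \<eta>: "\<eta> > 0" "\<omega> * m * \<eta> \<le> e / 3"
    using small[of "\<omega> * m"] \<omega> m by (auto simp: \<eta>_def)
  define C where "C = e / (3 * (\<omega> * m powr \<theta> + 1))"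
  have C: "C > 0" "\<omega> * C * m powr \<theta> \<le> e / 3"
    using small[of "\<omega> * m powr \<theta>"] \<omega> by (auto simp: C_def mult_ac)
  \<comment> \<open>Inverts the constant of \<open>weak_bound_Lp\<close>, so that h has weak bound
    C.\<close>
  define K where "K = (C / 2) powr p"
  have K: "K > 0" "2 * K powr (1/p) = C" using C p by (auto simp: K_def powr_powr)
  obtain f where f: "f \<in> test_functions" "(\<integral>\<^sup>+x. ennreal (\<bar>f x - v x\<bar> powr p) \<partial>lborel) \<le> ennreal K"
    using approx[OF K(1)] by auto
  note [measurable] = test_measurable[OF f(1)]
  define h where "h x = \<bar>f x - v x\<bar>" for x
  have [measurable]: "h \<in> borel_measurable borel" unfolding h_def[abs_def] by measurable
  have h0: "h x \<ge> 0" for x by (simp add: h_def)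
  have wh: "weak_bound \<theta> C (\<lambda>x. ennreal (h x))"
    using weak_bound_Lp[of h p K] f(2) K p unfolding \<theta>_def h_def by auto
  obtain \<epsilon> where \<epsilon>: "\<epsilon> > 0" "\<And>x y. dist x y < \<epsilon> \<Longrightarrow> \<bar>f x - f y\<bar> < \<eta>"
    using test_uniformly_continuous[OF f(1) \<eta>(1)] by blast
  define U where "U w x = ball_int (\<lambda>y. ennreal (w y)) x \<epsilon>" for w :: "real^'n \<Rightarrow> real" and x
  have [measurable]: "U w \<in> borel_measurable borel" if [measurable]: "w \<in> borel_measurable borel" for w
    unfolding U_def[abs_def] by measurable
  have vol: "emeasure lborel {y. dist x y < \<epsilon>} = ennreal (\<omega> * \<epsilon> powr N)" for x :: "real^'n"
    using emeasure_dist_ball[of \<epsilon> x] \<epsilon> by (simp add: \<omega>_def N_def)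
  have pw: "\<epsilon> powr - N * (\<omega> * \<epsilon> powr N) = \<omega>" using \<epsilon> by (simp add: powr_minus)
  have pointwise: "ennreal \<omega> * ennreal (v x) \<le> ennreal (\<epsilon> powr - N) * U v x + (ennreal (\<epsilon> powr - N) * U h x + (ennreal \<omega> * ennreal (h x) + ennreal (\<omega> * \<eta>)))" for x
  proof -
    have "ennreal \<omega> * ennreal (v x) = ennreal (\<epsilon> powr - N) * ball_int (\<lambda>y. ennreal (v x)) x \<epsilon>"
      using \<omega> v0[of x] pw by (simp add: nn_integral_cmult vol ennreal_mult'[symmetric] mult_ac)
    also have "ball_int (\<lambda>y. ennreal (v x)) x \<epsilon>
      \<le> (\<integral>\<^sup>+y. ennreal (v y) * indicator {y. dist x y < \<epsilon>} y + (ennreal (h y) * indicator {y. dist x y < \<epsilon>} y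
          + ennreal (h x + \<eta>) * indicator {y. dist x y < \<epsilon>} y) \<partial>lborel)"
    proof (rule nn_integral_mono)
      fix y
      have "v x \<le> v y + (h y + (h x + \<eta>))" if "dist x y < \<epsilon>" using \<epsilon>(2)[OF that] by (simp add: h_def)
      then show "ennreal (v x) * indicator {y. dist x y < \<epsilon>} y \<le> ennreal (v y) * indicator {y. dist x y < \<epsilon>} y + (ennreal (h y) * indicator {y. dist x y < \<epsilon>} y
          + ennreal (h x + \<eta>) * indicator {y. dist x y < \<epsilon>} y)"
        using v0[of y] h0[of y] h0[of x] \<eta>(1)
        by (auto split: split_indicator simp: ennreal_plus[symmetric] simp del: ennreal_plus intro!: ennreal_leI)
    qed
    also have "\<dots> = U v x + (U h x + ennreal (h x + \<eta>) * ennreal (\<omega> * \<epsilon> powr N))"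
      unfolding U_def by (subst nn_integral_add; (subst nn_integral_add)?) (auto simp: nn_integral_cmult vol)
    also have "ennreal (\<epsilon> powr - N) * (U v x + (U h x + ennreal (h x + \<eta>) * ennreal (\<omega> * \<epsilon> powr N)))
       = ennreal (\<epsilon> powr - N) * U v x + (ennreal (\<epsilon> powr - N) * U h x + ennreal (\<epsilon> powr - N) * (ennreal (h x + \<eta>) * ennreal (\<omega> * \<epsilon> powr N)))"
      by (simp add: distrib_left)
    also have "ennreal (\<epsilon> powr - N) * (ennreal (h x + \<eta>) * ennreal (\<omega> * \<epsilon> powr N)) = ennreal ((h x + \<eta>) * \<omega>)"
    proof -
      have "\<epsilon> powr - N * ((h x + \<eta>) * (\<omega> * \<epsilon> powr N)) = (h x + \<eta>) * (\<epsilon> powr - N * (\<omega> * \<epsilon> powr N))"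
        by (simp only: mult_ac)
      then have "(h x + \<eta>) * \<omega> = \<epsilon> powr - N * ((h x + \<eta>) * (\<omega> * \<epsilon> powr N))" by (simp only: pw)
      then show ?thesis using \<omega> h0[of x] \<eta>(1) by (simp only:) (simp add: ennreal_mult)
    qed
    also have "ennreal ((h x + \<eta>) * \<omega>) = ennreal \<omega> * ennreal (h x) + ennreal (\<omega> * \<eta>)"
      using \<omega> h0[of x] \<eta>(1) by (simp add: ennreal_mult'[symmetric] ennreal_plus[symmetric] algebra_simps del: ennreal_plus)
    finally show ?thesis by (simp add: mult_left_mono)
  qed
  have "ennreal \<omega> * (\<integral>\<^sup>+x\<in>A. ennreal (v x) \<partial>lborel) = (\<integral>\<^sup>+x\<in>A. ennreal \<omega> * ennreal (v x) \<partial>lborel)"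
    by (subst nn_integral_cmult[symmetric]) (auto simp: mult.assoc)
  also have "\<dots> \<le> (\<integral>\<^sup>+x\<in>A. (ennreal (\<epsilon> powr - N) * U v x + (ennreal (\<epsilon> powr - N) * U h x + (ennreal \<omega> * ennreal (h x) + ennreal (\<omega> * \<eta>)))) \<partial>lborel)"
    by (intro nn_integral_mono mult_right_mono pointwise) auto
  also have "\<dots> = ennreal (\<epsilon> powr - N) * (\<integral>\<^sup>+x\<in>A. U v x \<partial>lborel) +
     (ennreal (\<epsilon> powr - N) * (\<integral>\<^sup>+x\<in>A. U h x \<partial>lborel) +
     (ennreal \<omega> * (\<integral>\<^sup>+x\<in>A. ennreal (h x) \<partial>lborel) + ennreal (\<omega> * \<eta>) * ennreal m))"
    by (simp add: distrib_right mult.assoc nn_integral_add nn_integral_cmult em)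
  also have "\<dots> \<le> Y + (ennreal (e/3) + (ennreal (e/3) + ennreal (e/3)))"
  proof (intro add_mono)
    show "ennreal (\<epsilon> powr - N) * (\<integral>\<^sup>+x\<in>A. U v x \<partial>lborel) \<le> Y"
      unfolding U_def by (rule le[OF \<epsilon>(1)])
    have "ennreal (\<epsilon> powr - N) * (\<integral>\<^sup>+x\<in>A. U h x \<partial>lborel) \<le> ennreal (\<epsilon> powr - N) * ennreal (C * m powr \<theta> * (\<omega> * \<epsilon> powr N))"
      using ball_integral_le_2[OF wh _ _ A, of \<epsilon>] C \<epsilon> by (intro mult_left_mono) (auto simp: U_def \<omega>_def N_def m_def)
    also have "\<dots> = ennreal (\<omega> * C * m powr \<theta>)"
    proof -
      have "\<epsilon> powr - N * (C * m powr \<theta> * (\<omega> * \<epsilon> powr N)) = C * m powr \<theta> * (\<epsilon> powr - N * (\<omega> * \<epsilon> powr N))"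
        by (simp only: mult_ac)
      also have "\<dots> = \<omega> * C * m powr \<theta>" unfolding pw by (simp only: mult_ac)
      finally have E: "\<epsilon> powr - N * (C * m powr \<theta> * (\<omega> * \<epsilon> powr N)) = \<omega> * C * m powr \<theta>" .
      show ?thesis unfolding E[symmetric] by (rule ennreal_mult'[symmetric]) simp
    qed
    also have "\<dots> \<le> ennreal (e/3)" by (intro ennreal_leI C)
    finally show "ennreal (\<epsilon> powr - N) * (\<integral>\<^sup>+x\<in>A. U h x \<partial>lborel) \<le> ennreal (e/3)" .
    have "ennreal \<omega> * (\<integral>\<^sup>+x\<in>A. ennreal (h x) \<partial>lborel) \<le> ennreal \<omega> * ennreal (C * m powr \<theta>)"
      unfolding m_def by (intro mult_left_mono weak_boundD[OF wh A]) auto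
    also have "\<dots> = ennreal (\<omega> * C * m powr \<theta>)" using \<omega> C(1) by (simp add: ennreal_mult'[symmetric] mult.assoc)
    also have "\<dots> \<le> ennreal (e/3)" by (intro ennreal_leI C)
    finally show "ennreal \<omega> * (\<integral>\<^sup>+x\<in>A. ennreal (h x) \<partial>lborel) \<le> ennreal (e/3)" .
    have "ennreal (\<omega> * \<eta>) * ennreal m = ennreal (\<omega> * m * \<eta>)" using \<omega> \<eta>(1) m by (simp add: ennreal_mult'[symmetric] mult_ac)
    also have "\<dots> \<le> ennreal (e/3)" by (intro ennreal_leI \<eta>)
    finally show "ennreal (\<omega> * \<eta>) * ennreal m \<le> ennreal (e/3)" .
  qed
  also have "ennreal (e/3) + (ennreal (e/3) + ennreal (e/3)) = ennreal e"
    using e by (simp add: ennreal_plus[symmetric] del: ennreal_plus)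
  finally show "ennreal (unit_ball_vol N) * (\<integral>\<^sup>+x\<in>A. ennreal (v x) \<partial>lborel) \<le> Y + ennreal e"
    by (simp add: \<omega>_def)
qed

text \<open>The exceptional set is cut down to a ball and to v \<le> n so that the integral of g
  over it is finite; only then does g < v on a set of positive measure give a strict inequality of
  integrals.\<close>

lemma AE_le_if_nn_integral_le:
  fixes v :: "'a::euclidean_space \<Rightarrow> real"
  assumes [measurable]: "v \<in> borel_measurable borel" "g \<in> borel_measurable borel"
    and le: "\<And>A. A \<in> sets borel \<Longrightarrow> emeasure lborel A < \<infinity> \<Longrightarrow>
      (\<integral>\<^sup>+x\<in>A. ennreal (v x) \<partial>lborel) \<le> (\<integral>\<^sup>+x\<in>A. g x \<partial>lborel)"
  shows "AE x in lborel. ennreal (v x) \<le> g x"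
proof -
  define A where "A n = {x. g x < ennreal (v x) \<and> v x \<le> real n} \<inter> ball 0 (real n)" for n
  have [measurable]: "A n \<in> sets borel" for n unfolding A_def by measurable
  have fin: "emeasure lborel (A n) < \<infinity>" for n
  proof -
    have "emeasure lborel (A n) \<le> emeasure lborel (ball (0::'a) (real n))"
      by (intro emeasure_mono) (auto simp: A_def)
    also have "\<dots> < \<infinity>" using emeasure_bounded_finite[of "ball (0::'a) (real n)"] by simp
    finally show ?thesis .
  qed
  have "AE x in lborel. ennreal (v x) * indicator (A n) x \<le> g x * indicator (A n) x" for n
  proof (rule ccontr)
    assume n: "\<not> (AE x in lborel. ennreal (v x) * indicator (A n) x \<le> g x * indicator (A n) x)"
    have "(\<integral>\<^sup>+x. g x * indicator (A n) x \<partial>lborel) \<le> (\<integral>\<^sup>+x. ennreal (real n) * indicator (A n) x \<partial>lborel)"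
    proof (rule nn_integral_mono)
      fix x show "g x * indicator (A n) x \<le> ennreal (real n) * indicator (A n) x"
      proof (cases "x \<in> A n")
        case True
        then have "g x \<le> ennreal (v x)" "ennreal (v x) \<le> ennreal (real n)" by (auto simp: A_def intro: ennreal_leI less_imp_le)
        then have "g x \<le> ennreal (real n)" by (rule order_trans)
        then show ?thesis using True by simp
      qed simp
    qed
    also have "\<dots> < \<infinity>" using fin[of n] by (simp add: nn_integral_cmult ennreal_mult_less_top)
    finally have g: "(\<integral>\<^sup>+x. g x * indicator (A n) x \<partial>lborel) \<noteq> \<infinity>" by simp
    have "(\<integral>\<^sup>+x. g x * indicator (A n) x \<partial>lborel) < (\<integral>\<^sup>+x. ennreal (v x) * indicator (A n) x \<partial>lborel)"
    proof (rule nn_integral_less[OF _ _ g _ n])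
      show "AE x in lborel. g x * indicator (A n) x \<le> ennreal (v x) * indicator (A n) x"
        by (intro AE_I2) (auto simp: A_def split: split_indicator)
    qed auto
    then show False using le[OF _ fin[of n]] by (simp add: not_le[symmetric])
  qed
  then have "AE x in lborel. \<forall>n. ennreal (v x) * indicator (A n) x \<le> g x * indicator (A n) x"
    unfolding AE_all_countable by blast
  then show ?thesis
  proof eventually_elim
    case (elim x)
    show ?case
    proof (rule ccontr)
      assume *: "\<not> ennreal (v x) \<le> g x"
      obtain n :: nat where "max (v x) (norm x) < real n" using reals_Archimedean2 by blast
      then have "x \<in> A n" using * by (auto simp: A_def)
      then show False using elim[rule_format, of n] * by simp
    qed
  qed
qed

text \<open>The first claim is derived from the second: a test function has a finite
  \<open>L^p\<close> integral, and v lies at finite distance from one.\<close>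

lemma D12_Lp:
  fixes u :: "real ^ 'n::finite \<Rightarrow> real"
  defines "p \<equiv> 2 * real CARD('n) / (real CARD('n) - 2)"
  assumes u: "u \<in> D12" and N: "CARD('n) \<ge> 3"
    and v [measurable]: "v \<in> borel_measurable borel" and AE: "AE x in lebesgue. u x = v x"
  shows "(\<integral>\<^sup>+x. ennreal (\<bar>v x\<bar> powr p) \<partial>lborel) < \<infinity>"
    and "\<And>e. e > 0 \<Longrightarrow> \<exists>f\<in>test_functions. (\<integral>\<^sup>+x. ennreal (\<bar>f x - v x\<bar> powr p) \<partial>lborel) \<le> ennreal e"
proof -
  have p: "p > 1" using N by (auto simp: p_def field_simps)
  obtain f where f: "\<And>k. f k \<in> test_functions"
    and lim: "(\<lambda>k. \<integral>\<^sup>+x. ennreal (norm (f k x - u x) powr p) \<partial>lebesgue) \<longlonglongrightarrow> 0"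
    by (rule D12_approx[OF u, folded p_def], rule that)
  note [measurable] = test_measurable[OF f]
  have eq: "(\<integral>\<^sup>+x. ennreal (norm (f k x - u x) powr p) \<partial>lebesgue) = (\<integral>\<^sup>+x. ennreal (\<bar>f k x - v x\<bar> powr p) \<partial>lborel)" for k
  proof -
    have "(\<integral>\<^sup>+x. ennreal (norm (f k x - u x) powr p) \<partial>lebesgue) = (\<integral>\<^sup>+x. ennreal (\<bar>f k x - v x\<bar> powr p) \<partial>lebesgue)"
      using AE by (intro nn_integral_cong_AE) (auto elim!: eventually_mono)
    then show ?thesis by (simp add: nn_integral_completion)
  qed
  show approx: "\<exists>f\<in>test_functions. (\<integral>\<^sup>+x. ennreal (\<bar>f x - v x\<bar> powr p) \<partial>lborel) \<le> ennreal e" if "e > 0" for e :: real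
  proof -
    have "\<forall>\<^sub>F k in sequentially. (\<integral>\<^sup>+x. ennreal (norm (f k x - u x) powr p) \<partial>lebesgue) < ennreal e"
      using that lim by (intro order_tendstoD) auto
    then obtain k where "(\<integral>\<^sup>+x. ennreal (norm (f k x - u x) powr p) \<partial>lebesgue) < ennreal e"
      using eventually_happens by force
    then show ?thesis unfolding eq using f by (intro bexI[of _ "f k"]) auto
  qed
  obtain g where g: "g \<in> test_functions" "(\<integral>\<^sup>+x. ennreal (\<bar>g x - v x\<bar> powr p) \<partial>lborel) \<le> ennreal 1"
    using approx[of 1] by auto
  note [measurable] = test_measurable[OF g(1)]
  obtain B r where B: "B \<ge> 0" "\<And>x. \<bar>g x\<bar> \<le> B" and r: "\<And>x. norm x > r \<Longrightarrow> g x = 0"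
    using test_bounded[OF g(1)] by metis
  have gp: "(\<integral>\<^sup>+x. ennreal (\<bar>g x\<bar> powr p) \<partial>lborel) < \<infinity>"
  proof -
    have "(\<integral>\<^sup>+x. ennreal (\<bar>g x\<bar> powr p) \<partial>lborel) \<le> (\<integral>\<^sup>+x. ennreal (B powr p) * indicator (cball (0::real^'n) r) x \<partial>lborel)"
    proof (rule nn_integral_mono)
      fix x
      show "ennreal (\<bar>g x\<bar> powr p) \<le> ennreal (B powr p) * indicator (cball 0 r) x"
      proof (cases "norm x \<le> r")
        case True
        have "\<bar>g x\<bar> powr p \<le> B powr p" using B p by (intro powr_mono2) auto
        then show ?thesis using True by (simp add: ennreal_leI)
      qed (use r[of x] in auto)
    qed
    also have "\<dots> < \<infinity>" using emeasure_bounded_finite[of "cball (0::real^'n) r"]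
      by (simp add: nn_integral_cmult_indicator ennreal_mult_less_top)
    finally show ?thesis .
  qed
  have "(\<integral>\<^sup>+x. ennreal (\<bar>v x\<bar> powr p) \<partial>lborel)
    \<le> (\<integral>\<^sup>+x. ennreal (2 powr p) * (ennreal (\<bar>g x\<bar> powr p) + ennreal (\<bar>g x - v x\<bar> powr p)) \<partial>lborel)"
  proof (rule nn_integral_mono)
    fix x
    have "\<bar>v x\<bar> \<le> \<bar>g x\<bar> + \<bar>g x - v x\<bar>" by arith
    also have "\<dots> \<le> max \<bar>g x\<bar> \<bar>g x - v x\<bar> + max \<bar>g x\<bar> \<bar>g x - v x\<bar>" by (intro add_mono) auto
    finally have "\<bar>v x\<bar> \<le> 2 * max \<bar>g x\<bar> \<bar>g x - v x\<bar>" by simp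
    then have "\<bar>v x\<bar> powr p \<le> (2 * max \<bar>g x\<bar> \<bar>g x - v x\<bar>) powr p" using p by (intro powr_mono2) auto
    also have "\<dots> = 2 powr p * max \<bar>g x\<bar> \<bar>g x - v x\<bar> powr p" by (rule powr_mult) 
    also have "\<dots> \<le> 2 powr p * (\<bar>g x\<bar> powr p + \<bar>g x - v x\<bar> powr p)"
      by (intro mult_left_mono) (auto simp: max_def)
    finally show "ennreal (\<bar>v x\<bar> powr p) \<le> ennreal (2 powr p) * (ennreal (\<bar>g x\<bar> powr p) + ennreal (\<bar>g x - v x\<bar> powr p))"
      by (simp add: ennreal_plus[symmetric] ennreal_mult'[symmetric] ennreal_leI del: ennreal_plus)
  qed
  also have "\<dots> = ennreal (2 powr p) * ((\<integral>\<^sup>+x. ennreal (\<bar>g x\<bar> powr p) \<partial>lborel) + (\<integral>\<^sup>+x. ennreal (\<bar>g x - v x\<bar> powr p) \<partial>lborel))"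
    by (simp add: nn_integral_cmult nn_integral_add)
  also have "\<dots> < \<infinity>"
  proof -
    have "(\<integral>\<^sup>+x. ennreal (\<bar>g x - v x\<bar> powr p) \<partial>lborel) < \<infinity>" using g(2) by (simp add: le_less_trans)
    then show ?thesis using gp by (simp add: ennreal_mult_less_top)
  qed
  finally show "(\<integral>\<^sup>+x. ennreal (\<bar>v x\<bar> powr p) \<partial>lborel) < \<infinity>" .
qed

text \<open>Bounding the right-hand side by a nonnegative integral makes its integrability irrelevant:
  a non-integrable function has Bochner integral 0.\<close>

lemma weak_inequality:
  fixes u v :: "real ^ 'n::finite \<Rightarrow> real" and s q lam :: "nat \<Rightarrow> real"
  assumes N: "CARD('n) \<ge> 3" and u: "u \<in> D12"
    and v [measurable]: "v \<in> borel_measurable borel" and AE: "AE x in lebesgue. u x = v x"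
    and eq: "\<forall>\<phi>\<in>D12. (\<integral>x. weak_grad u x \<bullet> weak_grad \<phi> x \<partial>lebesgue) =
           (\<Sum>i=0..l. lam i * (\<integral>x. u x powr q i * \<phi> x / norm x powr s i \<partial>lebesgue))"
    and \<psi>: "\<psi> \<in> test_functions"
  shows "ennreal (\<integral>x. v x * - (\<Sum>i\<in>UNIV. partial_deriv i (partial_deriv i \<psi>) x) \<partial>lborel)
    \<le> (\<integral>\<^sup>+x. ennreal (\<Sum>i=0..l. \<bar>lam i\<bar> * (v x powr q i / norm x powr s i)) * ennreal \<bar>\<psi> x\<bar> \<partial>lborel)"
proof -
  define L where "L x = - (\<Sum>i\<in>UNIV. partial_deriv i (partial_deriv i \<psi>) x)" for x
  have [measurable]: "L \<in> borel_measurable borel" unfolding L_def[abs_def]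
    by (intro borel_measurable_uminus borel_measurable_sum test_measurable test_partial_deriv \<psi>)
  note [measurable] = test_measurable[OF \<psi>]
  have um: "u \<in> borel_measurable lebesgue" using u by (simp add: D12_def)
  have lebm: "h \<in> borel_measurable lebesgue" if "h \<in> borel_measurable borel" for h :: "real^'n \<Rightarrow> real"
    using that by (simp add: measurable_completion)
  define I where "I i = (\<integral>x. u x powr q i * \<psi> x / norm x powr s i \<partial>lebesgue)" for i
  define J where "J i = (\<integral>\<^sup>+x. ennreal (v x powr q i / norm x powr s i) * ennreal \<bar>\<psi> x\<bar> \<partial>lborel)" for i
  have IJ: "ennreal \<bar>I i\<bar> \<le> J i" for i
  proof -
    have "I i = (\<integral>x. v x powr q i * \<psi> x / norm x powr s i \<partial>lebesgue)"
      unfolding I_def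
    proof (rule integral_cong_AE)
      show m: "(\<lambda>x. v x powr q i * \<psi> x / norm x powr s i) \<in> borel_measurable lebesgue" by (intro lebm) measurable
      show AE': "AE x in lebesgue. u x powr q i * \<psi> x / norm x powr s i = v x powr q i * \<psi> x / norm x powr s i"
        using AE by eventually_elim simp
      show "(\<lambda>x. u x powr q i * \<psi> x / norm x powr s i) \<in> borel_measurable lebesgue"
        by (rule measurable_completion_AE[OF m AE'])
    qed
    also have "\<dots> = (\<integral>x. v x powr q i * \<psi> x / norm x powr s i \<partial>lborel)"
      by (rule integral_completion) measurable
    finally have I: "I i = (\<integral>x. v x powr q i * \<psi> x / norm x powr s i \<partial>lborel)" .
    have "ennreal \<bar>I i\<bar> \<le> (\<integral>\<^sup>+x. ennreal (norm (v x powr q i * \<psi> x / norm x powr s i)) \<partial>lborel)"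
    proof (cases "integrable lborel (\<lambda>x. v x powr q i * \<psi> x / norm x powr s i)")
      case True
      then show ?thesis unfolding I using integral_norm_bound_ennreal by fastforce
    qed (simp add: I not_integrable_integral_eq)
    also have "\<dots> = J i" unfolding J_def
      by (intro nn_integral_cong) (simp add: abs_mult ennreal_mult'[symmetric])
    finally show ?thesis .
  qed
  have "(\<integral>x. v x * L x \<partial>lborel) = (\<integral>x. v x * L x \<partial>lebesgue)"
    by (rule integral_completion[symmetric]) measurable
  also have "\<dots> = (\<integral>x. u x * L x \<partial>lebesgue)"
  proof (rule integral_cong_AE)
    show "(\<lambda>x. v x * L x) \<in> borel_measurable lebesgue" by (intro lebm) measurable
    show "(\<lambda>x. u x * L x) \<in> borel_measurable lebesgue"
      by (rule borel_measurable_times[OF um lebm]) measurable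
    show "AE x in lebesgue. v x * L x = u x * L x" using AE by eventually_elim simp
  qed
  also have "\<dots> = (\<integral>x. weak_grad u x \<bullet> weak_grad \<psi> x \<partial>lebesgue)"
    unfolding integral_weak_grad[OF u N \<psi>] L_def by simp
  also have "\<dots> = (\<Sum>i=0..l. lam i * I i)" using eq test_in_D12[OF \<psi>] by (simp add: I_def)
  \<comment> \<open>Under \<open>ennreal\<close> a negative value becomes 0, so only an upper bound
    is carried on, and this is all that the comparison requires.\<close>
  finally have "ennreal (\<integral>x. v x * L x \<partial>lborel) = ennreal (\<Sum>i=0..l. lam i * I i)" by simp
  also have "\<dots> \<le> ennreal (\<Sum>i=0..l. \<bar>lam i\<bar> * \<bar>I i\<bar>)"
    by (intro ennreal_leI sum_mono) (simp add: abs_mult[symmetric])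
  also have "\<dots> = (\<Sum>i=0..l. ennreal \<bar>lam i\<bar> * ennreal \<bar>I i\<bar>)"
    by (simp add: sum_ennreal[symmetric] ennreal_mult)
  also have "\<dots> \<le> (\<Sum>i=0..l. ennreal \<bar>lam i\<bar> * J i)" by (intro sum_mono mult_left_mono IJ) auto
  also have "\<dots> = (\<integral>\<^sup>+x. (\<Sum>i=0..l. ennreal \<bar>lam i\<bar> * (ennreal (v x powr q i / norm x powr s i) * ennreal \<bar>\<psi> x\<bar>)) \<partial>lborel)"
    unfolding J_def by (subst nn_integral_sum) (auto simp: nn_integral_cmult)
  also have "\<dots> = (\<integral>\<^sup>+x. ennreal (\<Sum>i=0..l. \<bar>lam i\<bar> * (v x powr q i / norm x powr s i)) * ennreal \<bar>\<psi> x\<bar> \<partial>lborel)"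
  proof (rule nn_integral_cong)
    fix x
    have "ennreal (\<Sum>i=0..l. \<bar>lam i\<bar> * (v x powr q i / norm x powr s i)) = (\<Sum>i=0..l. ennreal \<bar>lam i\<bar> * ennreal (v x powr q i / norm x powr s i))"
      by (subst sum_ennreal[symmetric]) (simp_all add: ennreal_mult'[symmetric])
    then show "(\<Sum>i=0..l. ennreal \<bar>lam i\<bar> * (ennreal (v x powr q i / norm x powr s i) * ennreal \<bar>\<psi> x\<bar>))
      = ennreal (\<Sum>i=0..l. \<bar>lam i\<bar> * (v x powr q i / norm x powr s i)) * ennreal \<bar>\<psi> x\<bar>"
      by (simp only: sum_distrib_right mult.assoc)
  qed
  finally show ?thesis by (simp add: L_def)
qed

lemma ennreal_add_le: "0 \<le> b \<Longrightarrow> ennreal (a + b) \<le> ennreal a + ennreal b"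
  by (cases "0 \<le> a") (auto simp: ennreal_neg intro: ennreal_leI)

text \<open>The cut-off error enters as \<open>R^(-2)\<close> times the truncated potential W R of
  v, whose growth in R is controlled after integration over A. This is why the averages are compared
  in integrated form before R tends to infinity.\<close>

lemma ball_average_le_potential:
  fixes v F :: "real ^ 'n::finite \<Rightarrow> real"
  defines "N \<equiv> real CARD('n)"
  assumes N: "CARD('n) \<ge> 3"
    and v [measurable]: "v \<in> borel_measurable borel" and v0: "\<And>x. 0 \<le> v x"
    and vint: "\<And>\<phi>. \<phi> \<in> test_functions \<Longrightarrow> integrable lborel (\<lambda>x. v x * \<phi> x)"
    and F [measurable]: "F \<in> borel_measurable borel"
    and wk: "weak_bound \<theta> C (\<lambda>x. ennreal (v x))" "0 \<le> C" "0 \<le> \<theta>" "\<theta> < 1"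
    and ineq: "\<And>\<psi>. \<psi> \<in> test_functions \<Longrightarrow>
      ennreal (\<integral>x. v x * - (\<Sum>i\<in>UNIV. partial_deriv i (partial_deriv i \<psi>) x) \<partial>lborel)
        \<le> (\<integral>\<^sup>+x. ennreal (F x) * ennreal \<bar>\<psi> x\<bar> \<partial>lborel)"
  shows "\<exists>c>0. \<forall>A \<epsilon>. A \<in> sets borel \<longrightarrow> emeasure lborel A < \<infinity> \<longrightarrow> \<epsilon> > 0 \<longrightarrow>
     ennreal (\<epsilon> powr - N) * (\<integral>\<^sup>+x\<in>A. ball_int (\<lambda>y. ennreal (v y)) x \<epsilon> \<partial>lborel)
      \<le> ennreal c * (\<integral>\<^sup>+x\<in>A. riesz (\<lambda>y. ennreal (F y)) x \<partial>lborel)"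
proof -
  obtain c B where c: "c > 0" and B: "B \<ge> 0" and fs: "\<And>\<epsilon> R (a::real^'n). \<epsilon> > 0 \<Longrightarrow> R > 0 \<Longrightarrow> 2 * \<epsilon>\<^sup>2 \<le> R\<^sup>2 \<Longrightarrow>
    (\<exists>\<psi>\<in>test_functions. \<forall>x. x \<noteq> a \<longrightarrow>
      \<bar>\<psi> x\<bar> \<le> norm (a - x) powr (2 - N) \<and>
      c * \<epsilon> powr - N * indicator {x. dist a x < \<epsilon>} x
        - B / R\<^sup>2 * (norm (a - x) powr (2 - N) * indicator {x. dist a x < R} x)
      \<le> - (\<Sum>i\<in>UNIV. partial_deriv i (partial_deriv i \<psi>) x))"
    using almost_fundamental_solution[OF N] unfolding N_def by blast
  define k where "k = 2 powr (N - 1)"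
  have k: "k > 0" by (simp add: k_def)
  define W where "W R x = (\<integral>\<^sup>+t. indicator {0..2 * R} t * ennreal (t powr (1 - N)) *
      ball_int (\<lambda>y. ennreal (v y)) x t \<partial>lborel)" for R and x :: "real^'n"
  have [measurable]: "W R \<in> borel_measurable borel" for R unfolding W_def[abs_def] by measurable
  define U where "U \<epsilon> x = ball_int (\<lambda>y. ennreal (v y)) x \<epsilon>" for \<epsilon> and x :: "real^'n"
  have [measurable]: "U \<epsilon> \<in> borel_measurable borel" for \<epsilon> unfolding U_def[abs_def] by measurable
  have pointwise: "ennreal (c * \<epsilon> powr - N) * U \<epsilon> a
      \<le> ennreal k * riesz (\<lambda>y. ennreal (F y)) a + ennreal (B * k / R\<^sup>2) * W R a"
    if \<epsilon>: "\<epsilon> > 0" and R: "R > 0" "2 * \<epsilon>\<^sup>2 \<le> R\<^sup>2" for \<epsilon> R a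
  proof -
    obtain \<psi> where \<psi>: "\<psi> \<in> test_functions" "\<And>x. x \<noteq> a \<Longrightarrow> \<bar>\<psi> x\<bar> \<le> norm (a - x) powr (2 - N)"
      "\<And>x. x \<noteq> a \<Longrightarrow> c * \<epsilon> powr - N * indicator {x. dist a x < \<epsilon>} x
        - B / R\<^sup>2 * (norm (a - x) powr (2 - N) * indicator {x. dist a x < R} x)
      \<le> - (\<Sum>i\<in>UNIV. partial_deriv i (partial_deriv i \<psi>) x)"
      using fs[OF \<epsilon> R, of a] by blast
    note [measurable] = test_measurable[OF \<psi>(1)]
    define L where "L x = - (\<Sum>i\<in>UNIV. partial_deriv i (partial_deriv i \<psi>) x)" for x
    define E where "E x = B / R\<^sup>2 * (norm (a - x) powr (2 - N) * indicator {x. dist a x < R} x)" for x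
    define D where "D x = c * \<epsilon> powr - N * indicator {x. dist a x < \<epsilon>} x" for x
    have [measurable]: "L \<in> borel_measurable borel" unfolding L_def[abs_def]
      by (intro borel_measurable_uminus borel_measurable_sum test_measurable test_partial_deriv \<psi>)
    have [measurable]: "E \<in> borel_measurable borel" "D \<in> borel_measurable borel"
      unfolding E_def[abs_def] D_def[abs_def] by measurable
    have E0: "E x \<ge> 0" for x using B by (simp add: E_def)
    have D0: "D x \<ge> 0" for x using c by (simp add: D_def)
    have DLE: "D x \<le> L x + E x" if "x \<noteq> a" for x using \<psi>(3)[OF that] by (simp add: D_def L_def E_def)
    \<comment> \<open>The estimates for \<psi> hold away from the pole a, which is a null
      set.\<close>
    have ae: "AE x in lborel. x \<noteq> a" by (rule AE_lborel_singleton)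
    have intL: "integrable lborel (\<lambda>x. v x * L x)"
    proof -
      have "(\<lambda>x. v x * L x) = (\<lambda>x. - (\<Sum>i\<in>UNIV. v x * partial_deriv i (partial_deriv i \<psi>) x))"
        by (simp add: L_def sum_distrib_left)
      then show ?thesis
        by (simp only:) (intro integrable_minus Bochner_Integration.integrable_sum vint test_partial_deriv \<psi>)
    qed
    have main: "(\<integral>\<^sup>+x. ennreal (v x * D x) \<partial>lborel) \<le> (\<integral>\<^sup>+x. ennreal (F x) * ennreal \<bar>\<psi> x\<bar> \<partial>lborel) + (\<integral>\<^sup>+x. ennreal (v x * E x) \<partial>lborel)"
    \<comment> \<open>If the error integral is infinite the claim is trivial; otherwise v E is
      integrable, and the Bochner integrals of v L and v E may be added.\<close>
    proof (cases "(\<integral>\<^sup>+x. ennreal (v x * E x) \<partial>lborel) = \<infinity>")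
      case False
      have intE: "integrable lborel (\<lambda>x. v x * E x)"
      proof (rule integrableI_bounded)
        show "(\<integral>\<^sup>+x. ennreal (norm (v x * E x)) \<partial>lborel) < \<infinity>" using False v0 E0 by (simp add: less_top)
      qed measurable
      have "(\<integral>\<^sup>+x. ennreal (v x * D x) \<partial>lborel) \<le> (\<integral>\<^sup>+x. ennreal (v x * L x + v x * E x) \<partial>lborel)"
      proof (rule nn_integral_mono_AE)
        show "AE x in lborel. ennreal (v x * D x) \<le> ennreal (v x * L x + v x * E x)"
          using ae by eventually_elim (auto simp: distrib_left[symmetric] intro!: ennreal_leI mult_left_mono DLE v0)
      qed
      also have "\<dots> = ennreal (\<integral>x. v x * L x + v x * E x \<partial>lborel)"
      proof (rule nn_integral_eq_integral)
        show "integrable lborel (\<lambda>x. v x * L x + v x * E x)" using intL intE by simp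
        show "AE x in lborel. 0 \<le> v x * L x + v x * E x"
          using ae
        proof eventually_elim
          case (elim x)
          have "0 \<le> v x * D x" using v0 D0 by simp
          also have "\<dots> \<le> v x * (L x + E x)" by (intro mult_left_mono DLE elim v0)
          finally show ?case by (simp add: distrib_left)
        qed
      qed
      also have "(\<integral>x. v x * L x + v x * E x \<partial>lborel) = (\<integral>x. v x * L x \<partial>lborel) + (\<integral>x. v x * E x \<partial>lborel)"
        using intL intE by simp
      also have "ennreal \<dots> \<le> ennreal (\<integral>x. v x * L x \<partial>lborel) + ennreal (\<integral>x. v x * E x \<partial>lborel)"
        using v0 E0 by (intro ennreal_add_le Bochner_Integration.integral_nonneg) simp
      also have "\<dots> \<le> (\<integral>\<^sup>+x. ennreal (F x) * ennreal \<bar>\<psi> x\<bar> \<partial>lborel) + (\<integral>\<^sup>+x. ennreal (v x * E x) \<partial>lborel)"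
      proof (rule add_mono)
        show "ennreal (\<integral>x. v x * L x \<partial>lborel) \<le> (\<integral>\<^sup>+x. ennreal (F x) * ennreal \<bar>\<psi> x\<bar> \<partial>lborel)"
          unfolding L_def by (rule ineq[OF \<psi>(1)])
        show "ennreal (\<integral>x. v x * E x \<partial>lborel) \<le> (\<integral>\<^sup>+x. ennreal (v x * E x) \<partial>lborel)"
          using intE v0 E0 by (simp add: nn_integral_eq_integral)
      qed
      finally show ?thesis .
    qed simp
    have "ennreal (c * \<epsilon> powr - N) * U \<epsilon> a = (\<integral>\<^sup>+x. ennreal (v x * D x) \<partial>lborel)"
      unfolding U_def using c v0
      by (subst nn_integral_cmult[symmetric])
         (auto simp: D_def ennreal_mult'[symmetric] mult.commute split: split_indicator intro!: nn_integral_cong)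
    also note main
    also have "(\<integral>\<^sup>+x. ennreal (F x) * ennreal \<bar>\<psi> x\<bar> \<partial>lborel) \<le> ennreal k * riesz (\<lambda>y. ennreal (F y)) a"
    proof -
      have "(\<integral>\<^sup>+x. ennreal (F x) * ennreal \<bar>\<psi> x\<bar> \<partial>lborel) \<le> (\<integral>\<^sup>+x. ennreal (F x) * ennreal (norm (a - x) powr (2 - N)) * indicator UNIV x \<partial>lborel)"
        using ae by (intro nn_integral_mono_AE) (auto elim!: eventually_mono intro!: mult_left_mono ennreal_leI \<psi>(2))
      also have "\<dots> \<le> ennreal k * riesz (\<lambda>y. ennreal (F y)) a"
        using riesz_kernel_le[of "\<lambda>y. ennreal (F y)" "{0..}" UNIV a]
        by (simp add: riesz_def k_def N_def subset_eq order_trans[OF zero_le_dist less_imp_le])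
      finally show ?thesis .
    qed
    also have "(\<integral>\<^sup>+x. ennreal (v x * E x) \<partial>lborel) \<le> ennreal (B * k / R\<^sup>2) * W R a"
    proof -
      have "(\<integral>\<^sup>+x. ennreal (v x * E x) \<partial>lborel) = ennreal (B / R\<^sup>2) *
         (\<integral>\<^sup>+x. ennreal (v x) * ennreal (norm (a - x) powr (2 - N)) * indicator {x. dist a x < R} x \<partial>lborel)"
        using B v0
        by (subst nn_integral_cmult[symmetric])
           (auto simp: E_def ennreal_mult'[symmetric] mult_ac split: split_indicator intro!: nn_integral_cong)
      also have "\<dots> \<le> ennreal (B / R\<^sup>2) * (ennreal k * W R a)"
      proof (rule mult_left_mono)
        \<comment> \<open>For points within distance R of a, \<open>riesz_kernel_le\<close> uses
          radii up to 2R only; this is the truncation in W.\<close>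
        have sub: "{dist a y<..2 * dist a y} \<subseteq> {0..2 * R}" if "y \<in> {x. dist a x < R}" for y
        proof
          fix t assume "t \<in> {dist a y<..2 * dist a y}"
          then have "dist a y < t" "t \<le> 2 * dist a y" "dist a y < R" using that by auto
          then show "t \<in> {0..2 * R}" using zero_le_dist[of a y] unfolding atLeastAtMost_iff by (intro conjI; linarith)
        qed
        show "(\<integral>\<^sup>+x. ennreal (v x) * ennreal (norm (a - x) powr (2 - N)) * indicator {x. dist a x < R} x \<partial>lborel) \<le> ennreal k * W R a"
          using riesz_kernel_le[where h = "\<lambda>y. ennreal (v y)" and S = "{0..2 * R}" and P = "{x. dist a x < R}" and x = a, OF _ _ _ sub]
          by (simp add: W_def k_def N_def)
      qed simp
      also have "\<dots> = ennreal (B * k / R\<^sup>2) * W R a"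
        using B k by (simp add: mult.assoc[symmetric] ennreal_mult'[symmetric])
      finally show ?thesis .
    qed
    finally show ?thesis by (simp add: add_mono)
  qed
  have "ennreal (\<epsilon> powr - N) * (\<integral>\<^sup>+x\<in>A. U \<epsilon> x \<partial>lborel)
      \<le> ennreal (k / c) * (\<integral>\<^sup>+x\<in>A. riesz (\<lambda>y. ennreal (F y)) x \<partial>lborel)"
    if A: "A \<in> sets borel" "emeasure lborel A < \<infinity>" and \<epsilon>: "\<epsilon> > 0" for A \<epsilon>
  proof -
    note [measurable] = A(1)
    define Y where "Y = (\<integral>\<^sup>+x\<in>A. riesz (\<lambda>y. ennreal (F y)) x \<partial>lborel)"
    define X where "X = (\<integral>\<^sup>+x\<in>A. U \<epsilon> x \<partial>lborel)"
    obtain K \<sigma> where \<sigma>: "\<sigma> > 0" and K: "\<And>R. R \<ge> 0 \<Longrightarrow>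
      (\<integral>\<^sup>+x. (\<integral>\<^sup>+t. indicator {0..R} t * ennreal (t powr (1 - N)) *
        ball_int (\<lambda>y. ennreal (v y)) x t \<partial>lborel) * indicator A x \<partial>lborel)
      \<le> ennreal (K * R powr (2 - \<sigma>))"
      using truncated_riesz_growth[OF wk A] unfolding N_def by auto
    \<comment> \<open>The integrated cut-off error; it is a constant multiple of
      \<open>R powr - \<sigma>\<close>.\<close>
    define b where "b R = B * k / R\<^sup>2 * (K * (2 * R) powr (2 - \<sigma>))" for R
    have le: "ennreal (c * \<epsilon> powr - N) * X \<le> ennreal k * Y + ennreal (b R)"
      if R: "R > 0" "2 * \<epsilon>\<^sup>2 \<le> R\<^sup>2" for R
    proof -
      have "ennreal (c * \<epsilon> powr - N) * X = (\<integral>\<^sup>+x\<in>A. ennreal (c * \<epsilon> powr - N) * U \<epsilon> x \<partial>lborel)"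
        unfolding X_def by (subst nn_integral_cmult[symmetric]) (auto simp: mult.assoc)
      also have "\<dots> \<le> (\<integral>\<^sup>+x\<in>A. (ennreal k * riesz (\<lambda>y. ennreal (F y)) x + ennreal (B * k / R\<^sup>2) * W R x) \<partial>lborel)"
        by (intro nn_integral_mono mult_right_mono pointwise \<epsilon> R) auto
      also have "\<dots> = ennreal k * Y + ennreal (B * k / R\<^sup>2) * (\<integral>\<^sup>+x\<in>A. W R x \<partial>lborel)"
        unfolding Y_def by (simp add: distrib_right mult.assoc nn_integral_add nn_integral_cmult)
      also have "\<dots> \<le> ennreal k * Y + ennreal (B * k / R\<^sup>2) * ennreal (K * (2 * R) powr (2 - \<sigma>))"
        using K[of "2 * R"] R by (intro add_left_mono mult_left_mono) (auto simp: W_def)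
      also have "\<dots> = ennreal k * Y + ennreal (b R)"
        using B k by (simp add: b_def ennreal_mult'[symmetric])
      finally show ?thesis .
    qed
    have "(b \<longlongrightarrow> 0) at_top"
    proof -
      have "((\<lambda>R. B * k * K * 2 powr (2 - \<sigma>) * R powr - \<sigma>) \<longlongrightarrow> B * k * K * 2 powr (2 - \<sigma>) * 0) at_top"
        using \<sigma> by (intro tendsto_mult tendsto_const tendsto_neg_powr filterlim_ident) auto
      moreover have "\<forall>\<^sub>F R in at_top. B * k * K * 2 powr (2 - \<sigma>) * R powr - \<sigma> = b R"
        using eventually_gt_at_top[of 0]
      proof eventually_elim
        case (elim R)
        have "R powr (2 - \<sigma>) = R\<^sup>2 * R powr - \<sigma>" using elim powr_add[of R 2 "- \<sigma>"] by simp
        then show ?case using elim by (simp add: b_def powr_mult)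
      qed
      ultimately show ?thesis by (simp add: tendsto_cong)
    qed
    then have "((\<lambda>R. ennreal k * Y + ennreal (b R)) \<longlongrightarrow> ennreal k * Y + ennreal 0) at_top"
      by (intro tendsto_add tendsto_const tendsto_ennrealI)
    moreover have "\<forall>\<^sub>F R in at_top. ennreal (c * \<epsilon> powr - N) * X \<le> ennreal k * Y + ennreal (b R)"
      using eventually_ge_at_top[of "2 * \<epsilon>"]
    proof eventually_elim
      case (elim R)
      have "2 * \<epsilon>\<^sup>2 \<le> (2 * \<epsilon>)\<^sup>2" by (simp add: power2_eq_square)
      also have "\<dots> \<le> R\<^sup>2" using elim \<epsilon> by (intro power_mono) auto
      finally show ?case using elim \<epsilon> by (intro le) auto
    qed
    ultimately have "ennreal (c * \<epsilon> powr - N) * X \<le> ennreal k * Y + ennreal 0"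
      by (intro tendsto_lowerbound[where F = at_top]) auto
    then have "ennreal (1 / c) * (ennreal (c * \<epsilon> powr - N) * X) \<le> ennreal (1 / c) * (ennreal k * Y)"
      by (intro mult_left_mono) auto
    then show ?thesis using c k unfolding X_def[symmetric] Y_def[symmetric]
      by (simp add: mult.assoc[symmetric] ennreal_mult'[symmetric])
  qed
  then show ?thesis using c k unfolding U_def by (intro exI[of _ "k / c"]) auto
qed

theorem proposition1:
  fixes u :: "real ^ 'n::finite \<Rightarrow> real"
    and l :: nat
    and s lam :: "nat \<Rightarrow> real"
  assumes "CARD('n) \<ge> 3"
    and "\<And>i. i \<in> {1..l} \<Longrightarrow> 0 < s i \<and> s i < 2"
    and "\<And>i. i \<in> {1..l} \<Longrightarrow> lam i \<noteq> 0"
    and "s 0 = 0" and "lam 0 = 1"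
    and "u \<in> D12"
    and "AE x in lebesgue. 0 \<le> u x"
    and "\<forall>\<phi>\<in>D12. (\<integral>x. weak_grad u x \<bullet> weak_grad \<phi> x \<partial>lebesgue) =
           (\<Sum>i=0..l. lam i *
              (\<integral>x. u x powr (crit_exp CARD('n) (s i) - 1) * \<phi> x / norm x powr s i \<partial>lebesgue))"
  shows "u \<in> Linf_loc"
proof -
  define N where "N = real CARD('n)"
  have N3: "N \<ge> 3" using assms(1) by (simp add: N_def)
  have DN: "real DIM(real^'n) = N" by (simp add: N_def)
  define e where "e = 4 / (N - 2)"
  define q where "q i = e * (1 - s i / 2) + 1" for i
  have e: "e > 0" using N3 by (simp add: e_def)
  \<comment> \<open>Brings the exponents of the equation into the form that
    \<open>young_critical\<close> expects.\<close>
  have q: "crit_exp CARD('n) (s i) - 1 = q i" for i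
    using N3 by (simp add: crit_exp_def q_def e_def N_def[symmetric] field_simps)
  have s: "0 \<le> s i" "s i < 2" if "i \<in> {0..l}" for i
    using assms(2)[of i] assms(4) that by (cases "i = 0"; force)+
  have um: "u \<in> borel_measurable lebesgue" using assms(6) by (simp add: D12_def)
  obtain u' where u': "u' \<in> borel_measurable lborel" "AE x in lborel. u x = u' x"
    using completion_ex_borel_measurable_real[OF um] by auto
  \<comment> \<open>A Borel representative of u that is nonnegative everywhere and not just almost
    everywhere.\<close>
  define v where "v x = max 0 (u' x)" for x
  have v [measurable]: "v \<in> borel_measurable borel" using u'(1) unfolding v_def[abs_def] by simp
  have v0: "v x \<ge> 0" for x by (simp add: v_def)
  have AE: "AE x in lebesgue. u x = v x"
    using AE_completion[OF u'(2)] assms(7) by eventually_elim (simp add: v_def)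
  define p where "p = 2 * N / (N - 2)"
  have p: "p > 1" using N3 by (auto simp: p_def field_simps)
  have fin: "(\<integral>\<^sup>+x. ennreal (v x powr p) \<partial>lborel) < \<infinity>"
    using D12_Lp(1)[OF assms(6,1) v AE] v0 by (simp add: p_def N_def)
  have approx: "\<exists>f\<in>test_functions. (\<integral>\<^sup>+x. ennreal (\<bar>f x - v x\<bar> powr p) \<partial>lborel) \<le> ennreal e" if "e > 0" for e
    using D12_Lp(2)[OF assms(6,1) v AE that] by (simp add: p_def N_def)
  obtain K where K: "(\<integral>\<^sup>+x. ennreal (v x powr p) \<partial>lborel) \<le> ennreal K" "K > 0"
  proof -
    obtain k where "k \<ge> 0" "(\<integral>\<^sup>+x. ennreal (v x powr p) \<partial>lborel) = ennreal k"
      using fin by (metis ennreal_cases infinity_ennreal_def less_irrefl)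
    then show ?thesis using that[of "k + 1"] by (simp add: ennreal_leI)
  qed
  have wk: "weak_bound (1 - 1/p) (2 * K powr (1/p)) (\<lambda>x. ennreal (v x))"
    by (intro weak_bound_Lp v v0 p K)
  \<comment> \<open>The absolute values make F a majorant of the right-hand side whatever the signs
    of the coefficients.\<close>
  define F where "F x = (\<Sum>i=0..l. \<bar>lam i\<bar> * (v x powr q i / norm x powr s i))" for x
  have F [measurable]: "F \<in> borel_measurable borel" unfolding F_def[abs_def] by measurable
  have vint: "integrable lborel (\<lambda>x. v x * \<phi> x)" if \<phi>: "\<phi> \<in> test_functions" for \<phi>
  proof -
    have sv: "set_integrable lebesgue K v" if "compact K" for K
    proof (rule set_integrable_Lp[OF _ _ _ p])
      show "v \<in> borel_measurable lebesgue" using v by (simp add: measurable_completion)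
      show "(\<integral>\<^sup>+x. ennreal (norm (v x) powr p) \<partial>lebesgue) < \<infinity>"
        using fin v0 by (simp add: nn_integral_completion)
    qed (use compact_emeasure_lebesgue[OF that] in auto)
    have "integrable lebesgue (\<lambda>x. v x * \<phi> x)" by (rule integrable_mult_test[OF _ \<phi>]) (rule sv)
    then show ?thesis using v test_measurable[OF \<phi>] by (simp add: integrable_completion)
  qed
  have ineq: "ennreal (\<integral>x. v x * - (\<Sum>i\<in>UNIV. partial_deriv i (partial_deriv i \<psi>) x) \<partial>lborel)
        \<le> (\<integral>\<^sup>+x. ennreal (F x) * ennreal \<bar>\<psi> x\<bar> \<partial>lborel)" if "\<psi> \<in> test_functions" for \<psi>
    using weak_inequality[OF assms(1,6) v AE assms(8)[unfolded q] that] by (simp add: F_def)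
  obtain c where c: "c > 0" and avg: "\<And>A \<epsilon>. A \<in> sets borel \<Longrightarrow> emeasure lborel A < \<infinity> \<Longrightarrow> \<epsilon> > 0 \<Longrightarrow>
     ennreal (\<epsilon> powr - N) * (\<integral>\<^sup>+x\<in>A. ball_int (\<lambda>y. ennreal (v y)) x \<epsilon> \<partial>lborel)
      \<le> ennreal c * (\<integral>\<^sup>+x\<in>A. riesz (\<lambda>y. ennreal (F y)) x \<partial>lborel)"
    using ball_average_le_potential[OF assms(1) v v0 vint F wk _ _ _ ineq] K p unfolding N_def by auto
  define \<omega> where "\<omega> = unit_ball_vol N"
  have \<omega>: "\<omega> > 0" by (simp add: \<omega>_def N_def)
  have le: "AE x in lborel. ennreal (v x) \<le> ennreal (c / \<omega>) * riesz (\<lambda>y. ennreal (F y)) x"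
  proof (rule AE_le_if_nn_integral_le)
    fix A :: "(real^'n) set" assume A: "A \<in> sets borel" "emeasure lborel A < \<infinity>"
    note [measurable] = A(1)
    have "ennreal \<omega> * (\<integral>\<^sup>+x\<in>A. ennreal (v x) \<partial>lborel)
      \<le> ennreal c * (\<integral>\<^sup>+x\<in>A. riesz (\<lambda>y. ennreal (F y)) x \<partial>lborel)"
      using ball_average_lower_bound[OF v v0 p approx A avg[OF A, unfolded N_def]] by (simp add: \<omega>_def N_def)
    then have "ennreal (1 / \<omega>) * (ennreal \<omega> * (\<integral>\<^sup>+x\<in>A. ennreal (v x) \<partial>lborel))
      \<le> ennreal (1 / \<omega>) * (ennreal c * (\<integral>\<^sup>+x\<in>A. riesz (\<lambda>y. ennreal (F y)) x \<partial>lborel))"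
      by (rule mult_left_mono) simp
    then show "(\<integral>\<^sup>+x\<in>A. ennreal (v x) \<partial>lborel)
      \<le> (\<integral>\<^sup>+x\<in>A. ennreal (c / \<omega>) * riesz (\<lambda>y. ennreal (F y)) x \<partial>lborel)"
      using \<omega> c by (simp add: mult.assoc[symmetric] ennreal_mult'[symmetric])
        (simp add: mult.assoc nn_integral_cmult)
  qed auto
  have growth: "\<exists>b>0. \<forall>x. F x \<le> \<epsilon> * norm x powr - 2 * v x + b * (v x powr e * v x)" if \<epsilon>: "\<epsilon> > 0" for \<epsilon>
  proof -
    \<comment> \<open>Giving each summand the tolerance \<epsilon>/\<Lambda> makes the total,
      weighted by the absolute values of the coefficients, at most \<epsilon>.\<close>
    define \<Lambda> where "\<Lambda> = (\<Sum>i=0..l. \<bar>lam i\<bar>) + 1"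
    have \<Lambda>: "\<Lambda> > 0" "(\<Sum>i=0..l. \<bar>lam i\<bar>) \<le> \<Lambda>" by (auto simp: \<Lambda>_def intro!: add_nonneg_pos sum_nonneg)
    have "\<forall>i\<in>{0..l}. \<exists>b>0. \<forall>t\<ge>0. \<forall>r\<ge>0. t powr q i / r powr s i \<le> \<epsilon> / \<Lambda> * r powr - 2 * t + b * (t powr e * t)"
      unfolding q_def by (intro ballI young_critical s e divide_pos_pos \<epsilon> \<Lambda>(1))
    then obtain b where b: "\<And>i. i \<in> {0..l} \<Longrightarrow> b i > 0"
      "\<And>i t r. i \<in> {0..l} \<Longrightarrow> t \<ge> 0 \<Longrightarrow> r \<ge> 0 \<Longrightarrow> t powr q i / r powr s i \<le> \<epsilon> / \<Lambda> * r powr - 2 * t + b i * (t powr e * t)"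
      by metis
    define b' where "b' = (\<Sum>i=0..l. \<bar>lam i\<bar> * b i) + 1"
    have b': "b' > 0" unfolding b'_def using b(1) by (intro add_nonneg_pos sum_nonneg mult_nonneg_nonneg) (auto simp: less_imp_le)
    have "F x \<le> \<epsilon> * norm x powr - 2 * v x + b' * (v x powr e * v x)" for x
    proof -
      define Y where "Y = norm x powr - 2 * v x"
      define Z where "Z = v x powr e * v x"
      have YZ: "Y \<ge> 0" "Z \<ge> 0" using v0[of x] by (auto simp: Y_def Z_def)
      have "F x \<le> (\<Sum>i=0..l. \<bar>lam i\<bar> * (\<epsilon> / \<Lambda> * norm x powr - 2 * v x + b i * (v x powr e * v x)))"
        unfolding F_def by (intro sum_mono mult_left_mono b(2) v0) auto
      also have "\<dots> = (\<Sum>i=0..l. \<bar>lam i\<bar> * (\<epsilon> / \<Lambda> * Y) + \<bar>lam i\<bar> * b i * Z)"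
        by (intro sum.cong refl) (simp add: Y_def Z_def distrib_left mult.assoc)
      also have "\<dots> = (\<Sum>i=0..l. \<bar>lam i\<bar>) * (\<epsilon> / \<Lambda> * Y) + (\<Sum>i=0..l. \<bar>lam i\<bar> * b i) * Z"
        by (simp only: sum.distrib sum_distrib_right)
      also have "\<dots> \<le> \<Lambda> * (\<epsilon> / \<Lambda> * Y) + b' * Z"
        using \<Lambda> \<epsilon> YZ by (intro add_mono mult_right_mono) (auto simp: b'_def)
      also have "\<dots> = \<epsilon> * norm x powr - 2 * v x + b' * (v x powr e * v x)"
        using \<Lambda>(1) by (simp add: Y_def Z_def)
      finally show ?thesis .
    qed
    then show ?thesis using b' by blast
  qed
  have weak: "\<exists>C\<ge>0. weak_bound \<theta> C (\<lambda>x. ennreal (v x))" if "1/2 + 1/N \<le> \<theta>" "\<theta> < 1" for \<theta>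
    using potential_weak_bound[of v F "c / \<omega>" \<theta>] N3 v F v0 fin growth c \<omega> le that
    unfolding DN p_def e_def by simp
  have "\<exists>K\<ge>0. \<forall>x. riesz (\<lambda>y. ennreal (v y powr q i / norm y powr s i)) x \<le> ennreal K" if "i \<in> {0..l}" for i
    using riesz_power_bounded[of v "s i"] N3 v v0 fin weak s[OF that]
    unfolding DN p_def q_def e_def by simp
  then obtain B where B: "\<And>i. i \<in> {0..l} \<Longrightarrow> B i \<ge> 0"
    "\<And>i x. i \<in> {0..l} \<Longrightarrow> riesz (\<lambda>y. ennreal (v y powr q i / norm y powr s i)) x \<le> ennreal (B i)"
    by metis
  define B' where "B' = (\<Sum>i=0..l. \<bar>lam i\<bar> * B i)"
  have B': "B' \<ge> 0" unfolding B'_def using B(1) by (intro sum_nonneg) auto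
  have "riesz (\<lambda>y. ennreal (F y)) x \<le> ennreal B'" for x
  proof -
    have "(\<lambda>y. ennreal (F y)) = (\<lambda>y. \<Sum>i=0..l. ennreal \<bar>lam i\<bar> * ennreal (v y powr q i / norm y powr s i))"
      unfolding F_def by (subst sum_ennreal[symmetric]) (simp_all add: ennreal_mult'[symmetric])
    then have "riesz (\<lambda>y. ennreal (F y)) x = (\<Sum>i=0..l. ennreal \<bar>lam i\<bar> * riesz (\<lambda>y. ennreal (v y powr q i / norm y powr s i)) x)"
      by (simp add: riesz_sum riesz_cmult)
    also have "\<dots> \<le> (\<Sum>i=0..l. ennreal \<bar>lam i\<bar> * ennreal (B i))" by (intro sum_mono mult_left_mono B(2)) auto
    also have "\<dots> = (\<Sum>i=0..l. ennreal (\<bar>lam i\<bar> * B i))" by (simp add: ennreal_mult')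
    also have "\<dots> = ennreal B'" unfolding B'_def using B(1) by (intro sum_ennreal) auto
    finally show ?thesis .
  qed
  then have "AE x in lborel. v x \<le> c / \<omega> * B'"
    using le
  proof (elim eventually_mono)
    fix x assume "ennreal (v x) \<le> ennreal (c / \<omega>) * riesz (\<lambda>y. ennreal (F y)) x"
    also have "\<dots> \<le> ennreal (c / \<omega>) * ennreal B'"
      by (intro mult_left_mono \<open>\<And>x. riesz (\<lambda>y. ennreal (F y)) x \<le> ennreal B'\<close>) simp
    also have "\<dots> = ennreal (c / \<omega> * B')" using c \<omega> by (intro ennreal_mult'[symmetric]) simp
    finally show "v x \<le> c / \<omega> * B'" using c \<omega> B' by simp
  qed
  then have "AE x in lebesgue. v x \<le> c / \<omega> * B'" by (rule AE_completion)
  with AE have bound: "AE x in lebesgue. \<bar>u x\<bar> \<le> c / \<omega> * B'"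
  proof eventually_elim
    case (elim x)
    then show ?case using v0[of x] by simp
  qed
  show ?thesis unfolding Linf_loc_def
  proof (intro CollectI conjI allI impI)
    \<comment> \<open>The bound obtained holds on the whole space, so one constant serves every
      compact K.\<close>
    show "\<exists>C. AE x in lebesgue. x \<in> K \<longrightarrow> \<bar>u x\<bar> \<le> C" for K
      using bound by (intro exI[of _ "c / \<omega> * B'"]) (auto elim: eventually_mono)
  qed (rule um)
qed

end
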